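(* Let $k$ be a field and let $\Lambda=k\langle x,y\rangle/I$ be a finite-dimensional local selfinjective $k$-algebra whose radical $J=J(\Lambda)$ has $x,y$ as independent generators, with $\Lambda/J=k$. Suppose that: (1) there is a minimal relation $\psi_1x+\psi_2y=0$ with $\psi_1,\psi_2\in J$ linearly independent modulo $J^2$; (2) there are minimal relations $\sigma_1x+\sigma_2y=0$ and $\theta_1x+\theta_2y=0$ such that, writing $\psi=(\psi_1,\psi_2)$, $\sigma=(\sigma_1,\sigma_2)$, $\theta=(\theta_1,\theta_2)\in\Lambda^2$, the elements $\sigma,\theta$ are $k$-linearly independent modulo $\Lambda\psi$; (3) there are elements $\rho_1,\rho_2,\rho_3,\rho_4\in\Lambda$ with $$x\sigma+\rho_1\psi=0,\quad y\sigma+\rho_2\psi=0,\quad x\theta+\rho_3\psi=0,\quad y\theta+\rho_4\psi=0,$$ $$\sigma_1\rho_1+\sigma_2\rho_2=0,\quad \psi_1\rho_1+\psi_2\rho_2=0,\quad \psi_1\rho_3+\psi_2\rho_4=0,\quad \theta_1\rho_3+\theta_2\rho_4=0,$$ $$\theta_1\rho_1+\theta_2\rho_2=\omega \ \text{ for some } 0\neq\omega\in\operatorname{soc}\Lambda,\qquad \theta_1\rho_1+\theta_2\rho_2+c(\sigma_1\rho_3+\sigma_2\rho_4)=0 \ \text{ for some } 0\neq c\in k.$$ Then the cohomology algebra $H^*(\Lambda,k)=\operatorname{Ext}^*_\Lambda(k,k)$ is a finitely generated $k$-algebra, and it is generated by elements in degrees $1$ and $2$.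
   Context: Modules are left modules. $k=\Lambda/J$ is the trivial module. "Independent generators" means that $x,y$ generate $J$ and their classes are linearly independent in $J/J^2$. $\Lambda^2$ is a left $\Lambda$-module by componentwise multiplication; a relation $ax+by=0$ is identified with the pair $(a,b)\in\Omega^2(k)=\{(a,b)\in\Lambda^2\mid ax+by=0\}$, and it is called minimal if $(a,b)\notin J\,\Omega^2(k)$. $\operatorname{Ext}^*_\Lambda(k,k)$ carries the Yoneda product; its degree $0$ part is $k$. *)

theory Defs
  imports Complex_Main "HOL-Algebra.Module" "HOL-Library.Function_Algebras" "HOL-Library.Product_Plus"
begin

section \<open>Left modules over a not necessarily commutative ring\<close>

text \<open>
  The ring is a type of class \<^class>\<open>ring_1\<close>. A left module is an additively closed subset of a
  type of class \<^class>\<open>ab_group_add\<close> with an action that only matters on that subset; every module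
  arises in this way. Left ideals are the left modules \<open>I\<close> for the action \<open>(*)\<close>.
\<close>

locale left_module =
  fixes act :: "'l::ring_1 \<Rightarrow> 'm::ab_group_add \<Rightarrow> 'm" and M :: "'m set"
  assumes zero_mem: "0 \<in> M"
    and add_mem: "u \<in> M \<Longrightarrow> v \<in> M \<Longrightarrow> u + v \<in> M"
    and act_mem: "u \<in> M \<Longrightarrow> act a u \<in> M"
    and act_add_right: "u \<in> M \<Longrightarrow> v \<in> M \<Longrightarrow> act a (u + v) = act a u + act a v"
    and act_add_left: "u \<in> M \<Longrightarrow> act (a + b) u = act a u + act b u"
    and act_mult: "u \<in> M \<Longrightarrow> act (a * b) u = act a (act b u)"
    and act_one: "u \<in> M \<Longrightarrow> act 1 u = u"

definition left_hom ::
  "('l::ring_1 \<Rightarrow> 'm::ab_group_add \<Rightarrow> 'm) \<Rightarrow> 'm set \<Rightarrow>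
   ('l \<Rightarrow> 'n::ab_group_add \<Rightarrow> 'n) \<Rightarrow> 'n set \<Rightarrow> ('m \<Rightarrow> 'n) \<Rightarrow> bool" where
  "left_hom act M act' N f \<longleftrightarrow>
     (\<forall>u\<in>M. f u \<in> N) \<and> (\<forall>u\<in>M. \<forall>v\<in>M. f (u + v) = f u + f v) \<and>
     (\<forall>a. \<forall>u\<in>M. f (act a u) = act' a (f u))"

definition has_basis :: "('l::ring_1 \<Rightarrow> 'm::ab_group_add \<Rightarrow> 'm) \<Rightarrow> 'm set \<Rightarrow> bool" where
  "has_basis act M \<longleftrightarrow> (\<exists>B\<subseteq>M. \<forall>u\<in>M. \<exists>!c :: 'm \<Rightarrow> 'l.
     finite {b. c b \<noteq> 0} \<and> {b. c b \<noteq> 0} \<subseteq> B \<and> u = (\<Sum>b | c b \<noteq> 0. act (c b) b))"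

text \<open>\<open>I N\<close>: the finite sums of products \<open>a u\<close> with \<open>a \<in> I\<close> and \<open>u \<in> N\<close>.\<close>

definition ideal_times ::
  "('l::ring_1 \<Rightarrow> 'm::ab_group_add \<Rightarrow> 'm) \<Rightarrow> 'l set \<Rightarrow> 'm set \<Rightarrow> 'm set" where
  "ideal_times act I N =
     {\<Sum>i<n. act (a i) (u i) | (n::nat) a u. \<forall>i<n. a i \<in> I \<and> u i \<in> N}"

definition maximal_left_ideal :: "'l::ring_1 set \<Rightarrow> bool" where
  "maximal_left_ideal M \<longleftrightarrow> left_module (*) M \<and> M \<noteq> UNIV \<and>
     (\<forall>I. left_module (*) I \<longrightarrow> M \<subseteq> I \<longrightarrow> I = M \<or> I = UNIV)"

definition minimal_left_ideal :: "'l::ring_1 set \<Rightarrow> bool" where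
  "minimal_left_ideal M \<longleftrightarrow> left_module (*) M \<and> M \<noteq> {0} \<and>
     (\<forall>I. left_module (*) I \<longrightarrow> I \<subseteq> M \<longrightarrow> I = {0} \<or> I = M)"

definition jacobson_radical :: "'l::ring_1 set" where
  "jacobson_radical = \<Inter> {M. maximal_left_ideal M}"

text \<open>The socle of the left regular module: the sum of its simple submodules.\<close>

definition socle :: "'l::ring_1 set" where
  "socle = {\<Sum>i<n. a i | (n::nat) a. \<forall>i<n. \<exists>M. minimal_left_ideal M \<and> a i \<in> M}"

definition local_ring :: "'l::ring_1 itself \<Rightarrow> bool" where
  "local_ring _ \<longleftrightarrow> (\<exists>!M :: 'l set. maximal_left_ideal M)"

text \<open>
  The ring is injective as a left module over itself. HOL cannot quantify over the modules of all
  types, so the test modules \<open>N \<subseteq> M\<close> are those carried by subgroups of the sequence group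
  \<open>nat \<Rightarrow> 'l\<close>, with arbitrary actions. For a nonzero finite-dimensional algebra every finitely
  generated module is isomorphic to one of these (as a vector space it is some \<open>k\<^sup>n\<close>, which embeds
  additively), so this is injectivity in the category of finitely generated modules and, as the
  left ideals are among the submodules tested, also in the category of all modules.
\<close>

definition selfinjective :: "'l::ring_1 itself \<Rightarrow> bool" where
  "selfinjective _ \<longleftrightarrow>
     (\<forall>(act :: 'l \<Rightarrow> (nat \<Rightarrow> 'l) \<Rightarrow> (nat \<Rightarrow> 'l)) M N f.
        left_module act M \<longrightarrow> left_module act N \<longrightarrow> N \<subseteq> M \<longrightarrow> left_hom act N (*) (UNIV :: 'l set) f \<longrightarrow>
        (\<exists>g. left_hom act M (*) UNIV g \<and> (\<forall>u\<in>N. g u = f u)))"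


section \<open>Algebras\<close>

locale fd_algebra = vector_space scale
  for scale :: "'k::field \<Rightarrow> 'l::ring_1 \<Rightarrow> 'l" +
  assumes scale_mult_left: "scale c (a * b) = scale c a * b"
    and scale_mult_right: "scale c (a * b) = a * scale c b"
    and finite_dim: "\<exists>B. finite B \<and> span B = UNIV"

text \<open>
  The subalgebra generated by a set \<open>S\<close>. Only the record of operations from HOL-Algebra is used; its
  locale \<open>algebra\<close> is for commutative algebras.
\<close>

inductive_set subalgebra_gen :: "('k, 'a, 'e) module_scheme \<Rightarrow> 'a set \<Rightarrow> 'a set"
  for A :: "('k, 'a, 'e) module_scheme" and S :: "'a set" where
  one: "\<one>\<^bsub>A\<^esub> \<in> subalgebra_gen A S"
| incl: "u \<in> S \<Longrightarrow> u \<in> subalgebra_gen A S"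
| add: "u \<in> subalgebra_gen A S \<Longrightarrow> v \<in> subalgebra_gen A S \<Longrightarrow> u \<oplus>\<^bsub>A\<^esub> v \<in> subalgebra_gen A S"
| mult: "u \<in> subalgebra_gen A S \<Longrightarrow> v \<in> subalgebra_gen A S \<Longrightarrow> u \<otimes>\<^bsub>A\<^esub> v \<in> subalgebra_gen A S"
| smult: "u \<in> subalgebra_gen A S \<Longrightarrow> c \<odot>\<^bsub>A\<^esub> u \<in> subalgebra_gen A S"

definition generates_algebra :: "('k, 'a, 'e) module_scheme \<Rightarrow> 'a set \<Rightarrow> bool" where
  "generates_algebra A S \<longleftrightarrow> S \<subseteq> carrier A \<and> subalgebra_gen A S = carrier A"

definition finitely_generated_algebra :: "('k, 'a, 'e) module_scheme \<Rightarrow> bool" where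
  "finitely_generated_algebra A \<longleftrightarrow> (\<exists>S. finite S \<and> generates_algebra A S)"

definition type_algebra :: "('k \<Rightarrow> 'l::ring_1 \<Rightarrow> 'l) \<Rightarrow> ('k, 'l) module" where
  "type_algebra scale =
     \<lparr>carrier = UNIV, mult = (*), one = 1, zero = 0, add = (+), smult = scale\<rparr>"

definition lin_indep_mod ::
  "('k::zero \<Rightarrow> 'm::ab_group_add \<Rightarrow> 'm) \<Rightarrow> 'm set \<Rightarrow> 'm \<Rightarrow> 'm \<Rightarrow> bool" where
  "lin_indep_mod scale N u v \<longleftrightarrow> (\<forall>c d. scale c u + scale d v \<in> N \<longrightarrow> c = 0 \<and> d = 0)"

definition act2 :: "('a \<Rightarrow> 'm \<Rightarrow> 'm) \<Rightarrow> 'a \<Rightarrow> 'm \<times> 'm \<Rightarrow> 'm \<times> 'm" where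
  "act2 act a = (\<lambda>(u, v). (act a u, act a v))"

definition Omega2 :: "'l::ring_1 \<Rightarrow> 'l \<Rightarrow> ('l \<times> 'l) set" where
  "Omega2 x y = {(a, b). a * x + b * y = 0}"

definition minimal_relation :: "'l::ring_1 \<Rightarrow> 'l \<Rightarrow> 'l \<times> 'l \<Rightarrow> bool" where
  "minimal_relation x y p \<longleftrightarrow>
     p \<in> Omega2 x y \<and> p \<notin> ideal_times (act2 (*)) jacobson_radical (Omega2 x y)"

text \<open>
  \<open>\<Lambda>/J = k\<close> means that the structure map \<open>k \<rightarrow> \<Lambda>/J\<close> is bijective. Then \<open>\<Lambda>\<close> acts on the trivial
  module \<open>k = \<Lambda>/J\<close> (here the type of scalars) through the inverse of this map.
\<close>

definition residue_field_is_base :: "('k \<Rightarrow> 'l::ring_1 \<Rightarrow> 'l) \<Rightarrow> bool" where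
  "residue_field_is_base scale \<longleftrightarrow> (\<forall>a. \<exists>!c. a - scale c 1 \<in> jacobson_radical)"

definition augmentation :: "('k \<Rightarrow> 'l::ring_1 \<Rightarrow> 'l) \<Rightarrow> 'l \<Rightarrow> 'k" where
  "augmentation scale a = (THE c. a - scale c 1 \<in> jacobson_radical)"

definition trivial_act :: "('k::field \<Rightarrow> 'l::ring_1 \<Rightarrow> 'l) \<Rightarrow> 'l \<Rightarrow> 'k \<Rightarrow> 'k" where
  "trivial_act scale a c = augmentation scale a * c"


section \<open>Free resolutions\<close>

text \<open>
  \<open>\<cdots> \<rightarrow> P\<^sub>2 \<rightarrow> P\<^sub>1 \<rightarrow> P\<^sub>0 \<rightarrow> M \<rightarrow> 0\<close> with \<open>P\<^sub>n\<close> the module \<open>res_mod R n\<close>, \<open>res_d R n : P\<^sub>n\<^sub>+\<^sub>1 \<rightarrow> P\<^sub>n\<close>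
  and \<open>res_aug R : P\<^sub>0 \<rightarrow> M\<close>.
\<close>

record ('l, 'p, 'm) resolution =
  res_mod :: "nat \<Rightarrow> 'p set"
  res_act :: "nat \<Rightarrow> 'l \<Rightarrow> 'p \<Rightarrow> 'p"
  res_d :: "nat \<Rightarrow> 'p \<Rightarrow> 'p"
  res_aug :: "'p \<Rightarrow> 'm"

definition free_resolution ::
  "('l::ring_1 \<Rightarrow> 'm::ab_group_add \<Rightarrow> 'm) \<Rightarrow> 'm set \<Rightarrow>
   ('l, 'p::ab_group_add, 'm) resolution \<Rightarrow> bool" where
  "free_resolution act M R \<longleftrightarrow>
     (\<forall>n. left_module (res_act R n) (res_mod R n) \<and> has_basis (res_act R n) (res_mod R n)) \<and>
     (\<forall>n. left_hom (res_act R (Suc n)) (res_mod R (Suc n)) (res_act R n) (res_mod R n) (res_d R n)) \<and>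
     left_hom (res_act R 0) (res_mod R 0) act M (res_aug R) \<and>
     res_aug R ` res_mod R 0 = M \<and>
     {u \<in> res_mod R 0. res_aug R u = 0} = res_d R 0 ` res_mod R (Suc 0) \<and>
     (\<forall>n. {u \<in> res_mod R (Suc n). res_d R n u = 0} = res_d R (Suc n) ` res_mod R (Suc (Suc n)))"


section \<open>The Ext algebra of the trivial module\<close>

text \<open>
  \<open>Ext\<^sup>n(k,k)\<close> is the \<open>n\<close>-th cohomology of \<open>Hom(P,k)\<close> for a free resolution \<open>P\<close> of \<open>k\<close>. Cochains are
  taken to be \<open>0\<close> outside \<open>P\<^sub>n\<close>, so that equality of cochains is equality of functions.
  A cohomology class is the set of the cocycles in it; its zero is the set of coboundaries.
\<close>

definition cochains ::
  "('k::field \<Rightarrow> 'l::ring_1 \<Rightarrow> 'l) \<Rightarrow> ('l, 'p::ab_group_add, 'k) resolution \<Rightarrow> nat \<Rightarrow> ('p \<Rightarrow> 'k) set"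
  where
  "cochains scale R n =
     {f. left_hom (res_act R n) (res_mod R n) (trivial_act scale) UNIV f \<and>
         (\<forall>u. u \<notin> res_mod R n \<longrightarrow> f u = 0)}"

definition cocycles ::
  "('k::field \<Rightarrow> 'l::ring_1 \<Rightarrow> 'l) \<Rightarrow> ('l, 'p::ab_group_add, 'k) resolution \<Rightarrow> nat \<Rightarrow> ('p \<Rightarrow> 'k) set"
  where
  "cocycles scale R n =
     {f \<in> cochains scale R n. \<forall>u\<in>res_mod R (Suc n). f (res_d R n u) = 0}"

fun coboundaries ::
  "('k::field \<Rightarrow> 'l::ring_1 \<Rightarrow> 'l) \<Rightarrow> ('l, 'p::ab_group_add, 'k) resolution \<Rightarrow> nat \<Rightarrow> ('p \<Rightarrow> 'k) set"
  where
  "coboundaries scale R 0 = {0}"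
| "coboundaries scale R (Suc n) =
     (\<lambda>g u. if u \<in> res_mod R (Suc n) then g (res_d R n u) else 0) ` cochains scale R n"

definition ext_class ::
  "('k::field \<Rightarrow> 'l::ring_1 \<Rightarrow> 'l) \<Rightarrow> ('l, 'p::ab_group_add, 'k) resolution \<Rightarrow> nat \<Rightarrow>
   ('p \<Rightarrow> 'k) \<Rightarrow> ('p \<Rightarrow> 'k) set" where
  "ext_class scale R n f = {g \<in> cocycles scale R n. g - f \<in> coboundaries scale R n}"

definition Ext ::
  "('k::field \<Rightarrow> 'l::ring_1 \<Rightarrow> 'l) \<Rightarrow> ('l, 'p::ab_group_add, 'k) resolution \<Rightarrow> nat \<Rightarrow>
   ('p \<Rightarrow> 'k) set set" where
  "Ext scale R n = ext_class scale R n ` cocycles scale R n"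

text \<open>The chain maps \<open>G\<^sub>i : P\<^sub>n\<^sub>+\<^sub>i \<rightarrow> P\<^sub>i\<close> that lift a cocycle \<open>g : P\<^sub>n \<rightarrow> k\<close>.\<close>

definition chain_lifts ::
  "('l::ring_1, 'p::ab_group_add, 'k::field) resolution \<Rightarrow> nat \<Rightarrow> ('p \<Rightarrow> 'k) \<Rightarrow>
   (nat \<Rightarrow> 'p \<Rightarrow> 'p) set" where
  "chain_lifts R n g =
     {G. (\<forall>i. left_hom (res_act R (n + i)) (res_mod R (n + i)) (res_act R i) (res_mod R i) (G i)) \<and>
         (\<forall>u\<in>res_mod R n. res_aug R (G 0 u) = g u) \<and>
         (\<forall>i. \<forall>u\<in>res_mod R (Suc (n + i)). G i (res_d R (n + i) u) = res_d R i (G (Suc i) u))}"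

text \<open>
  The Yoneda product \<open>Ext\<^sup>m \<times> Ext\<^sup>n \<rightarrow> Ext\<^sup>m\<^sup>+\<^sup>n\<close>: the product of the classes of \<open>f\<close> and \<open>g\<close> is the class of
  \<open>f \<circ> G\<^sub>m\<close>. The operations on classes are unions over all choices of representatives and of the
  lift; all choices give the same class. Other conventions change this product by the sign
  \<open>(-1)\<^sup>m\<^sup>n\<close> or by the order of the factors, which does not affect what a set of homogeneous elements
  generates.
\<close>

definition yoneda_product ::
  "('k::field \<Rightarrow> 'l::ring_1 \<Rightarrow> 'l) \<Rightarrow> ('l, 'p::ab_group_add, 'k) resolution \<Rightarrow> nat \<Rightarrow> nat \<Rightarrow>
   ('p \<Rightarrow> 'k) set \<Rightarrow> ('p \<Rightarrow> 'k) set \<Rightarrow> ('p \<Rightarrow> 'k) set" where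
  "yoneda_product scale R m n \<alpha> \<beta> =
     (\<Union>f\<in>\<alpha>. \<Union>g\<in>\<beta>. \<Union>G\<in>chain_lifts R n g.
        ext_class scale R (m + n) (\<lambda>u. if u \<in> res_mod R (m + n) then f (G m u) else 0))"

text \<open>
  \<open>Ext\<^sup>*(k,k)\<close>, the direct sum of the \<open>Ext\<^sup>n(k,k)\<close>: an element is a sequence of classes, almost all
  zero. The class of the augmentation \<open>P\<^sub>0 \<rightarrow> k\<close> is the unit.
\<close>

definition Ext_algebra ::
  "('k::field \<Rightarrow> 'l::ring_1 \<Rightarrow> 'l) \<Rightarrow> ('l, 'p::ab_group_add, 'k) resolution \<Rightarrow>
   ('k, nat \<Rightarrow> ('p \<Rightarrow> 'k) set) module" where
  "Ext_algebra scale R =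
     \<lparr>carrier = {\<alpha>. (\<forall>n. \<alpha> n \<in> Ext scale R n) \<and> finite {n. \<alpha> n \<noteq> coboundaries scale R n}},
      mult = (\<lambda>\<alpha> \<beta> n.
        \<Union>h\<in>{h. \<forall>i\<le>n. h i \<in> yoneda_product scale R i (n - i) (\<alpha> i) (\<beta> (n - i))}.
          ext_class scale R n (\<Sum>i\<le>n. h i)),
      one = (\<lambda>n. if n = 0
        then ext_class scale R 0 (\<lambda>u. if u \<in> res_mod R 0 then res_aug R u else 0)
        else coboundaries scale R n),
      zero = coboundaries scale R,
      add = (\<lambda>\<alpha> \<beta> n. \<Union>f\<in>\<alpha> n. \<Union>g\<in>\<beta> n. ext_class scale R n (f + g)),
      smult = (\<lambda>c \<alpha> n. \<Union>f\<in>\<alpha> n. ext_class scale R n (\<lambda>u. c * f u))\<rparr>"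

definition Ext_homogeneous ::
  "('k::field \<Rightarrow> 'l::ring_1 \<Rightarrow> 'l) \<Rightarrow> ('l, 'p::ab_group_add, 'k) resolution \<Rightarrow> nat \<Rightarrow>
   (nat \<Rightarrow> ('p \<Rightarrow> 'k) set) set" where
  "Ext_homogeneous scale R n =
     {\<alpha> \<in> carrier (Ext_algebra scale R). \<forall>m. m \<noteq> n \<longrightarrow> \<alpha> m = coboundaries scale R m}"


section \<open>Existence of free resolutions of the trivial module\<close>

text \<open>
  A statement about all free resolutions of \<open>k\<close> is not vacuous: one exists by the modules
  \<open>\<Lambda>\<^sup>r\<close>, here the sequences that vanish from index \<open>r\<close> on.
\<close>


definition std_free :: "nat \<Rightarrow> (nat \<Rightarrow> 'l::ring_1) set" where
  "std_free r = {v. \<forall>i\<ge>r. v i = 0}"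

definition std_act :: "'l::ring_1 \<Rightarrow> (nat \<Rightarrow> 'l) \<Rightarrow> (nat \<Rightarrow> 'l)" where
  "std_act a v = (\<lambda>i. a * v i)"

definition unit_vec :: "nat \<Rightarrow> nat \<Rightarrow> 'l::ring_1" where
  "unit_vec i = (\<lambda>j. if j = i then 1 else 0)"

lemma sum_fun_apply: "(\<Sum>i\<in>A. f i) j = (\<Sum>i\<in>A. f i j)"
  by (induction A rule: infinite_finite_induct) auto

lemma left_module_std: "left_module std_act (std_free r)"
  by unfold_locales (auto simp: std_act_def std_free_def fun_eq_iff algebra_simps)

lemma unit_vec_inj: "unit_vec i = (unit_vec j :: nat \<Rightarrow> 'l::ring_1) \<longleftrightarrow> i = j"
  unfolding unit_vec_def fun_eq_iff by (metis zero_neq_one)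

lemma std_expand:
  fixes v :: "nat \<Rightarrow> 'l::ring_1"
  assumes "v \<in> std_free r"
  shows "v = (\<Sum>i<r. std_act (v i) (unit_vec i))"
proof
  fix j
  have "(\<Sum>i<r. std_act (v i) (unit_vec i)) j = (\<Sum>i<r. if i = j then v i else 0)"
    unfolding sum_fun_apply by (rule sum.cong) (auto simp: std_act_def unit_vec_def)
  also have "\<dots> = v j"
    using assms by (auto simp: std_free_def)
  finally show "v j = (\<Sum>i<r. std_act (v i) (unit_vec i)) j" ..
qed

lemma has_basis_std: "has_basis std_act (std_free r :: (nat \<Rightarrow> 'l::ring_1) set)"
  unfolding has_basis_def
proof (intro exI[of _ "unit_vec ` {..<r}"] conjI ballI)
  show "unit_vec ` {..<r} \<subseteq> (std_free r :: (nat \<Rightarrow> 'l) set)"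
    by (auto simp: std_free_def unit_vec_def)
next
  fix v :: "nat \<Rightarrow> 'l" assume v: "v \<in> std_free r"
  let ?e = "unit_vec :: nat \<Rightarrow> nat \<Rightarrow> 'l"
  have inj: "inj_on ?e A" for A by (auto simp: inj_on_def unit_vec_inj)
  have sum_eq: "(\<Sum>b | c b \<noteq> 0. std_act (c b) b) = (\<Sum>i<r. std_act (c (?e i)) (?e i))"
    if "{b. c b \<noteq> 0} \<subseteq> ?e ` {..<r}" for c
  proof -
    have "(\<Sum>b | c b \<noteq> 0. std_act (c b) b) = (\<Sum>b\<in>?e ` {..<r}. std_act (c b) b)"
      using that by (intro sum.mono_neutral_left) (auto simp: std_act_def fun_eq_iff)
    also have "\<dots> = (\<Sum>i<r. std_act (c (?e i)) (?e i))"
      by (subst sum.reindex[OF inj]) simp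
    finally show ?thesis .
  qed
  define c0 where "c0 = (\<lambda>b. if b \<in> ?e ` {..<r} then v (the_inv ?e b) else 0)"
  have c0: "c0 (?e i) = v i" if "i < r" for i
    using that the_inv_f_f[OF inj, of i] by (simp add: c0_def)
  have c0_supp: "{b. c0 b \<noteq> 0} \<subseteq> ?e ` {..<r}" by (auto simp: c0_def)
  show "\<exists>!c. finite {b. c b \<noteq> 0} \<and> {b. c b \<noteq> 0} \<subseteq> ?e ` {..<r}
      \<and> v = (\<Sum>b | c b \<noteq> 0. std_act (c b) b)"
  proof (rule ex1I[of _ c0])
    show "finite {b. c0 b \<noteq> 0} \<and> {b. c0 b \<noteq> 0} \<subseteq> ?e ` {..<r}
      \<and> v = (\<Sum>b | c0 b \<noteq> 0. std_act (c0 b) b)"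
      using c0_supp finite_subset[OF c0_supp] c0 std_expand[OF v] by (simp add: sum_eq)
  next
    fix c assume c: "finite {b. c b \<noteq> 0} \<and> {b. c b \<noteq> 0} \<subseteq> ?e ` {..<r}
      \<and> v = (\<Sum>b | c b \<noteq> 0. std_act (c b) b)"
    then have eq: "v = (\<Sum>i<r. std_act (c (?e i)) (?e i))" using sum_eq[of c] by simp
    have ce: "c (?e j) = v j" if "j < r" for j
    proof -
      have "v j = (\<Sum>i<r. std_act (c (?e i)) (?e i)) j" using eq by simp
      also have "\<dots> = (\<Sum>i<r. if i = j then c (?e i) else 0)"
        unfolding sum_fun_apply by (rule sum.cong) (auto simp: std_act_def unit_vec_def)
      finally show ?thesis using that by simp
    qed
    show "c = c0"
    proof
      fix b show "c b = c0 b"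
      proof (cases "b \<in> ?e ` {..<r}")
        case True then show ?thesis using ce c0 by auto
      next
        case False
        then have "c b = 0" and "c0 b = 0" using c c0_supp by auto
        then show ?thesis by simp
      qed
    qed
  qed
qed

text \<open>A finite-dimensional algebra is Noetherian.\<close>

lemma (in fd_algebra) submodule_cover:
  fixes K :: "(nat \<Rightarrow> 'l) set"
  assumes K: "left_module std_act K" and sub: "K \<subseteq> std_free r"
  shows "\<exists>s g. left_hom std_act (std_free s) std_act K g \<and> g ` std_free s = K"
proof -
  interpret K: left_module std_act K by fact
  define vs :: "'k \<Rightarrow> (nat \<Rightarrow> 'l) \<Rightarrow> (nat \<Rightarrow> 'l)" where "vs = (\<lambda>c v i. scale c (v i))"
  interpret V: vector_space vs
    by unfold_locales (auto simp: vs_def fun_eq_iff scale_right_distrib scale_left_distrib)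
  have vs_act: "vs c v = std_act (scale c 1) v" for c v
    by (auto simp: vs_def std_act_def fun_eq_iff simp flip: scale_mult_left)
  obtain T where T: "finite T" "span T = UNIV" using finite_dim by blast
  define T' where "T' = (\<lambda>(t, i). std_act t (unit_vec i)) ` (T \<times> {..<r})"
  have T': "finite T'" using T(1) by (simp add: T'_def)
  have gen: "std_act a (unit_vec i) \<in> V.span T'" if "i < r" for a i
  proof -
    have "a \<in> span T" using T by simp
    then show ?thesis
    proof (induction a rule: span_induct_alt)
      case base
      have "std_act 0 (unit_vec i) = (0 :: nat \<Rightarrow> 'l)" by (auto simp: std_act_def fun_eq_iff)
      then show ?case using V.span_zero[of T'] by metis
    next
      case (step c a b)
      have eq: "std_act (scale c a + b) (unit_vec i) = vs c (std_act a (unit_vec i)) + std_act b (unit_vec i)"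
        by (auto simp: std_act_def vs_def fun_eq_iff distrib_right scale_mult_left)
      have "std_act a (unit_vec i) \<in> V.span T'"
        using step.hyps that by (intro V.span_base) (auto simp: T'_def)
      then show ?case unfolding eq by (intro V.span_add V.span_scale step.IH)
    qed
  qed
  have "std_free r \<subseteq> V.span T'"
  proof
    fix v :: "nat \<Rightarrow> 'l" assume "v \<in> std_free r"
    then have "v = (\<Sum>i<r. std_act (v i) (unit_vec i))" by (rule std_expand)
    also have "\<dots> \<in> V.span T'" by (rule V.span_sum) (simp add: gen)
    finally show "v \<in> V.span T'" .
  qed
  obtain B where B: "B \<subseteq> K" "V.independent B" "K \<subseteq> V.span B"
    using V.maximal_independent_subset[of K] by blast
  have "finite B"
    using V.independent_span_bound[OF T' B(2)] B(1) sub \<open>std_free r \<subseteq> V.span T'\<close> by blast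
  then obtain xs where xs: "set xs = B" using finite_list by blast
  define g where "g = (\<lambda>v. \<Sum>i<length xs. std_act (v i) (xs ! i))"
  have xs_K: "xs ! i \<in> K" if "i < length xs" for i
    using that xs B(1) nth_mem by blast
  have hom_g: "left_hom std_act (std_free (length xs)) std_act K g"
    unfolding left_hom_def
  proof (intro conjI ballI allI)
    have sum_K: "(\<Sum>i\<in>A. h i) \<in> K" if "\<And>i. i \<in> A \<Longrightarrow> h i \<in> K" for A :: "nat set" and h
      using that by (induction A rule: infinite_finite_induct) (auto intro: K.zero_mem K.add_mem)
    show "g u \<in> K" for u
      unfolding g_def by (rule sum_K) (simp add: xs_K K.act_mem)
    show "g (u + v) = g u + g v" for u v
      by (auto simp: g_def std_act_def fun_eq_iff sum_fun_apply algebra_simps simp flip: sum.distrib)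
    show "g (std_act a u) = std_act a (g u)" for a u
      by (auto simp: g_def std_act_def fun_eq_iff sum_fun_apply sum_distrib_left mult.assoc)
  qed
  have "K \<subseteq> g ` std_free (length xs)"
  proof
    fix v assume "v \<in> K"
    then have "v \<in> V.span B" using B by blast
    then show "v \<in> g ` std_free (length xs)"
    proof (induction v rule: V.span_induct_alt)
      case base
      have "g 0 = 0" by (auto simp: g_def std_act_def fun_eq_iff sum_fun_apply)
      then show ?case by (metis image_eqI left_module.zero_mem left_module_std)
    next
      case (step c b w)
      then obtain u where u: "u \<in> std_free (length xs)" "w = g u" by blast
      obtain i where i: "i < length xs" "b = xs ! i" using step xs by (metis in_set_conv_nth)
      let ?u = "std_act (scale c 1) (unit_vec i) + u"
      have e: "unit_vec i \<in> std_free (length xs)" using i by (auto simp: unit_vec_def std_free_def)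
      have "g (unit_vec i) = (\<Sum>j<length xs. if j = i then xs ! j else 0)"
        unfolding g_def by (rule sum.cong) (auto simp: unit_vec_def std_act_def fun_eq_iff)
      then have "g (unit_vec i) = b" using i by simp
      then have "g ?u = vs c b + w"
        using hom_g e u unfolding left_hom_def vs_act
        by (metis left_module.act_mem left_module_std)
      moreover have "?u \<in> std_free (length xs)"
        using u e by (metis left_module.act_mem left_module.add_mem left_module_std)
      ultimately show ?case by (metis image_eqI)
    qed
  qed
  then show ?thesis using hom_g unfolding left_hom_def by blast
qed

lemma left_module_kernel:
  fixes act' :: "'l::ring_1 \<Rightarrow> 'n::ab_group_add \<Rightarrow> 'n"
  assumes "left_hom act M act' N f" and "left_module act M" and "left_module act' N"
  shows "left_module act {u \<in> M. f u = 0}"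
proof -
  interpret M: left_module act M by fact
  interpret N: left_module act' N by fact
  have f_add: "f (u + v) = f u + f v" if "u \<in> M" "v \<in> M" for u v
    using assms(1) that by (simp add: left_hom_def)
  have f_act: "f (act a u) = act' a (f u)" if "u \<in> M" for a u
    using assms(1) that by (simp add: left_hom_def)
  have f0: "f 0 = 0" using f_add[of 0 0] M.zero_mem by simp
  have a0: "act' a 0 = 0" for a using N.act_add_right[of 0 0 a] N.zero_mem by simp
  show ?thesis
    by unfold_locales
      (simp_all add: f_add f_act f0 a0 M.zero_mem M.add_mem M.act_mem M.act_add_right
        M.act_add_left M.act_mult M.act_one)
qed

lemma left_hom_mono: "left_hom act M act' K f \<Longrightarrow> K \<subseteq> N \<Longrightarrow> left_hom act M act' N f"
  unfolding left_hom_def by blast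

lemma left_module_radical: "left_module (*) (jacobson_radical :: 'l::ring_1 set)"
proof -
  have *: "left_module (*) M" if "maximal_left_ideal M" for M :: "'l set"
    using that by (simp add: maximal_left_ideal_def)
  show ?thesis
  proof
    show "0 \<in> (jacobson_radical :: 'l set)"
      unfolding jacobson_radical_def using * left_module.zero_mem by blast
    show "u + v \<in> jacobson_radical" if "u \<in> jacobson_radical" "v \<in> jacobson_radical" for u v :: 'l
      using that unfolding jacobson_radical_def using * left_module.add_mem by blast
    show "a * u \<in> jacobson_radical" if "u \<in> jacobson_radical" for a u :: 'l
      using that unfolding jacobson_radical_def using * left_module.act_mem by blast
  qed (simp_all add: algebra_simps)
qed

lemma (in fd_algebra) augmentation_unique:
  assumes "residue_field_is_base scale" and "a - scale c 1 \<in> jacobson_radical"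
  shows "augmentation scale a = c"
  unfolding augmentation_def
  by (rule the1_equality) (use assms in \<open>simp_all add: residue_field_is_base_def\<close>)

lemma (in fd_algebra) augmentation:
  assumes "residue_field_is_base scale"
  shows "a - scale (augmentation scale a) 1 \<in> jacobson_radical"
    and "augmentation scale (a + b) = augmentation scale a + augmentation scale b"
    and "augmentation scale (a * b) = augmentation scale a * augmentation scale b"
    and "augmentation scale (scale c 1) = c"
proof -
  interpret J: left_module "(*)" "jacobson_radical :: 'l set" by (rule left_module_radical)
  show aug: "a - scale (augmentation scale a) 1 \<in> jacobson_radical" for a
    unfolding augmentation_def
    by (rule theI') (use assms in \<open>simp add: residue_field_is_base_def\<close>)
  show "augmentation scale (scale c 1) = c"
    by (rule augmentation_unique[OF assms]) (simp add: J.zero_mem)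
  let ?a = "augmentation scale a" and ?b = "augmentation scale b"
  show "augmentation scale (a + b) = ?a + ?b"
  proof (rule augmentation_unique[OF assms])
    have "a + b - scale (?a + ?b) 1 = (a - scale ?a 1) + (b - scale ?b 1)"
      by (simp add: scale_left_distrib)
    also have "\<dots> \<in> jacobson_radical" by (intro J.add_mem aug)
    finally show "a + b - scale (?a + ?b) 1 \<in> jacobson_radical" .
  qed
  show "augmentation scale (a * b) = ?a * ?b"
  proof (rule augmentation_unique[OF assms])
    have "scale ?b a = scale ?b 1 * a" using scale_mult_left[of ?b 1 a] by simp
    moreover have "a * scale ?b 1 = scale ?b a" using scale_mult_right[of ?b a 1] by simp
    moreover have "scale ?b 1 * scale ?a 1 = scale (?a * ?b) 1"
      using scale_mult_left[of ?b 1 "scale ?a 1"] by (simp add: mult.commute)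
    ultimately have "a * b - scale (?a * ?b) 1 = a * (b - scale ?b 1) + scale ?b 1 * (a - scale ?a 1)"
      by (simp add: right_diff_distrib)
    also have "\<dots> \<in> jacobson_radical" by (intro J.add_mem J.act_mem aug)
    finally show "a * b - scale (?a * ?b) 1 \<in> jacobson_radical" .
  qed
qed

lemma (in fd_algebra) left_module_trivial:
  assumes "residue_field_is_base scale"
  shows "left_module (trivial_act scale) UNIV"
proof -
  have "augmentation scale 1 = 1"
    using augmentation(4)[OF assms, of 1] by simp
  then show ?thesis
    by unfold_locales (simp_all add: trivial_act_def augmentation(2,3)[OF assms] algebra_simps)
qed

lemma (in fd_algebra) free_resolution_exists:
  assumes "residue_field_is_base scale"
  shows "\<exists>R :: ('l, nat \<Rightarrow> 'l, 'k) resolution. free_resolution (trivial_act scale) UNIV R"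
proof -
  define cov where "cov = (\<lambda>K :: (nat \<Rightarrow> 'l) set. SOME (s, g).
    left_hom std_act (std_free s) std_act K g \<and> g ` std_free s = K)"
  have cov: "left_hom std_act (std_free (fst (cov K))) std_act K (snd (cov K)) \<and>
      snd (cov K) ` std_free (fst (cov K)) = K"
    if "left_module std_act K" "K \<subseteq> std_free r" for K r
  proof -
    have "\<exists>p. case p of (s, g) \<Rightarrow> left_hom std_act (std_free s) std_act K g \<and> g ` std_free s = K"
      using submodule_cover[OF that] by simp
    from someI_ex[OF this] show ?thesis unfolding cov_def by (simp add: case_prod_unfold)
  qed
  define aug where "aug = (\<lambda>v :: nat \<Rightarrow> 'l. augmentation scale (v 0))"
  define K0 where "K0 = {u \<in> std_free 1. aug u = 0}"
  define S where "S = rec_nat (cov K0) (\<lambda>_ p. cov {u \<in> std_free (fst p). snd p u = 0})"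
  define rk where "rk = (\<lambda>n. case n of 0 \<Rightarrow> 1 | Suc m \<Rightarrow> fst (S m))"
  define K where "K = (\<lambda>n. case n of 0 \<Rightarrow> K0 | Suc m \<Rightarrow> {u \<in> std_free (rk n). snd (S m) u = 0})"
  have S: "S n = cov (K n)" for n by (cases n) (simp_all add: S_def K_def rk_def)
  have sub: "K n \<subseteq> std_free (rk n)" for n by (cases n) (auto simp: K_def rk_def K0_def)
  have hom_aug: "left_hom std_act (std_free 1) (trivial_act scale) UNIV aug"
    by (simp add: left_hom_def aug_def std_act_def trivial_act_def augmentation(2,3)[OF assms])
  have step: "left_hom std_act (std_free (rk (Suc n))) std_act (K n) (snd (S n)) \<and>
      snd (S n) ` std_free (rk (Suc n)) = K n" if "left_module std_act (K n)" for n
    using cov[OF that sub] by (simp add: S rk_def)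
  have mod_K: "left_module std_act (K n)" for n
  proof (induction n)
    case 0
    show ?case
      using left_module_kernel[OF hom_aug left_module_std left_module_trivial[OF assms]]
      by (simp add: K_def K0_def)
  next
    case (Suc n)
    from left_module_kernel[OF conjunct1[OF step[OF Suc]] left_module_std Suc]
    show ?case by (simp add: K_def)
  qed
  have hom: "left_hom std_act (std_free (rk (Suc n))) std_act (std_free (rk n)) (snd (S n))" for n
    by (rule left_hom_mono[OF conjunct1[OF step[OF mod_K]] sub])
  define R :: "('l, nat \<Rightarrow> 'l, 'k) resolution" where
    "R = \<lparr>res_mod = (\<lambda>n. std_free (rk n)), res_act = (\<lambda>n. std_act),
      res_d = (\<lambda>n. snd (S n)), res_aug = aug\<rparr>"
  have surj: "aug ` std_free 1 = UNIV"
  proof -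
    have "c \<in> aug ` std_free 1" for c
      by (rule image_eqI[of _ _ "\<lambda>i. if i = 0 then scale c 1 else 0"])
        (auto simp: aug_def std_free_def augmentation(4)[OF assms])
    then show ?thesis by blast
  qed
  have "free_resolution (trivial_act scale) UNIV R"
    unfolding free_resolution_def
  proof (intro conjI allI)
    show "{u \<in> res_mod R 0. res_aug R u = 0} = res_d R 0 ` res_mod R (Suc 0)"
      using step[OF mod_K, of 0] by (simp add: R_def K_def K0_def rk_def)
    show "{u \<in> res_mod R (Suc n). res_d R n u = 0} = res_d R (Suc n) ` res_mod R (Suc (Suc n))" for n
      using step[OF mod_K, of "Suc n"] by (simp add: R_def K_def)
  qed (use hom_aug surj hom in \<open>simp_all add: R_def left_module_std has_basis_std rk_def\<close>)
  then show ?thesis by blast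
qed

end

theory Submission
  imports Defs
begin

text \<open>
  As \<open>\<psi>\<^sub>1, \<psi>\<^sub>2\<close> generate \<open>J\<close> as a right ideal, the annihilator of \<open>\<psi>\<close> is the one-dimensional socle, and counting dimensions gives
  \<open>\<Omega>\<^sup>2(k) = \<Lambda>\<psi> + k\<sigma> + k\<theta>\<close>. The identities (3) then determine the whole minimal resolution \<open>F\<close> of \<open>k\<close>
  explicitly, with \<open>F\<^sub>n = \<Lambda>\<^sup>n\<^sup>+\<^sup>1\<close>. The classes in \<open>Ext\<^sup>2(k,k)\<close> dual to \<open>\<sigma>\<close> and \<open>\<theta>\<close> lift to chain maps
  \<open>F\<^sub>n\<^sub>+\<^sub>2 \<rightarrow> F\<^sub>n\<close> that forget the last two, respectively (up to powers of \<open>c\<close>) the first two, coordinates. So for \<open>n \<ge> 3\<close>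
  every coordinate function on \<open>F\<^sub>n\<close> is, up to a scalar, the product of one on \<open>F\<^sub>n\<^sub>-\<^sub>2\<close> with one of these two classes.
\<close>

section \<open>Modules and chain maps between free resolutions\<close>

text \<open>The resolution \<open>R\<close> is arbitrary, hence possibly far from minimal, and its
  products are accessible only through the comparison theorem. They are computed on the explicit
  resolution \<open>F\<close> and carried to \<open>R\<close> along a chain map
  \<open>\<Psi>\<close>: two lifts of the same cocycle to chain maps from \<open>R\<close> to
  \<open>F\<close> are homotopic, so they agree on classes.

  Selfinjectivity enters through a Frobenius form. It passes from left to right multiplication: an
  element \<open>b\<close> with \<open>b * j = 0\<close> for all \<open>j\<close> in
  \<open>J\<close> is a multiple of \<omega>.

  In (3) the vector identities push J\<sigma> and J\<theta> into \<Lambda>\<psi>, and \<omega> is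
  the delicate element. Its multiples annihilate \<psi>, so they give extra cycles that must become
  boundaries; \<open>\<theta>\<^sub>1 * \<rho>\<^sub>1 + \<theta>\<^sub>2 * \<rho>\<^sub>2 =
  \<omega>\<close> achieves this. The same \<omega> would spoil the vanishing of the squared
  differential unless it is cancelled by the product of \<sigma> with \<open>\<rho>\<^sub>3\<close>,
  \<open>\<rho>\<^sub>4\<close>, which is \<omega> divided by -c. This ties \<theta> in one block to
  \<sigma> in the next with a factor c, and the factors accumulate to powers of c.\<close>

context left_module
begin

lemma act_zero_left: "u \<in> M \<Longrightarrow> act 0 u = 0"
  using act_add_left[of u 0 0] by simp

lemma act_zero_right: "act a 0 = 0"
  using act_add_right[of 0 0 a] zero_mem by simp

lemma minus_mem: assumes "u \<in> M" shows "- u \<in> M"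
proof -
  have "act (- 1) u + u = act (- 1 + 1) u"
    using assms by (simp only: act_add_left act_one)
  then have "act (- 1) u = - u" using act_zero_left[OF assms] by (simp add: eq_neg_iff_add_eq_0)
  then show ?thesis using act_mem[OF assms, of "- 1"] by simp
qed

lemma diff_mem: "u \<in> M \<Longrightarrow> v \<in> M \<Longrightarrow> u - v \<in> M"
  using add_mem[of u "- v"] minus_mem[of v] by simp

lemma act_minus_right: assumes "u \<in> M" shows "act a (- u) = - act a u"
  using act_add_right[of u "- u" a] assms minus_mem[of u] act_zero_right[of a]
  by (simp add: eq_neg_iff_add_eq_0 add.commute)

lemma act_diff_right: "u \<in> M \<Longrightarrow> v \<in> M \<Longrightarrow> act a (u - v) = act a u - act a v"
  using act_add_right[of u "- v" a] minus_mem[of v] by (simp add: act_minus_right)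

lemma sum_mem: "(\<And>i. i \<in> A \<Longrightarrow> f i \<in> M) \<Longrightarrow> (\<Sum>i\<in>A. f i) \<in> M"
  by (induction A rule: infinite_finite_induct) (auto intro: zero_mem add_mem)

lemma act_sum: "(\<And>i. i \<in> A \<Longrightarrow> f i \<in> M) \<Longrightarrow> act a (\<Sum>i\<in>A. f i) = (\<Sum>i\<in>A. act a (f i))"
  by (induction A rule: infinite_finite_induct)
    (simp_all add: act_zero_right act_add_right sum_mem)

end

lemma left_hom_mem: "left_hom a M b N f \<Longrightarrow> u \<in> M \<Longrightarrow> f u \<in> N"
  and left_hom_add: "left_hom a M b N f \<Longrightarrow> u \<in> M \<Longrightarrow> v \<in> M \<Longrightarrow> f (u + v) = f u + f v"
  and left_hom_act: "left_hom a M b N f \<Longrightarrow> u \<in> M \<Longrightarrow> f (a r u) = b r (f u)"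
  by (simp_all add: left_hom_def)

lemma left_hom_zero:
  "left_hom a M b N f \<Longrightarrow> left_module a M \<Longrightarrow> f 0 = 0"
  using left_hom_add[of a M b N f 0 0] by (simp add: left_module.zero_mem)

lemma left_hom_diff:
  assumes "left_hom a M b N f" "left_module a M" "u \<in> M" "v \<in> M"
  shows "f (u - v) = f u - f v"
  using left_hom_add[OF assms(1) left_module.diff_mem[OF assms(2-4)] assms(4)]
  by (simp add: algebra_simps)

lemma left_hom_sum:
  assumes "left_hom a M b N f" "left_module a M" "\<And>i. i \<in> A \<Longrightarrow> g i \<in> M"
  shows "f (\<Sum>i\<in>A. g i) = (\<Sum>i\<in>A. f (g i))"
  using assms(3)
  by (induction A rule: infinite_finite_induct)
    (simp_all add: left_hom_zero[OF assms(1,2)] left_hom_add[OF assms(1)] left_module.sum_mem[OF assms(2)])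

lemma left_hom_comp:
  "left_hom a M b N f \<Longrightarrow> left_hom b N c K g \<Longrightarrow> left_hom a M c K (\<lambda>u. g (f u))"
  by (simp add: left_hom_def)

lemma left_hom_ident: "left_hom a M a M (\<lambda>u. u)"
  by (simp add: left_hom_def)

lemma left_hom_zero_map: "left_module b N \<Longrightarrow> left_hom a M b N (\<lambda>u. 0)"
  by (simp add: left_hom_def left_module.zero_mem left_module.act_zero_right)

lemma left_hom_diff_map:
  "left_module b N \<Longrightarrow> left_hom a M b N f \<Longrightarrow> left_hom a M b N g \<Longrightarrow> left_hom a M b N (\<lambda>u. f u - g u)"
  by (simp add: left_hom_def left_module.diff_mem left_module.act_diff_right algebra_simps)

text \<open>Free modules are projective: choose a preimage under \<open>g\<close> for the image of
  each basis vector and extend linearly. \<open>has_basis\<close> gives unique coordinates of single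
  elements only, so linearity of the extension must come from that uniqueness.\<close>

lemma free_lift:
  assumes P: "left_module a P" "has_basis a P" and M: "left_module b M" and N: "left_module c N"
    and f: "left_hom a P c N f" and g: "left_hom b M c N g" and sub: "f ` P \<subseteq> g ` M"
  obtains h where "left_hom a P b M h" and "\<And>u. u \<in> P \<Longrightarrow> g (h u) = f u"
proof -
  interpret P: left_module a P by fact
  interpret M: left_module b M by fact
  interpret N: left_module c N by fact
  obtain B where B: "B \<subseteq> P" and basis: "\<forall>u\<in>P. \<exists>!c. finite {b. c b \<noteq> 0} \<and> {b. c b \<noteq> 0} \<subseteq> B
      \<and> u = (\<Sum>b | c b \<noteq> 0. a (c b) b)"
    using P(2) unfolding has_basis_def by blast
  define ok where "ok = (\<lambda>u k. finite {b. k b \<noteq> 0} \<and> {b. k b \<noteq> 0} \<subseteq> B \<and> u = (\<Sum>b | k b \<noteq> 0. a (k b) b))"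
  define coef where "coef = (\<lambda>u. THE k. ok u k)"
  have ok_ex: "\<exists>!k. ok u k" if "u \<in> P" for u
    using bspec[OF basis that] unfolding ok_def .
  have ok_coef: "ok u (coef u)" if "u \<in> P" for u
    unfolding coef_def by (rule theI'[OF ok_ex[OF that]])
  have uniq: "k = coef u" if "u \<in> P" "ok u k" for u k
    using ok_ex[OF that(1)] that(2) ok_coef[OF that(1)] by blast
  obtain m where m: "m b \<in> M" "g (m b) = f b" if "b \<in> B" for b
  proof -
    have "\<exists>v. v \<in> M \<and> g v = f b" if "b \<in> B" for b using that B sub by force
    then show ?thesis using that by metis
  qed
  define h where "h = (\<lambda>u. \<Sum>t | coef u t \<noteq> 0. b (coef u t) (m t))"
  have P_ext: "(\<Sum>t | k t \<noteq> 0. a (k t) t) = (\<Sum>t\<in>S. a (k t) t)"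
    if "finite S" "{t. k t \<noteq> 0} \<subseteq> S" "S \<subseteq> B" for k S
    using that B by (intro sum.mono_neutral_left) (auto simp: P.act_zero_left)
  have M_ext: "(\<Sum>t | k t \<noteq> 0. b (k t) (m t)) = (\<Sum>t\<in>S. b (k t) (m t))"
    if "finite S" "{t. k t \<noteq> 0} \<subseteq> S" "S \<subseteq> B" for k S
    using that m by (intro sum.mono_neutral_left) (auto simp: M.act_zero_left)
  \<comment> \<open>By uniqueness of coordinates \<open>h\<close> can be read off from any finite
    expansion, zero coefficients included. So two elements may be expanded over the union of their
    supports.\<close>
  have h_eq: "h u = (\<Sum>t\<in>S. b (k t) (m t))" if "u \<in> P" "finite S" "{t. k t \<noteq> 0} \<subseteq> S" "S \<subseteq> B"
    "u = (\<Sum>t\<in>S. a (k t) t)" for u S k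
  proof -
    have "ok u k" unfolding ok_def using that P_ext[OF that(2-4)] finite_subset[OF that(3,2)] by auto
    then have "k = coef u" using uniq that(1) by blast
    then show ?thesis using M_ext[OF that(2-4)] by (simp add: h_def)
  qed
  have supp: "finite {t. coef u t \<noteq> 0}" "{t. coef u t \<noteq> 0} \<subseteq> B"
      "u = (\<Sum>t | coef u t \<noteq> 0. a (coef u t) t)" if "u \<in> P" for u
    using ok_coef[OF that] by (simp_all add: ok_def)
  show ?thesis
  proof
    show "left_hom a P b M h"
      unfolding left_hom_def
    proof (intro conjI ballI allI)
      show "h u \<in> M" if "u \<in> P" for u
        unfolding h_def using supp[OF that] m by (intro M.sum_mem M.act_mem) auto
      show "h (u + v) = h u + h v" if u: "u \<in> P" and v: "v \<in> P" for u v
      proof -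
        let ?S = "{t. coef u t \<noteq> 0} \<union> {t. coef v t \<noteq> 0}"
        have S: "finite ?S" "?S \<subseteq> B" using supp u v by auto
        have tP: "t \<in> P" and tM: "m t \<in> M" if "t \<in> ?S" for t using that S(2) B m by blast+
        have "u + v = (\<Sum>t\<in>?S. a (coef u t) t) + (\<Sum>t\<in>?S. a (coef v t) t)"
          using supp(3)[OF u] supp(3)[OF v] P_ext[OF S(1) Un_upper1 S(2)] P_ext[OF S(1) Un_upper2 S(2)] by simp
        also have "\<dots> = (\<Sum>t\<in>?S. a (coef u t + coef v t) t)"
          unfolding sum.distrib[symmetric] by (rule sum.cong) (use P.act_add_left tP in auto)
        finally have "h (u + v) = (\<Sum>t\<in>?S. b (coef u t + coef v t) (m t))"
          by (intro h_eq S P.add_mem u v) auto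
        also have "\<dots> = (\<Sum>t\<in>?S. b (coef u t) (m t)) + (\<Sum>t\<in>?S. b (coef v t) (m t))"
          unfolding sum.distrib[symmetric] by (rule sum.cong) (use M.act_add_left tM in auto)
        also have "\<dots> = h u + h v"
          unfolding h_def using M_ext[OF S(1) Un_upper1 S(2)] M_ext[OF S(1) Un_upper2 S(2)] by simp
        finally show ?thesis .
      qed
      show "h (a r u) = b r (h u)" if u: "u \<in> P" for r u
      proof -
        let ?S = "{t. coef u t \<noteq> 0}"
        have S: "finite ?S" "?S \<subseteq> B" using supp u by auto
        have tP: "t \<in> P" and tM: "m t \<in> M" if "t \<in> ?S" for t using that S(2) B m by blast+
        have "a r u = a r (\<Sum>t\<in>?S. a (coef u t) t)" using supp(3)[OF u] by simp
        also have "\<dots> = (\<Sum>t\<in>?S. a (r * coef u t) t)"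
          by (subst P.act_sum) (use tP P.act_mult P.act_mem in auto)
        finally have "h (a r u) = (\<Sum>t\<in>?S. b (r * coef u t) (m t))"
          by (intro h_eq S P.act_mem u) auto
        also have "\<dots> = b r (h u)" unfolding h_def
          by (subst M.act_sum) (use tM M.act_mult M.act_mem in auto)
        finally show ?thesis .
      qed
    qed
  next
    fix u assume u: "u \<in> P"
    let ?S = "{t. coef u t \<noteq> 0}"
    have S: "?S \<subseteq> B" using supp u by auto
    then have tP: "t \<in> P" and tM: "m t \<in> M" and gm: "g (m t) = f t" if "t \<in> ?S" for t
      using that B m by blast+
    have "g (h u) = (\<Sum>t\<in>?S. g (b (coef u t) (m t)))"
      unfolding h_def by (rule left_hom_sum[OF g M]) (use tM M.act_mem in auto)
    also have "\<dots> = (\<Sum>t\<in>?S. f (a (coef u t) t))"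
      by (rule sum.cong) (use tM tP gm left_hom_act[OF g] left_hom_act[OF f] in auto)
    also have "\<dots> = f (\<Sum>t\<in>?S. a (coef u t) t)"
      by (rule left_hom_sum[OF f P(1), symmetric]) (use tP P.act_mem in auto)
    also have "\<dots> = f u" using supp(3)[OF u] by simp
    finally show "g (h u) = f u" .
  qed
qed

section \<open>Free resolutions and the comparison theorem\<close>

locale resolved_module = left_module act M
  for act :: "'l::ring_1 \<Rightarrow> 'm::ab_group_add \<Rightarrow> 'm" and M +
  fixes R :: "('l, 'p::ab_group_add, 'm) resolution"
  assumes free_res: "free_resolution act M R"
begin

lemma res_module: "left_module (res_act R n) (res_mod R n)"
  and res_basis: "has_basis (res_act R n) (res_mod R n)"
  and res_d_hom: "left_hom (res_act R (Suc n)) (res_mod R (Suc n)) (res_act R n) (res_mod R n) (res_d R n)"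
  and res_aug_hom: "left_hom (res_act R 0) (res_mod R 0) act M (res_aug R)"
  using free_res by (simp_all add: free_resolution_def)

lemma res_d_mem: "u \<in> res_mod R (Suc n) \<Longrightarrow> res_d R n u \<in> res_mod R n"
  by (rule left_hom_mem[OF res_d_hom])

lemma res_aug_d: "u \<in> res_mod R (Suc 0) \<Longrightarrow> res_aug R (res_d R 0 u) = 0"
  using free_res unfolding free_resolution_def by blast

lemma res_d_d: "u \<in> res_mod R (Suc (Suc n)) \<Longrightarrow> res_d R n (res_d R (Suc n) u) = 0"
  using free_res unfolding free_resolution_def by blast

lemma res_aug_exact: "u \<in> res_mod R 0 \<Longrightarrow> res_aug R u = 0 \<Longrightarrow> u \<in> res_d R 0 ` res_mod R (Suc 0)"
  using free_res unfolding free_resolution_def by blast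

lemma res_d_exact:
  "u \<in> res_mod R (Suc n) \<Longrightarrow> res_d R n u = 0 \<Longrightarrow> u \<in> res_d R (Suc n) ` res_mod R (Suc (Suc n))"
  using free_res unfolding free_resolution_def by blast

lemma res_aug_surj: "res_aug R ` res_mod R 0 = M"
  using free_res unfolding free_resolution_def by blast

end

text \<open>\<open>chain_lifts\<close> with different source and target resolutions. For
  \<open>n = 0\<close> and the augmentation as cocycle these are the comparison maps between two
  resolutions of the same module.\<close>

definition lifts ::
  "('l::ring_1, 'p::ab_group_add, 'n) resolution \<Rightarrow> ('l, 'q::ab_group_add, 'm) resolution \<Rightarrow> nat \<Rightarrow>
   ('p \<Rightarrow> 'm) \<Rightarrow> (nat \<Rightarrow> 'p \<Rightarrow> 'q) set" where
  "lifts R Q n g =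
     {G. (\<forall>i. left_hom (res_act R (n + i)) (res_mod R (n + i)) (res_act Q i) (res_mod Q i) (G i)) \<and>
         (\<forall>u\<in>res_mod R n. res_aug Q (G 0 u) = g u) \<and>
         (\<forall>i. \<forall>u\<in>res_mod R (Suc (n + i)). G i (res_d R (n + i) u) = res_d Q i (G (Suc i) u))}"

lemma chain_lifts_eq: "chain_lifts R n g = lifts R R n g"
  by (simp add: chain_lifts_def lifts_def)

lemma liftsD:
  assumes "G \<in> lifts R Q n g"
  shows "left_hom (res_act R (n + i)) (res_mod R (n + i)) (res_act Q i) (res_mod Q i) (G i)"
    and "u \<in> res_mod R n \<Longrightarrow> res_aug Q (G 0 u) = g u"
    and "u \<in> res_mod R (Suc (n + i)) \<Longrightarrow> G i (res_d R (n + i) u) = res_d Q i (G (Suc i) u)"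
  using assms by (auto simp: lifts_def)

lemma lifts_comp:
  assumes G: "G \<in> lifts R Q n g" and H: "H \<in> lifts Q S m h"
  shows "(\<lambda>i u. H i (G (m + i) u)) \<in> lifts R S (n + m) (\<lambda>u. h (G m u))"
  unfolding lifts_def mem_Collect_eq
proof (intro conjI allI ballI)
  show "left_hom (res_act R (n + m + i)) (res_mod R (n + m + i)) (res_act S i) (res_mod S i)
      (\<lambda>u. H i (G (m + i) u))" for i
    using left_hom_comp[OF liftsD(1)[OF G, of "m + i"] liftsD(1)[OF H, of i]] by (simp add: add.assoc)
  have mem: "G i u \<in> res_mod Q i" if "u \<in> res_mod R (n + i)" for u i
    using left_hom_mem[OF liftsD(1)[OF G]] that .
  show "res_aug S (H 0 (G (m + 0) u)) = h (G m u)" if "u \<in> res_mod R (n + m)" for u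
    using liftsD(2)[OF H] mem[OF that] by simp
  show "H i (G (m + i) (res_d R (n + m + i) u)) = res_d S i (H (Suc i) (G (m + Suc i) u))"
    if "u \<in> res_mod R (Suc (n + m + i))" for i u
    using liftsD(3)[OF G, of u "m + i"] liftsD(3)[OF H, of "G (Suc (m + i)) u" i]
      mem[of u "Suc (m + i)"] that by (simp add: add.assoc)
qed

lemma lifts_ident: "(\<lambda>i u. u) \<in> lifts R R 0 (res_aug R)"
  by (simp add: lifts_def left_hom_ident)

locale two_resolutions = R: resolved_module act' M' R + Q: resolved_module act M Q
  for act' :: "'l::ring_1 \<Rightarrow> 'n::ab_group_add \<Rightarrow> 'n" and M'
    and R :: "('l, 'p::ab_group_add, 'n) resolution"
    and act :: "'l::ring_1 \<Rightarrow> 'm::ab_group_add \<Rightarrow> 'm" and M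
    and Q :: "('l, 'q::ab_group_add, 'm) resolution"
begin

text \<open>Existence half of the comparison theorem: the source is free, the target exact, so the
  maps are built degree by degree with \<open>free_lift\<close>.\<close>

lemma lifts_exist:
  assumes g: "left_hom (res_act R n) (res_mod R n) act M g"
    and gd: "\<And>u. u \<in> res_mod R (Suc n) \<Longrightarrow> g (res_d R n u) = 0"
  shows "\<exists>G. G \<in> lifts R Q n g"
proof -
  \<comment> \<open>The second clause is the invariant of the recursion: after the differential,
    \<open>h\<close> lands in boundaries of \<open>Q\<close>, which is what the next use of
    \<open>free_lift\<close> requires.\<close>
  define P where "P = (\<lambda>i h. left_hom (res_act R (n + i)) (res_mod R (n + i)) (res_act Q i) (res_mod Q i) h
     \<and> (\<forall>u\<in>res_mod R (Suc (n + i)). h (res_d R (n + i) u) \<in> res_d Q i ` res_mod Q (Suc i))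
     \<and> (i = 0 \<longrightarrow> (\<forall>u\<in>res_mod R n. res_aug Q (h u) = g u)))"
  have "\<exists>G. \<forall>i. P i (G i) \<and> (\<forall>u\<in>res_mod R (Suc (n + i)). G i (res_d R (n + i) u) = res_d Q i (G (Suc i) u))"
  proof (rule dependent_nat_choice)
    have sub: "g ` res_mod R n \<subseteq> res_aug Q ` res_mod Q 0"
      using Q.res_aug_surj left_hom_mem[OF g] by blast
    obtain h where h: "left_hom (res_act R n) (res_mod R n) (res_act Q 0) (res_mod Q 0) h"
        "\<And>u. u \<in> res_mod R n \<Longrightarrow> res_aug Q (h u) = g u"
      using free_lift[OF R.res_module R.res_basis Q.res_module Q.left_module_axioms g Q.res_aug_hom sub]
      by blast
    have "P 0 h"
      unfolding P_def using h
      by (auto intro!: Q.res_aug_exact simp: gd R.res_d_mem left_hom_mem[OF h(1)])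
    then show "\<exists>h. P 0 h" by blast
  next
    fix h i assume "P i h"
    then have h: "left_hom (res_act R (n + i)) (res_mod R (n + i)) (res_act Q i) (res_mod Q i) h"
      and im: "\<And>u. u \<in> res_mod R (Suc (n + i)) \<Longrightarrow> h (res_d R (n + i) u) \<in> res_d Q i ` res_mod Q (Suc i)"
      by (auto simp: P_def)
    have "(\<lambda>u. h (res_d R (n + i) u)) ` res_mod R (Suc (n + i)) \<subseteq> res_d Q i ` res_mod Q (Suc i)"
      using im by blast
    from free_lift[OF R.res_module R.res_basis Q.res_module Q.res_module
        left_hom_comp[OF R.res_d_hom h] Q.res_d_hom this]
    obtain k where k: "left_hom (res_act R (Suc (n + i))) (res_mod R (Suc (n + i)))
        (res_act Q (Suc i)) (res_mod Q (Suc i)) k"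
      "\<And>u. u \<in> res_mod R (Suc (n + i)) \<Longrightarrow> res_d Q i (k u) = h (res_d R (n + i) u)" by blast
    have "k (res_d R (Suc (n + i)) u) \<in> res_d Q (Suc i) ` res_mod Q (Suc (Suc i))"
      if "u \<in> res_mod R (Suc (Suc (n + i)))" for u
      using that k(2)[of "res_d R (Suc (n + i)) u"] left_hom_zero[OF h R.res_module]
      by (intro Q.res_d_exact) (auto simp: R.res_d_mem R.res_d_d left_hom_mem[OF k(1)])
    then have "P (Suc i) k" using k by (simp add: P_def)
    then show "\<exists>k. P (Suc i) k \<and>
      (\<forall>u\<in>res_mod R (Suc (n + i)). h (res_d R (n + i) u) = res_d Q i (k u))"
      using k by auto
  qed
  then obtain G where G: "P i (G i)"
      "\<forall>u\<in>res_mod R (Suc (n + i)). G i (res_d R (n + i) u) = res_d Q i (G (Suc i) u)" for i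
    by blast
  then have "G \<in> lifts R Q n g"
    using G(1)[of 0] by (simp add: lifts_def P_def)
  then show ?thesis by blast
qed

text \<open>Uniqueness half: a chain map over the zero map is null-homotopic. In each degree,
  \<open>G\<close> minus the homotopy already built composed with the differential is a cycle, hence
  lifts through the differential of \<open>Q\<close>.\<close>

lemma lifts_homotopy:
  assumes G: "G \<in> lifts R Q n (\<lambda>u. 0)"
  shows "\<exists>s. (\<forall>i. left_hom (res_act R (n + i)) (res_mod R (n + i)) (res_act Q (Suc i)) (res_mod Q (Suc i)) (s i)) \<and>
    (\<forall>u\<in>res_mod R n. G 0 u = res_d Q 0 (s 0 u)) \<and>
    (\<forall>i. \<forall>u\<in>res_mod R (Suc (n + i)). G (Suc i) u = res_d Q (Suc i) (s (Suc i) u) + s i (res_d R (n + i) u))"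
proof -
  note Ghom = liftsD(1)[OF G] and Gcomm = liftsD(3)[OF G]
  define P where "P = (\<lambda>i h. left_hom (res_act R (n + i)) (res_mod R (n + i)) (res_act Q (Suc i)) (res_mod Q (Suc i)) h
     \<and> (\<forall>u\<in>res_mod R (Suc (n + i)). G (Suc i) u - h (res_d R (n + i) u) \<in> res_d Q (Suc i) ` res_mod Q (Suc (Suc i)))
     \<and> (i = 0 \<longrightarrow> (\<forall>u\<in>res_mod R n. G 0 u = res_d Q 0 (h u))))"
  have "\<exists>s. \<forall>i. P i (s i) \<and> (\<forall>u\<in>res_mod R (Suc (n + i)).
      G (Suc i) u = res_d Q (Suc i) (s (Suc i) u) + s i (res_d R (n + i) u))"
  proof (rule dependent_nat_choice)
    have G0: "left_hom (res_act R n) (res_mod R n) (res_act Q 0) (res_mod Q 0) (G 0)"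
      using Ghom[of 0] by simp
    have sub: "G 0 ` res_mod R n \<subseteq> res_d Q 0 ` res_mod Q (Suc 0)"
      using liftsD(2)[OF G] left_hom_mem[OF G0] Q.res_aug_exact by blast
    obtain h where h: "left_hom (res_act R n) (res_mod R n) (res_act Q (Suc 0)) (res_mod Q (Suc 0)) h"
        "\<And>u. u \<in> res_mod R n \<Longrightarrow> res_d Q 0 (h u) = G 0 u"
      using free_lift[OF R.res_module R.res_basis Q.res_module Q.res_module G0 Q.res_d_hom sub] by blast
    have "G (Suc 0) u - h (res_d R n u) \<in> res_d Q (Suc 0) ` res_mod Q (Suc (Suc 0))"
      if u: "u \<in> res_mod R (Suc n)" for u
    proof (rule Q.res_d_exact)
      have 1: "G (Suc 0) u \<in> res_mod Q (Suc 0)"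
        using left_hom_mem[OF Ghom[of "Suc 0"]] u by simp
      have 2: "h (res_d R n u) \<in> res_mod Q (Suc 0)" using left_hom_mem[OF h(1)] R.res_d_mem u by blast
      show "G (Suc 0) u - h (res_d R n u) \<in> res_mod Q (Suc 0)"
        using left_module.diff_mem[OF Q.res_module 1 2] .
      show "res_d Q 0 (G (Suc 0) u - h (res_d R n u)) = 0"
        using left_hom_diff[OF Q.res_d_hom Q.res_module 1 2] Gcomm[of u 0] h(2)[of "res_d R n u"] u R.res_d_mem
        by simp
    qed
    then have "P 0 h" unfolding P_def using h by auto
    then show "\<exists>h. P 0 h" by blast
  next
    fix h i assume "P i h"
    then have h: "left_hom (res_act R (n + i)) (res_mod R (n + i)) (res_act Q (Suc i)) (res_mod Q (Suc i)) h"
      and im: "\<And>u. u \<in> res_mod R (Suc (n + i)) \<Longrightarrow>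
         G (Suc i) u - h (res_d R (n + i) u) \<in> res_d Q (Suc i) ` res_mod Q (Suc (Suc i))"
      by (auto simp: P_def)
    have Gi: "left_hom (res_act R (Suc (n + i))) (res_mod R (Suc (n + i))) (res_act Q (Suc i)) (res_mod Q (Suc i)) (G (Suc i))"
      using Ghom[of "Suc i"] by simp
    have "(\<lambda>u. G (Suc i) u - h (res_d R (n + i) u)) ` res_mod R (Suc (n + i)) \<subseteq> res_d Q (Suc i) ` res_mod Q (Suc (Suc i))"
      using im by blast
    from free_lift[OF R.res_module R.res_basis Q.res_module Q.res_module
        left_hom_diff_map[OF Q.res_module Gi left_hom_comp[OF R.res_d_hom h]] Q.res_d_hom this]
    obtain k where k: "left_hom (res_act R (Suc (n + i))) (res_mod R (Suc (n + i)))
        (res_act Q (Suc (Suc i))) (res_mod Q (Suc (Suc i))) k"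
      "\<And>u. u \<in> res_mod R (Suc (n + i)) \<Longrightarrow> res_d Q (Suc i) (k u) = G (Suc i) u - h (res_d R (n + i) u)" by blast
    have "G (Suc (Suc i)) u - k (res_d R (Suc (n + i)) u) \<in> res_d Q (Suc (Suc i)) ` res_mod Q (Suc (Suc (Suc i)))"
      if u: "u \<in> res_mod R (Suc (Suc (n + i)))" for u
    proof (rule Q.res_d_exact)
      have 1: "G (Suc (Suc i)) u \<in> res_mod Q (Suc (Suc i))"
        using left_hom_mem[OF Ghom[of "Suc (Suc i)"]] u by simp
      have 2: "k (res_d R (Suc (n + i)) u) \<in> res_mod Q (Suc (Suc i))"
        using left_hom_mem[OF k(1)] R.res_d_mem u by blast
      show "G (Suc (Suc i)) u - k (res_d R (Suc (n + i)) u) \<in> res_mod Q (Suc (Suc i))"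
        using left_module.diff_mem[OF Q.res_module 1 2] .
      show "res_d Q (Suc i) (G (Suc (Suc i)) u - k (res_d R (Suc (n + i)) u)) = 0"
        using left_hom_diff[OF Q.res_d_hom Q.res_module 1 2] Gcomm[of u "Suc i"]
          k(2)[of "res_d R (Suc (n + i)) u"] u R.res_d_mem R.res_d_d[of u] left_hom_zero[OF h R.res_module]
        by simp
    qed
    then have "P (Suc i) k" using k by (simp add: P_def)
    then show "\<exists>k. P (Suc i) k \<and> (\<forall>u\<in>res_mod R (Suc (n + i)).
      G (Suc i) u = res_d Q (Suc i) (k u) + h (res_d R (n + i) u))"
      using k by auto
  qed
  then obtain s where s: "P i (s i)" "\<forall>u\<in>res_mod R (Suc (n + i)).
      G (Suc i) u = res_d Q (Suc i) (s (Suc i) u) + s i (res_d R (n + i) u)" for i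
    by blast
  then show ?thesis
    using s(1)[of 0] by (intro exI[of _ s]) (simp add: P_def)
qed

lemma lifts_diff:
  assumes "G \<in> lifts R Q n g" "H \<in> lifts R Q n h"
  shows "(\<lambda>i u. G i u - H i u) \<in> lifts R Q n (\<lambda>u. g u - h u)"
  unfolding lifts_def mem_Collect_eq
proof (intro conjI allI ballI)
  show "left_hom (res_act R (n + i)) (res_mod R (n + i)) (res_act Q i) (res_mod Q i) (\<lambda>u. G i u - H i u)" for i
    using left_hom_diff_map[OF Q.res_module liftsD(1)[OF assms(1)] liftsD(1)[OF assms(2)]] .
  have mem: "G i u \<in> res_mod Q i" "H i u \<in> res_mod Q i" if "u \<in> res_mod R (n + i)" for u i
    using left_hom_mem[OF liftsD(1)[OF assms(1)]] left_hom_mem[OF liftsD(1)[OF assms(2)]] that by auto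
  show "res_aug Q (G 0 u - H 0 u) = g u - h u" if "u \<in> res_mod R n" for u
    using liftsD(2)[OF assms(1)] liftsD(2)[OF assms(2)] mem[of u 0] that
    by (simp add: left_hom_diff[OF Q.res_aug_hom Q.res_module])
  show "G i (res_d R (n + i) u) - H i (res_d R (n + i) u) = res_d Q i (G (Suc i) u - H (Suc i) u)"
    if "u \<in> res_mod R (Suc (n + i))" for i u
    using liftsD(3)[OF assms(1)] liftsD(3)[OF assms(2)] mem[of u "Suc i"] that
    by (simp add: left_hom_diff[OF Q.res_d_hom Q.res_module])
qed

end

section \<open>Cocycles, coboundaries and their classes\<close>

locale trivial_resolution = fd_algebra scale
  for scale :: "'k::field \<Rightarrow> 'l::ring_1 \<Rightarrow> 'l" +
  fixes R :: "('l, 'p::ab_group_add, 'k) resolution"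
  assumes residue: "residue_field_is_base scale"
    and resolves_trivial: "free_resolution (trivial_act scale) UNIV R"

sublocale trivial_resolution \<subseteq> resolved_module "trivial_act scale" UNIV R
  by (intro resolved_module.intro resolved_module_axioms.intro left_module_trivial residue resolves_trivial)

context trivial_resolution
begin

lemma cochains_iff:
  "f \<in> cochains scale R n \<longleftrightarrow>
    left_hom (res_act R n) (res_mod R n) (trivial_act scale) UNIV f \<and> (\<forall>u. u \<notin> res_mod R n \<longrightarrow> f u = 0)"
  by (simp add: cochains_def)

lemma cochains_restrict:
  assumes "left_hom (res_act R n) (res_mod R n) (trivial_act scale) UNIV f"
  shows "(\<lambda>u. if u \<in> res_mod R n then f u else 0) \<in> cochains scale R n"
  using assms left_module.add_mem[OF res_module] left_module.act_mem[OF res_module]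
  by (simp add: cochains_iff left_hom_def)

lemma cochains_zero: "0 \<in> cochains scale R n"
  by (simp add: cochains_iff left_hom_def trivial_act_def)

lemma cochains_add: "f \<in> cochains scale R n \<Longrightarrow> g \<in> cochains scale R n \<Longrightarrow> f + g \<in> cochains scale R n"
  by (simp add: cochains_iff left_hom_def trivial_act_def algebra_simps)

lemma cochains_smult: "f \<in> cochains scale R n \<Longrightarrow> (\<lambda>u. c * f u) \<in> cochains scale R n"
  by (simp add: cochains_iff left_hom_def trivial_act_def algebra_simps)

lemma cocycles_iff:
  "f \<in> cocycles scale R n \<longleftrightarrow> f \<in> cochains scale R n \<and> (\<forall>u\<in>res_mod R (Suc n). f (res_d R n u) = 0)"
  by (simp add: cocycles_def)

lemma cocycles_zero: "0 \<in> cocycles scale R n"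
  by (simp add: cocycles_iff cochains_zero)

lemma cocycles_add: "f \<in> cocycles scale R n \<Longrightarrow> g \<in> cocycles scale R n \<Longrightarrow> f + g \<in> cocycles scale R n"
  by (simp add: cocycles_iff cochains_add)

lemma cocycles_smult: "f \<in> cocycles scale R n \<Longrightarrow> (\<lambda>u. c * f u) \<in> cocycles scale R n"
  by (simp add: cocycles_iff cochains_smult)

lemma cocycles_sum:
  "(\<And>i. i \<in> A \<Longrightarrow> h i \<in> cocycles scale R n) \<Longrightarrow> (\<Sum>i\<in>A. h i) \<in> cocycles scale R n"
  by (induction A rule: infinite_finite_induct) (simp_all add: cocycles_zero cocycles_add)

lemma cocycles_hom:
  "f \<in> cocycles scale R n \<Longrightarrow> left_hom (res_act R n) (res_mod R n) (trivial_act scale) UNIV f"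
  by (simp add: cocycles_iff cochains_iff)

lemma cocycles_d: "f \<in> cocycles scale R n \<Longrightarrow> u \<in> res_mod R (Suc n) \<Longrightarrow> f (res_d R n u) = 0"
  by (simp add: cocycles_iff)

lemma cocycles_outside: "f \<in> cocycles scale R n \<Longrightarrow> u \<notin> res_mod R n \<Longrightarrow> f u = 0"
  by (simp add: cocycles_iff cochains_iff)

lemma coboundaries_Suc_iff:
  "f \<in> coboundaries scale R (Suc n) \<longleftrightarrow>
    (\<exists>h\<in>cochains scale R n. f = (\<lambda>u. if u \<in> res_mod R (Suc n) then h (res_d R n u) else 0))"
  by auto

lemma coboundaries_zero: "0 \<in> coboundaries scale R n"
proof (cases n)
  case (Suc m)
  have "0 = (\<lambda>u. if u \<in> res_mod R (Suc m) then (0 :: _ \<Rightarrow> 'k) (res_d R m u) else 0)"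
    by (simp add: fun_eq_iff)
  then show ?thesis unfolding Suc coboundaries_Suc_iff using cochains_zero by blast
qed simp

lemma coboundaries_add:
  assumes "f \<in> coboundaries scale R n" "g \<in> coboundaries scale R n"
  shows "f + g \<in> coboundaries scale R n"
proof (cases n)
  case (Suc m)
  from assms obtain h k where h: "h \<in> cochains scale R m" "k \<in> cochains scale R m" 
    "f = (\<lambda>u. if u \<in> res_mod R (Suc m) then h (res_d R m u) else 0)"
    "g = (\<lambda>u. if u \<in> res_mod R (Suc m) then k (res_d R m u) else 0)"
    unfolding Suc coboundaries_Suc_iff by blast
  then show ?thesis unfolding Suc coboundaries_Suc_iff
    by (intro bexI[of _ "h + k"]) (auto simp: cochains_add)
qed (use assms in auto)

lemma coboundaries_smult:
  assumes "f \<in> coboundaries scale R n"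
  shows "(\<lambda>u. c * f u) \<in> coboundaries scale R n"
proof (cases n)
  case 0 then show ?thesis using assms by (simp add: fun_eq_iff)
next
  case (Suc m)
  from assms obtain h where h: "h \<in> cochains scale R m" 
    "f = (\<lambda>u. if u \<in> res_mod R (Suc m) then h (res_d R m u) else 0)"
    unfolding Suc coboundaries_Suc_iff by blast
  then show ?thesis unfolding Suc coboundaries_Suc_iff
    by (intro bexI[of _ "\<lambda>u. c * h u"]) (auto simp: cochains_smult)
qed

lemma coboundaries_uminus:
  assumes "f \<in> coboundaries scale R n" shows "- f \<in> coboundaries scale R n"
proof -
  have "- f = (\<lambda>u. - 1 * f u)" by (simp add: fun_eq_iff)
  then show ?thesis using coboundaries_smult[OF assms, of "- 1"] by simp
qed

lemma coboundaries_diff: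
  "f \<in> coboundaries scale R n \<Longrightarrow> g \<in> coboundaries scale R n \<Longrightarrow> f - g \<in> coboundaries scale R n"
  using coboundaries_add[of f n "- g"] coboundaries_uminus[of g n] by simp

lemma coboundaries_sum:
  "(\<And>i. i \<in> A \<Longrightarrow> h i \<in> coboundaries scale R n) \<Longrightarrow> (\<Sum>i\<in>A. h i) \<in> coboundaries scale R n"
  by (induction A rule: infinite_finite_induct) (simp_all add: coboundaries_zero coboundaries_add)

lemma coboundaries_subset: "coboundaries scale R n \<subseteq> cocycles scale R n"
proof (cases n)
  case (Suc m)
  have "(\<lambda>u. if u \<in> res_mod R (Suc m) then h (res_d R m u) else 0) \<in> cocycles scale R (Suc m)"
    if h: "h \<in> cochains scale R m" for h
  proof -
    have hh: "left_hom (res_act R m) (res_mod R m) (trivial_act scale) UNIV h"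
      using h by (simp add: cochains_iff)
    show ?thesis
      unfolding cocycles_iff
      using cochains_restrict[OF left_hom_comp[OF res_d_hom hh]] left_hom_zero[OF hh res_module]
      by (simp add: res_d_d res_d_mem)
  qed
  then show ?thesis unfolding Suc by auto
qed (simp add: cocycles_zero)

lemma ext_class_iff: "g \<in> ext_class scale R n f \<longleftrightarrow> g \<in> cocycles scale R n \<and> g - f \<in> coboundaries scale R n"
  by (simp add: ext_class_def)

lemma ext_class_self: "f \<in> cocycles scale R n \<Longrightarrow> f \<in> ext_class scale R n f"
  by (simp add: ext_class_iff coboundaries_zero)

lemma ext_class_eqI:
  assumes "f - g \<in> coboundaries scale R n"
  shows "ext_class scale R n f = ext_class scale R n g"
proof -
  have "h - f \<in> coboundaries scale R n \<longleftrightarrow> h - g \<in> coboundaries scale R n" for h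
    using coboundaries_add[of "h - f" n "f - g"] coboundaries_diff[of "h - g" n "f - g"] assms
    by auto
  then show ?thesis by (auto simp: ext_class_iff)
qed

lemma ext_class_zero: "ext_class scale R n 0 = coboundaries scale R n"
  using coboundaries_subset by (auto simp: ext_class_def)

lemma ext_class_coboundary:
  "f \<in> coboundaries scale R n \<Longrightarrow> ext_class scale R n f = coboundaries scale R n"
  using ext_class_eqI[of f 0 n] by (simp add: ext_class_zero)

lemma Ext_class: "f \<in> cocycles scale R n \<Longrightarrow> ext_class scale R n f \<in> Ext scale R n"
  by (simp add: Ext_def)

lemma Ext_coboundaries: "coboundaries scale R n \<in> Ext scale R n"
  using Ext_class[OF cocycles_zero] by (simp add: ext_class_zero)

lemma Ext_E:
  assumes "\<alpha> \<in> Ext scale R n"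
  obtains f where "f \<in> cocycles scale R n" "\<alpha> = ext_class scale R n f"
  using assms by (auto simp: Ext_def)

end

section \<open>Lifted cocycles up to coboundaries\<close>

locale two_trivial_resolutions = R: trivial_resolution scale R + Q: trivial_resolution scale Q
  for scale :: "'k::field \<Rightarrow> 'l::ring_1 \<Rightarrow> 'l"
    and R :: "('l, 'p::ab_group_add, 'k) resolution"
    and Q :: "('l, 'q::ab_group_add, 'k) resolution"

sublocale two_trivial_resolutions \<subseteq>
  two_resolutions "trivial_act scale" UNIV R "trivial_act scale" UNIV Q ..

context two_trivial_resolutions
begin

lemma cocycle_lift:
  assumes G: "G \<in> lifts R Q n g" and f: "f \<in> cocycles scale Q m"
  shows "(\<lambda>u. if u \<in> res_mod R (n + m) then f (G m u) else 0) \<in> cocycles scale R (n + m)"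
  unfolding R.cocycles_iff
proof (intro conjI ballI)
  show "(\<lambda>u. if u \<in> res_mod R (n + m) then f (G m u) else 0) \<in> cochains scale R (n + m)"
    by (rule R.cochains_restrict[OF left_hom_comp[OF liftsD(1)[OF G] Q.cocycles_hom[OF f]]])
  fix u assume u: "u \<in> res_mod R (Suc (n + m))"
  have "G (Suc m) u \<in> res_mod Q (Suc m)"
    using left_hom_mem[OF liftsD(1)[OF G, of "Suc m"]] u by simp
  then show "(if res_d R (n + m) u \<in> res_mod R (n + m) then f (G m (res_d R (n + m) u)) else 0) = 0"
    using liftsD(3)[OF G u] Q.cocycles_d[OF f] by simp
qed

lemma coboundary_lift:
  assumes G: "G \<in> lifts R Q n g" and f: "f \<in> coboundaries scale Q m"
  shows "(\<lambda>u. if u \<in> res_mod R (n + m) then f (G m u) else 0) \<in> coboundaries scale R (n + m)"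
proof (cases m)
  case 0
  then have "(\<lambda>u. if u \<in> res_mod R (n + m) then f (G m u) else 0) = 0" using f by (simp add: fun_eq_iff)
  then show ?thesis by (simp only: R.coboundaries_zero)
next
  case (Suc k)
  then obtain h where h: "h \<in> cochains scale Q k"
      and fh: "f = (\<lambda>u. if u \<in> res_mod Q (Suc k) then h (res_d Q k u) else 0)"
    using f Q.coboundaries_Suc_iff by blast
  have hh: "left_hom (res_act Q k) (res_mod Q k) (trivial_act scale) UNIV h"
    using h by (simp add: Q.cochains_iff)
  have "f (G m u) = h (G k (res_d R (n + k) u))" if "u \<in> res_mod R (Suc (n + k))" for u
    using liftsD(3)[OF G that] left_hom_mem[OF liftsD(1)[OF G, of m], of u] that Suc by (simp add: fh)
  then show ?thesis
    unfolding Suc add_Suc_right R.coboundaries_Suc_iff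
    by (intro bexI[OF _ R.cochains_restrict[OF left_hom_comp[OF liftsD(1)[OF G, of k] hh]]])
      (auto simp: fun_eq_iff Suc R.res_d_mem)
qed

text \<open>With \<open>G\<close> null-homotopic through \<open>s\<close>, the cocycle
  \<open>f\<close> kills the summand that is a boundary in \<open>Q\<close>; what is left is
  \<open>f\<close> after \<open>s\<close> after the differential of \<open>R\<close>, a coboundary.
  In degree \<open>m = 0\<close> nothing is left.\<close>

lemma lift_of_zero_coboundary:
  assumes G: "G \<in> lifts R Q n (\<lambda>u. 0)" and f: "f \<in> cocycles scale Q m"
  shows "(\<lambda>u. if u \<in> res_mod R (n + m) then f (G m u) else 0) \<in> coboundaries scale R (n + m)"
proof -
  note fhom = Q.cocycles_hom[OF f]
  obtain s where shom: "\<And>i. left_hom (res_act R (n + i)) (res_mod R (n + i)) (res_act Q (Suc i)) (res_mod Q (Suc i)) (s i)"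
    and s0: "\<And>u. u \<in> res_mod R n \<Longrightarrow> G 0 u = res_d Q 0 (s 0 u)"
    and sS: "\<And>i u. u \<in> res_mod R (Suc (n + i)) \<Longrightarrow>
       G (Suc i) u = res_d Q (Suc i) (s (Suc i) u) + s i (res_d R (n + i) u)"
    using lifts_homotopy[OF G] by blast
  show ?thesis
  proof (cases m)
    case 0
    then have "(\<lambda>u. if u \<in> res_mod R (n + m) then f (G m u) else 0) = 0"
      using s0 Q.cocycles_d[OF f] left_hom_mem[OF shom[of 0]] by (simp add: fun_eq_iff)
    then show ?thesis by (simp only: R.coboundaries_zero)
  next
    case (Suc k)
    have "f (G m u) = f (s k (res_d R (n + k) u))" if u: "u \<in> res_mod R (Suc (n + k))" for u
    proof -
      have 1: "s (Suc k) u \<in> res_mod Q (Suc (Suc k))"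
        using left_hom_mem[OF shom[of "Suc k"]] u by simp
      have 2: "s k (res_d R (n + k) u) \<in> res_mod Q (Suc k)"
        using left_hom_mem[OF shom[of k]] R.res_d_mem[OF u] by blast
      show ?thesis
        using sS[OF u] left_hom_add[OF fhom] Q.res_d_mem[OF 1] 1 2 Q.cocycles_d[OF f] Suc by simp
    qed
    then show ?thesis
      unfolding Suc add_Suc_right R.coboundaries_Suc_iff
      by (intro bexI[OF _ R.cochains_restrict[OF left_hom_comp[OF shom[of k] fhom[unfolded Suc]]]])
        (auto simp: fun_eq_iff Suc R.res_d_mem)
  qed
qed

lemma cochain_lift_diff:
  assumes G: "G \<in> lifts R Q n g" and H: "H \<in> lifts R Q n g'" and f: "f \<in> cocycles scale Q m"
  shows "(\<lambda>u. if u \<in> res_mod R (n + m) then f (G m u) else 0)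
      - (\<lambda>u. if u \<in> res_mod R (n + m) then f (H m u) else 0)
    = (\<lambda>u. if u \<in> res_mod R (n + m) then f (G m u - H m u) else 0)"
  using left_hom_diff[OF Q.cocycles_hom[OF f] Q.res_module]
    left_hom_mem[OF liftsD(1)[OF G]] left_hom_mem[OF liftsD(1)[OF H]]
  by (auto simp: fun_eq_iff)

lemma lift_unique:
  assumes G: "G \<in> lifts R Q n g" and H: "H \<in> lifts R Q n g" and f: "f \<in> cocycles scale Q m"
  shows "(\<lambda>u. if u \<in> res_mod R (n + m) then f (G m u) else 0)
      - (\<lambda>u. if u \<in> res_mod R (n + m) then f (H m u) else 0) \<in> coboundaries scale R (n + m)"
  unfolding cochain_lift_diff[OF assms]
  by (rule lift_of_zero_coboundary[OF _ f]) (use lifts_diff[OF G H] in simp)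

lemma lift_of_coboundary:
  assumes g: "g \<in> coboundaries scale R n" and G: "G \<in> lifts R Q n g" and f: "f \<in> cocycles scale Q m"
  shows "(\<lambda>u. if u \<in> res_mod R (n + m) then f (G m u) else 0) \<in> coboundaries scale R (n + m)"
proof (cases n)
  case 0
  then have "g = (\<lambda>u. 0)" using g by (simp add: fun_eq_iff)
  then show ?thesis using lift_of_zero_coboundary[OF _ f] G by simp
next
  case (Suc k)
  then obtain h where h: "h \<in> cochains scale R k"
      and gh: "g = (\<lambda>u. if u \<in> res_mod R (Suc k) then h (res_d R k u) else 0)"
    using g R.coboundaries_Suc_iff by blast
  have hh: "left_hom (res_act R k) (res_mod R k) (trivial_act scale) UNIV h"
    using h by (simp add: R.cochains_iff)
  have sub: "h ` res_mod R k \<subseteq> res_aug Q ` res_mod Q 0" using Q.res_aug_surj by simp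
  obtain e where e: "left_hom (res_act R k) (res_mod R k) (res_act Q 0) (res_mod Q 0) e"
      "\<And>u. u \<in> res_mod R k \<Longrightarrow> res_aug Q (e u) = h u"
    using free_lift[OF R.res_module R.res_basis Q.res_module R.left_module_trivial[OF R.residue] hh Q.res_aug_hom sub]
    by blast
  \<comment> \<open>By uniqueness of lifts a single convenient lift of the coboundary suffices: lift
    \<open>h\<close> to \<open>e\<close> with values in the degree 0 module of \<open>Q\<close>, use
    \<open>e\<close> after the differential in degree 0, and zero above. It is a chain map since the
    differential squares to zero.\<close>
  define H where "H = (\<lambda>i :: nat. if i = 0 then (\<lambda>u. e (res_d R k u)) else (\<lambda>u. 0))"
  have "H \<in> lifts R Q n g"
    unfolding lifts_def mem_Collect_eq
  proof (intro conjI allI ballI)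
    show "left_hom (res_act R (n + i)) (res_mod R (n + i)) (res_act Q i) (res_mod Q i) (H i)" for i
      using left_hom_comp[OF R.res_d_hom e(1)] left_hom_zero_map[OF Q.res_module]
      by (cases i) (simp_all add: H_def Suc)
    show "res_aug Q (H 0 u) = g u" if "u \<in> res_mod R n" for u
      using that by (simp add: H_def gh Suc e(2) R.res_d_mem)
    show "H i (res_d R (n + i) u) = res_d Q i (H (Suc i) u)" if "u \<in> res_mod R (Suc (n + i))" for i u
      using that left_hom_zero[OF e(1) R.res_module] left_hom_zero[OF Q.res_d_hom Q.res_module]
      by (cases i) (simp_all add: H_def Suc R.res_d_d)
  qed
  from lift_unique[OF G this f]
  have "(\<lambda>u. if u \<in> res_mod R (n + m) then f (G m u) else 0)
      - (\<lambda>u. if u \<in> res_mod R (n + m) then f (H m u) else 0) \<in> coboundaries scale R (n + m)" .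
  moreover have "(\<lambda>u. if u \<in> res_mod R (n + m) then f (H m u) else 0) \<in> coboundaries scale R (n + m)"
  proof (cases m)
    case 0
    then show ?thesis
      using R.cochains_restrict[OF left_hom_comp[OF e(1) Q.cocycles_hom[OF f[unfolded 0]]]]
      unfolding 0 add_0_right Suc R.coboundaries_Suc_iff
      by (intro bexI[of _ "\<lambda>u. if u \<in> res_mod R k then f (e u) else 0"])
        (auto simp: fun_eq_iff H_def R.res_d_mem)
  next
    case (Suc j)
    then have "(\<lambda>u. if u \<in> res_mod R (n + m) then f (H m u) else 0) = 0"
      using left_hom_zero[OF Q.cocycles_hom[OF f] Q.res_module] by (simp add: H_def fun_eq_iff)
    then show ?thesis by (simp only: R.coboundaries_zero)
  qed
  ultimately show ?thesis using R.coboundaries_add by fastforce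
qed

text \<open>Both representatives change in turn: first \<open>G\<close> becomes \<open>H\<close>
  with \<open>f\<close> fixed, then \<open>f\<close> becomes \<open>f'\<close> with \<open>H\<close>
  fixed.\<close>

lemma lift_change:
  assumes G: "G \<in> lifts R Q n g" and H: "H \<in> lifts R Q n g'" and gg: "g - g' \<in> coboundaries scale R n"
    and f: "f \<in> cocycles scale Q m" and f': "f' \<in> cocycles scale Q m" and ff: "f - f' \<in> coboundaries scale Q m"
  shows "(\<lambda>u. if u \<in> res_mod R (n + m) then f (G m u) else 0)
      - (\<lambda>u. if u \<in> res_mod R (n + m) then f' (H m u) else 0) \<in> coboundaries scale R (n + m)"
proof -
  have "(\<lambda>u. if u \<in> res_mod R (n + m) then f (G m u) else 0)
      - (\<lambda>u. if u \<in> res_mod R (n + m) then f (H m u) else 0) \<in> coboundaries scale R (n + m)"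
    unfolding cochain_lift_diff[OF G H f]
    by (rule lift_of_coboundary[OF gg _ f]) (use lifts_diff[OF G H] in \<open>simp add: fun_diff_def\<close>)
  from R.coboundaries_add[OF this coboundary_lift[OF H ff]] show ?thesis
    by (simp add: fun_eq_iff if_distrib cong: if_cong) (simp add: plus_fun_def fun_diff_def if_distrib cong: if_cong)
qed

end

section \<open>The Ext algebra\<close>

lemma subalgebra_gen_mono: "\<alpha> \<in> subalgebra_gen A S \<Longrightarrow> S \<subseteq> T \<Longrightarrow> \<alpha> \<in> subalgebra_gen A T"
  by (induction rule: subalgebra_gen.induct) (auto intro: subalgebra_gen.intros)

section \<open>Yoneda products and the operations on sequences of classes\<close>

context trivial_resolution
begin

lemma chain_lifts_exist:
  assumes "g \<in> cocycles scale R n"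
  obtains G where "G \<in> chain_lifts R n g"
proof -
  interpret two_trivial_resolutions scale R R ..
  show ?thesis
    using lifts_exist[OF cocycles_hom[OF assms] cocycles_d[OF assms]] that by (auto simp: chain_lifts_eq)
qed

text \<open>All members of the union defining the product coincide by \<open>lift_change\<close>, so
  one choice of representatives and of a lift computes it.\<close>

lemma yoneda_class:
  assumes f: "f \<in> cocycles scale R m" and g: "g \<in> cocycles scale R n" and G: "G \<in> chain_lifts R n g"
  shows "yoneda_product scale R m n (ext_class scale R m f) (ext_class scale R n g) =
    ext_class scale R (m + n) (\<lambda>u. if u \<in> res_mod R (m + n) then f (G m u) else 0)"
    (is "_ = ext_class scale R _ (?F f G)")
proof -
  interpret two_trivial_resolutions scale R R ..
  have eq: "ext_class scale R (m + n) (?F f' G') = ext_class scale R (m + n) (?F f G)"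
    if "f' \<in> ext_class scale R m f" "g' \<in> ext_class scale R n g" "G' \<in> chain_lifts R n g'" for f' g' G'
  proof (rule ext_class_eqI)
    show "?F f' G' - ?F f G \<in> coboundaries scale R (m + n)"
      using lift_change[of G' n g' G g f' m f] that assms
      by (simp add: chain_lifts_eq ext_class_iff add.commute)
  qed
  have "ext_class scale R (m + n) (?F f G) \<subseteq>
      yoneda_product scale R m n (ext_class scale R m f) (ext_class scale R n g)"
    unfolding yoneda_product_def using ext_class_self[OF f] ext_class_self[OF g] G by blast
  moreover have "yoneda_product scale R m n (ext_class scale R m f) (ext_class scale R n g)
      \<subseteq> ext_class scale R (m + n) (?F f G)"
    unfolding yoneda_product_def using eq by blast
  ultimately show ?thesis by blast
qed

lemma yoneda_lift_cocycle:
  assumes f: "f \<in> cocycles scale R m" and G: "G \<in> chain_lifts R n g"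
  shows "(\<lambda>u. if u \<in> res_mod R (m + n) then f (G m u) else 0) \<in> cocycles scale R (m + n)"
proof -
  interpret two_trivial_resolutions scale R R ..
  show ?thesis using cocycle_lift[OF G[unfolded chain_lifts_eq] f] by (simp add: add.commute)
qed

lemma yoneda_zero_left:
  assumes "\<beta> \<in> Ext scale R n"
  shows "yoneda_product scale R m n (coboundaries scale R m) \<beta> = coboundaries scale R (m + n)"
proof -
  obtain g where g: "g \<in> cocycles scale R n" "\<beta> = ext_class scale R n g" using Ext_E[OF assms] .
  obtain G where G: "G \<in> chain_lifts R n g" using chain_lifts_exist[OF g(1)] .
  have "(\<lambda>u. if u \<in> res_mod R (m + n) then (0 :: 'p \<Rightarrow> 'k) (G m u) else 0) = 0"
    by (simp add: fun_eq_iff)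
  then show ?thesis
    using yoneda_class[OF cocycles_zero g(1) G, of m] by (simp only: g(2) ext_class_zero)
qed

lemma yoneda_zero_right:
  assumes "\<alpha> \<in> Ext scale R m"
  shows "yoneda_product scale R m n \<alpha> (coboundaries scale R n) = coboundaries scale R (m + n)"
proof -
  interpret two_trivial_resolutions scale R R ..
  obtain f where f: "f \<in> cocycles scale R m" "\<alpha> = ext_class scale R m f" using Ext_E[OF assms] .
  have 0: "(\<lambda>i u. 0) \<in> chain_lifts R n 0"
    by (simp add: chain_lifts_def left_hom_zero_map[OF res_module] left_hom_zero[OF res_d_hom res_module]
      left_hom_zero[OF res_aug_hom res_module])
  have "(\<lambda>u. if u \<in> res_mod R (m + n) then f 0 else 0) = 0"
    using left_hom_zero[OF cocycles_hom[OF f(1)] res_module] by (simp add: fun_eq_iff)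
  then show ?thesis
    using yoneda_class[OF f(1) cocycles_zero 0] by (simp only: f(2) ext_class_zero)
qed

lemma yoneda_Ext:
  assumes "\<alpha> \<in> Ext scale R m" "\<beta> \<in> Ext scale R n"
  shows "yoneda_product scale R m n \<alpha> \<beta> \<in> Ext scale R (m + n)"
proof -
  obtain f where f: "f \<in> cocycles scale R m" "\<alpha> = ext_class scale R m f" using Ext_E[OF assms(1)] .
  obtain g where g: "g \<in> cocycles scale R n" "\<beta> = ext_class scale R n g" using Ext_E[OF assms(2)] .
  obtain G where G: "G \<in> chain_lifts R n g" using chain_lifts_exist[OF g(1)] .
  show ?thesis
    using yoneda_class[OF f(1) g(1) G] Ext_class[OF yoneda_lift_cocycle[OF f(1) G]] by (simp add: f g)
qed

abbreviation "E \<equiv> Ext_algebra scale R"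

lemma carrier_iff:
  "\<alpha> \<in> carrier E \<longleftrightarrow> (\<forall>n. \<alpha> n \<in> Ext scale R n) \<and> finite {n. \<alpha> n \<noteq> coboundaries scale R n}"
  by (simp add: Ext_algebra_def)

lemma ext_add_apply:
  assumes "f \<in> cocycles scale R n" "g \<in> cocycles scale R n"
    "\<alpha> n = ext_class scale R n f" "\<beta> n = ext_class scale R n g"
  shows "(\<alpha> \<oplus>\<^bsub>E\<^esub> \<beta>) n = ext_class scale R n (f + g)"
proof -
  have "ext_class scale R n (f' + g') = ext_class scale R n (f + g)"
    if "f' \<in> \<alpha> n" "g' \<in> \<beta> n" for f' g'
  proof (rule ext_class_eqI)
    have "f' + g' - (f + g) = (f' - f) + (g' - g)" by simp
    moreover have "(f' - f) + (g' - g) \<in> coboundaries scale R n"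
      using that assms by (intro coboundaries_add) (simp_all add: ext_class_iff)
    ultimately show "f' + g' - (f + g) \<in> coboundaries scale R n" by (simp only:)
  qed
  moreover have "f \<in> \<alpha> n" "g \<in> \<beta> n" using assms ext_class_self by auto
  ultimately have "(\<Union>f\<in>\<alpha> n. \<Union>g\<in>\<beta> n. ext_class scale R n (f + g)) = ext_class scale R n (f + g)"
    by blast
  then show ?thesis by (simp add: Ext_algebra_def)
qed

lemma ext_smult_apply:
  assumes "f \<in> cocycles scale R n" "\<alpha> n = ext_class scale R n f"
  shows "(c \<odot>\<^bsub>E\<^esub> \<alpha>) n = ext_class scale R n (\<lambda>u. c * f u)"
proof -
  have "ext_class scale R n (\<lambda>u. c * f' u) = ext_class scale R n (\<lambda>u. c * f u)" if "f' \<in> \<alpha> n" for f'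
  proof (rule ext_class_eqI)
    have "(\<lambda>u. c * f' u) - (\<lambda>u. c * f u) = (\<lambda>u. c * (f' - f) u)"
      by (simp add: fun_eq_iff algebra_simps)
    then show "(\<lambda>u. c * f' u) - (\<lambda>u. c * f u) \<in> coboundaries scale R n"
      using that coboundaries_smult[of "f' - f" n c] assms by (simp only: ext_class_iff)
  qed
  moreover have "f \<in> \<alpha> n" using assms ext_class_self by auto
  ultimately have "(\<Union>f\<in>\<alpha> n. ext_class scale R n (\<lambda>u. c * f u)) = ext_class scale R n (\<lambda>u. c * f u)"
    by blast
  then show ?thesis by (simp add: Ext_algebra_def)
qed

text \<open>Each summand is determined up to a coboundary, since the product in each bidegree is a
  single class. Any choice \<open>h\<close> of summands therefore gives the same class.\<close>

lemma ext_mult_apply: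
  assumes \<alpha>: "\<And>i. \<alpha> i \<in> Ext scale R i" and \<beta>: "\<And>i. \<beta> i \<in> Ext scale R i"
    and h: "\<And>i. i \<le> n \<Longrightarrow> h i \<in> yoneda_product scale R i (n - i) (\<alpha> i) (\<beta> (n - i))"
  shows "(\<alpha> \<otimes>\<^bsub>E\<^esub> \<beta>) n = ext_class scale R n (\<Sum>i\<le>n. h i)"
proof -
  have diff: "h' - h'' \<in> coboundaries scale R n"
    if i: "i \<le> n" and "h' \<in> yoneda_product scale R i (n - i) (\<alpha> i) (\<beta> (n - i))"
      "h'' \<in> yoneda_product scale R i (n - i) (\<alpha> i) (\<beta> (n - i))" for i h' h''
  proof -
    have "yoneda_product scale R i (n - i) (\<alpha> i) (\<beta> (n - i)) \<in> Ext scale R (i + (n - i))"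
      by (rule yoneda_Ext[OF \<alpha> \<beta>])
    then obtain k where "yoneda_product scale R i (n - i) (\<alpha> i) (\<beta> (n - i)) = ext_class scale R n k"
      using i by (auto elim: Ext_E)
    then show ?thesis
      using that coboundaries_diff[of "h' - k" n "h'' - k"] by (simp add: ext_class_iff)
  qed
  have "ext_class scale R n (\<Sum>i\<le>n. h' i) = ext_class scale R n (\<Sum>i\<le>n. h i)"
    if "\<forall>i\<le>n. h' i \<in> yoneda_product scale R i (n - i) (\<alpha> i) (\<beta> (n - i))" for h'
    using that h diff
    by (intro ext_class_eqI) (auto simp flip: sum_subtractf intro!: coboundaries_sum)
  then have "(\<Union>h\<in>{h. \<forall>i\<le>n. h i \<in> yoneda_product scale R i (n - i) (\<alpha> i) (\<beta> (n - i))}.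
      ext_class scale R n (\<Sum>i\<le>n. h i)) = ext_class scale R n (\<Sum>i\<le>n. h i)"
    using h by blast
  then show ?thesis by (simp add: Ext_algebra_def)
qed

lemma ext_mult_apply_ex:
  assumes \<alpha>: "\<And>i. \<alpha> i \<in> Ext scale R i" and \<beta>: "\<And>i. \<beta> i \<in> Ext scale R i"
  obtains h where "\<And>i. i \<le> n \<Longrightarrow> h i \<in> yoneda_product scale R i (n - i) (\<alpha> i) (\<beta> (n - i))"
    "\<And>i. i \<le> n \<Longrightarrow> h i \<in> cocycles scale R n"
proof -
  have "\<exists>h. i \<le> n \<longrightarrow> h \<in> yoneda_product scale R i (n - i) (\<alpha> i) (\<beta> (n - i)) \<and> h \<in> cocycles scale R n" for i
  proof (cases "i \<le> n")
    case True
    have "yoneda_product scale R i (n - i) (\<alpha> i) (\<beta> (n - i)) \<in> Ext scale R (i + (n - i))"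
      by (rule yoneda_Ext[OF \<alpha> \<beta>])
    then obtain k where "k \<in> cocycles scale R n"
        "yoneda_product scale R i (n - i) (\<alpha> i) (\<beta> (n - i)) = ext_class scale R n k"
      using True by (auto elim: Ext_E)
    then show ?thesis using ext_class_self by blast
  qed simp
  then obtain h where "\<forall>i. i \<le> n \<longrightarrow> h i \<in> yoneda_product scale R i (n - i) (\<alpha> i) (\<beta> (n - i))
      \<and> h i \<in> cocycles scale R n"
    by (rule exE[OF choice[OF allI]])
  then show ?thesis using that by blast
qed

lemma ext_add_carrier:
  assumes "\<alpha> \<in> carrier E" "\<beta> \<in> carrier E"
  shows "\<alpha> \<oplus>\<^bsub>E\<^esub> \<beta> \<in> carrier E"
proof -
  have 1: "(\<alpha> \<oplus>\<^bsub>E\<^esub> \<beta>) n \<in> Ext scale R n" for n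
  proof -
    have "\<alpha> n \<in> Ext scale R n" "\<beta> n \<in> Ext scale R n" using assms by (simp_all add: carrier_iff)
    then obtain f g where fg: "f \<in> cocycles scale R n" "g \<in> cocycles scale R n"
        "\<alpha> n = ext_class scale R n f" "\<beta> n = ext_class scale R n g"
      by (metis Ext_E)
    show ?thesis unfolding ext_add_apply[of _ _ _ \<alpha> \<beta>, OF fg] by (intro Ext_class cocycles_add fg)
  qed
  have "(\<alpha> \<oplus>\<^bsub>E\<^esub> \<beta>) n = coboundaries scale R n"
    if "\<alpha> n = coboundaries scale R n" "\<beta> n = coboundaries scale R n" for n
    using ext_add_apply[OF cocycles_zero cocycles_zero, of \<alpha> n \<beta>] that by (simp add: ext_class_zero)
  then have "{n. (\<alpha> \<oplus>\<^bsub>E\<^esub> \<beta>) n \<noteq> coboundaries scale R n} \<subseteq>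
      {n. \<alpha> n \<noteq> coboundaries scale R n} \<union> {n. \<beta> n \<noteq> coboundaries scale R n}" by blast
  then show ?thesis using 1 assms by (auto simp: carrier_iff intro: finite_subset)
qed

lemma ext_smult_carrier:
  assumes "\<alpha> \<in> carrier E"
  shows "c \<odot>\<^bsub>E\<^esub> \<alpha> \<in> carrier E"
proof -
  have 1: "(c \<odot>\<^bsub>E\<^esub> \<alpha>) n \<in> Ext scale R n" for n
  proof -
    have "\<alpha> n \<in> Ext scale R n" using assms by (simp add: carrier_iff)
    then obtain f where f: "f \<in> cocycles scale R n" "\<alpha> n = ext_class scale R n f"
      by (metis Ext_E)
    show ?thesis unfolding ext_smult_apply[of _ _ \<alpha>, OF f] by (intro Ext_class cocycles_smult f)
  qed
  have "(c \<odot>\<^bsub>E\<^esub> \<alpha>) n = coboundaries scale R n" if "\<alpha> n = coboundaries scale R n" for n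
    using ext_smult_apply[OF cocycles_zero, of \<alpha> n c] that ext_class_zero[of n]
    by (simp add: zero_fun_def)
  then have "{n. (c \<odot>\<^bsub>E\<^esub> \<alpha>) n \<noteq> coboundaries scale R n} \<subseteq> {n. \<alpha> n \<noteq> coboundaries scale R n}" by blast
  then show ?thesis using 1 assms by (auto simp: carrier_iff intro: finite_subset)
qed

lemma ext_mult_carrier:
  assumes "\<alpha> \<in> carrier E" "\<beta> \<in> carrier E"
  shows "\<alpha> \<otimes>\<^bsub>E\<^esub> \<beta> \<in> carrier E"
proof -
  have \<alpha>: "\<alpha> i \<in> Ext scale R i" and \<beta>: "\<beta> i \<in> Ext scale R i" for i
    using assms by (simp_all add: carrier_iff)
  let ?A = "{n. \<alpha> n \<noteq> coboundaries scale R n}" and ?B = "{n. \<beta> n \<noteq> coboundaries scale R n}"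
  have fin: "finite ?A" "finite ?B" using assms by (simp_all add: carrier_iff)
  have 1: "(\<alpha> \<otimes>\<^bsub>E\<^esub> \<beta>) n \<in> Ext scale R n" for n
  proof -
    obtain h where h: "\<And>i. i \<le> n \<Longrightarrow> h i \<in> yoneda_product scale R i (n - i) (\<alpha> i) (\<beta> (n - i))"
        "\<And>i. i \<le> n \<Longrightarrow> h i \<in> cocycles scale R n"
      using ext_mult_apply_ex[OF \<alpha> \<beta>, where n=n] by blast
    show ?thesis using ext_mult_apply[OF \<alpha> \<beta> h(1)] h(2) by (auto intro!: Ext_class cocycles_sum)
  qed
  \<comment> \<open>The support of a product lies in the sumset of the two finite supports; outside
    it every summand is a coboundary.\<close>
  have "n \<in> (\<lambda>(i, j). i + j) ` (?A \<times> ?B)" if "(\<alpha> \<otimes>\<^bsub>E\<^esub> \<beta>) n \<noteq> coboundaries scale R n" for n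
  proof (rule ccontr)
    assume n: "\<not> ?thesis"
    obtain h where h: "\<And>i. i \<le> n \<Longrightarrow> h i \<in> yoneda_product scale R i (n - i) (\<alpha> i) (\<beta> (n - i))"
      using ext_mult_apply_ex[OF \<alpha> \<beta>, where n=n] by blast
    have "h i \<in> coboundaries scale R n" if i: "i \<le> n" for i
    proof -
      have "\<not> (i \<in> ?A \<and> n - i \<in> ?B)"
      proof
        assume "i \<in> ?A \<and> n - i \<in> ?B"
        then have "n \<in> (\<lambda>(i, j). i + j) ` (?A \<times> ?B)"
          using i by (intro image_eqI[of _ _ "(i, n - i)"]) auto
        then show False using n by blast
      qed
      then have "yoneda_product scale R i (n - i) (\<alpha> i) (\<beta> (n - i)) = coboundaries scale R (i + (n - i))"
        using yoneda_zero_left[OF \<beta>] yoneda_zero_right[OF \<alpha>] by auto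
      then show ?thesis using h[OF i] i by simp
    qed
    then have "ext_class scale R n (\<Sum>i\<le>n. h i) = coboundaries scale R n"
      by (intro ext_class_coboundary coboundaries_sum) auto
    then show False using ext_mult_apply[OF \<alpha> \<beta> h] that by simp
  qed
  then have "{n. (\<alpha> \<otimes>\<^bsub>E\<^esub> \<beta>) n \<noteq> coboundaries scale R n} \<subseteq> (\<lambda>(i, j). i + j) ` (?A \<times> ?B)" by blast
  then have "finite {n. (\<alpha> \<otimes>\<^bsub>E\<^esub> \<beta>) n \<noteq> coboundaries scale R n}"
    by (rule finite_subset) (use fin in simp)
  then show ?thesis using 1 by (simp add: carrier_iff)
qed

section \<open>Homogeneous elements and the subalgebra they generate\<close>

definition homogeneous :: "nat \<Rightarrow> ('p \<Rightarrow> 'k) \<Rightarrow> nat \<Rightarrow> ('p \<Rightarrow> 'k) set" where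
  "homogeneous n f = (\<lambda>m. if m = n then ext_class scale R n f else coboundaries scale R m)"

lemma homogeneous_mem: "f \<in> cocycles scale R n \<Longrightarrow> homogeneous n f \<in> Ext_homogeneous scale R n"
proof -
  assume f: "f \<in> cocycles scale R n"
  have "{m. homogeneous n f m \<noteq> coboundaries scale R m} \<subseteq> {n}" by (auto simp: homogeneous_def)
  then have "finite {m. homogeneous n f m \<noteq> coboundaries scale R m}" by (rule finite_subset) simp
  then have "homogeneous n f \<in> carrier E"
    using f by (auto simp: carrier_iff homogeneous_def Ext_class Ext_coboundaries)
  then show ?thesis by (simp add: Ext_homogeneous_def) (simp add: homogeneous_def)
qed

lemma homogeneous_carrier: "f \<in> cocycles scale R n \<Longrightarrow> homogeneous n f \<in> carrier E"
  using homogeneous_mem by (auto simp: Ext_homogeneous_def)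

lemma homogeneous_cong: "f - g \<in> coboundaries scale R n \<Longrightarrow> homogeneous n f = homogeneous n g"
  by (simp add: homogeneous_def fun_eq_iff ext_class_eqI[of f g n])

definition aug_cocycle :: "'p \<Rightarrow> 'k" where
  "aug_cocycle = (\<lambda>u. if u \<in> res_mod R 0 then res_aug R u else 0)"

lemma aug_cocycle: "aug_cocycle \<in> cocycles scale R 0"
  unfolding cocycles_iff aug_cocycle_def using cochains_restrict[OF res_aug_hom] by (simp add: res_d_mem res_aug_d)

lemma ext_one: "\<one>\<^bsub>E\<^esub> = homogeneous 0 aug_cocycle"
  by (auto simp: Ext_algebra_def homogeneous_def aug_cocycle_def fun_eq_iff)

lemma homogeneous_add:
  assumes "f \<in> cocycles scale R n" "g \<in> cocycles scale R n"
  shows "homogeneous n f \<oplus>\<^bsub>E\<^esub> homogeneous n g = homogeneous n (f + g)"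
proof
  fix m
  show "(homogeneous n f \<oplus>\<^bsub>E\<^esub> homogeneous n g) m = homogeneous n (f + g) m"
  proof (cases "m = n")
    case True
    then show ?thesis using ext_add_apply[OF assms] by (simp add: homogeneous_def)
  next
    case False
    then show ?thesis
      using ext_add_apply[OF cocycles_zero cocycles_zero, of "homogeneous n f" m "homogeneous n g"]
      by (simp add: homogeneous_def ext_class_zero)
  qed
qed

lemma homogeneous_smult:
  assumes "f \<in> cocycles scale R n"
  shows "c \<odot>\<^bsub>E\<^esub> homogeneous n f = homogeneous n (\<lambda>u. c * f u)"
proof
  fix m
  show "(c \<odot>\<^bsub>E\<^esub> homogeneous n f) m = homogeneous n (\<lambda>u. c * f u) m"
  proof (cases "m = n")
    case True
    then show ?thesis using ext_smult_apply[OF assms] by (simp add: homogeneous_def)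
  next
    case False
    then show ?thesis
      using ext_smult_apply[OF cocycles_zero, of "homogeneous n f" m c] ext_class_zero[of m]
      by (simp add: homogeneous_def ext_class_zero zero_fun_def)
  qed
qed

lemma homogeneous_mult:
  assumes f: "f \<in> cocycles scale R m" and g: "g \<in> cocycles scale R n" and G: "G \<in> chain_lifts R n g"
  shows "homogeneous m f \<otimes>\<^bsub>E\<^esub> homogeneous n g =
    homogeneous (m + n) (\<lambda>u. if u \<in> res_mod R (m + n) then f (G m u) else 0)"
    (is "?\<alpha> \<otimes>\<^bsub>E\<^esub> ?\<beta> = homogeneous (m + n) ?k")
proof
  fix N
  have \<alpha>: "?\<alpha> i \<in> Ext scale R i" and \<beta>: "?\<beta> i \<in> Ext scale R i" for i
    using homogeneous_carrier f g by (auto simp: carrier_iff)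
  \<comment> \<open>Only the index \<open>i = m\<close> in total degree \<open>m + n\<close> has two
    nonzero factors; all other summands are coboundaries and may be represented by 0.\<close>
  define h where "h = (\<lambda>i. if i = m \<and> N = m + n then ?k else 0)"
  have "h i \<in> yoneda_product scale R i (N - i) (?\<alpha> i) (?\<beta> (N - i))" if i: "i \<le> N" for i
  proof (cases "i = m \<and> N = m + n")
    case True
    then show ?thesis
      using yoneda_class[OF f g G] ext_class_self[OF yoneda_lift_cocycle[OF f G]]
      by (simp add: h_def homogeneous_def)
  next
    case False
    then have "?\<alpha> i = coboundaries scale R i \<or> ?\<beta> (N - i) = coboundaries scale R (N - i)"
      using i by (auto simp: homogeneous_def)
    then have "yoneda_product scale R i (N - i) (?\<alpha> i) (?\<beta> (N - i)) = coboundaries scale R (i + (N - i))"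
      using yoneda_zero_left[OF \<beta>] yoneda_zero_right[OF \<alpha>] by metis
    then show ?thesis using False i coboundaries_zero by (auto simp: h_def)
  qed
  then have "(?\<alpha> \<otimes>\<^bsub>E\<^esub> ?\<beta>) N = ext_class scale R N (\<Sum>i\<le>N. h i)"
    by (rule ext_mult_apply[OF \<alpha> \<beta>])
  also have "(\<Sum>i\<le>N. h i) = (if N = m + n then ?k else 0)"
    by (cases "N = m + n") (simp_all add: h_def)
  also have "ext_class scale R N \<dots> = homogeneous (m + n) ?k N"
    by (simp add: homogeneous_def ext_class_zero)
  finally show "(?\<alpha> \<otimes>\<^bsub>E\<^esub> ?\<beta>) N = homogeneous (m + n) ?k N" .
qed

lemma subalgebra_gen_subset_carrier:
  assumes "S \<subseteq> carrier E" shows "subalgebra_gen E S \<subseteq> carrier E"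
proof
  fix \<alpha> assume "\<alpha> \<in> subalgebra_gen E S"
  then show "\<alpha> \<in> carrier E"
    using assms
    by induction (auto intro: ext_add_carrier ext_mult_carrier ext_smult_carrier
        simp: ext_one homogeneous_carrier[OF aug_cocycle])
qed

lemma carrier_subset_subalgebra_gen:
  assumes hom: "\<And>n f. f \<in> cocycles scale R n \<Longrightarrow> homogeneous n f \<in> subalgebra_gen E S"
  shows "carrier E \<subseteq> subalgebra_gen E S"
proof
  fix \<alpha> assume \<alpha>: "\<alpha> \<in> carrier E"
  define A where "A = {n. \<alpha> n \<noteq> coboundaries scale R n}"
  have "finite A" using \<alpha> by (simp add: A_def carrier_iff)
  then show "\<alpha> \<in> subalgebra_gen E S"
    using \<alpha> A_def
  proof (induction A arbitrary: \<alpha> rule: finite_induct)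
    case empty
    then have "\<alpha> = coboundaries scale R" by blast
    also have "\<dots> = homogeneous 0 0" by (simp add: homogeneous_def ext_class_zero fun_eq_iff)
    finally show ?case using hom[OF cocycles_zero] by simp
  next
    case (insert n A)
    obtain f where f: "f \<in> cocycles scale R n" "\<alpha> n = ext_class scale R n f"
      using insert.prems(1) by (metis Ext_E carrier_iff)
    \<comment> \<open>Induction on the support: deleting the component in degree \<open>n\<close>
      leaves an element to which the induction hypothesis applies, and that component returns as a
      homogeneous summand.\<close>
    define \<beta> where "\<beta> = \<alpha>(n := coboundaries scale R n)"
    have A: "A = {n. \<beta> n \<noteq> coboundaries scale R n}"
      using insert.hyps(2) insert.prems(2) by (auto simp: \<beta>_def)
    then have \<beta>: "\<beta> \<in> carrier E"
      using insert.prems(1) insert.hyps(1) by (auto simp: carrier_iff \<beta>_def Ext_coboundaries)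
    have "\<alpha> = \<beta> \<oplus>\<^bsub>E\<^esub> homogeneous n f"
    proof
      fix m
      obtain g where g: "g \<in> cocycles scale R m" "\<alpha> m = ext_class scale R m g"
        using insert.prems(1) by (metis Ext_E carrier_iff)
      show "\<alpha> m = (\<beta> \<oplus>\<^bsub>E\<^esub> homogeneous n f) m"
      proof (cases "m = n")
        case True
        then show ?thesis
          using ext_add_apply[OF cocycles_zero f(1), of \<beta> "homogeneous n f"] f
          by (simp add: \<beta>_def homogeneous_def ext_class_zero)
      next
        case False
        then show ?thesis
          using ext_add_apply[OF g(1) cocycles_zero, of \<beta> "homogeneous n f"] g
          by (simp add: \<beta>_def homogeneous_def ext_class_zero)
      qed
    qed
    then show ?case
      using insert.IH[OF \<beta> A] hom[OF f(1)] by (simp add: subalgebra_gen.add)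
  qed
qed

end

section \<open>Local selfinjective algebras\<close>

text \<open>A basis through a prescribed vector: it serves to normalise \<open>frob\<close> at
  \<omega> and to test the resulting form at a given element.\<close>

lemma independent_singleton_extend:
  assumes "vector_space scale" and "v \<noteq> 0"
  obtains B where "v \<in> B" "\<not> module.dependent scale B" "module.span scale B = UNIV"
proof -
  interpret vector_space scale by fact
  have "independent {v}" using assms(2) by (simp add: dependent_single)
  from extend_basis_superset[OF this] independent_extend_basis[OF this] span_extend_basis[OF this]
  show ?thesis by (intro that[of "extend_basis {v}"]) blast+
qed

section \<open>The radical of a finite-dimensional algebra with residue field k\<close>

locale local_fd_algebra = fd_algebra scale
  for scale :: "'k::field \<Rightarrow> 'l::ring_1 \<Rightarrow> 'l" +
  assumes residue: "residue_field_is_base scale"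
begin

abbreviation "J \<equiv> jacobson_radical :: 'l set"
abbreviation "aug \<equiv> augmentation scale"

lemmas aug_add = augmentation(2)[OF residue]
  and aug_mult = augmentation(3)[OF residue]
  and aug_scale_one = augmentation(4)[OF residue]

lemma aug_zero [simp]: "aug 0 = 0"
  using aug_scale_one[of 0] by simp

lemma aug_minus: "aug (- a) = - aug a"
  using aug_add[of a "- a"] by (simp add: eq_neg_iff_add_eq_0 add.commute)

lemma scale_eq_mult: "scale c a = scale c 1 * a"
  using scale_mult_left[of c 1 a] by simp

lemma scale_eq_mult_right: "scale c a = a * scale c 1"
  using scale_mult_right[of c a 1] by simp

lemma aug_scale: "aug (scale c a) = c * aug a"
  using scale_eq_mult[of c a] by (simp add: aug_mult aug_scale_one)

lemma radical_iff: "a \<in> J \<longleftrightarrow> aug a = 0"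
  using augmentation(1)[OF residue, of a] augmentation_unique[OF residue, of a 0] by auto

lemma aug_decomp: "a - scale (aug a) 1 \<in> J"
  by (rule augmentation(1)[OF residue])

lemma left_ideal_subspace:
  assumes "left_module (*) I" shows "subspace I"
proof -
  interpret left_module "(*)" I by fact
  have "scale c u \<in> I" if "u \<in> I" for c u
    unfolding scale_eq_mult[of c u] by (rule act_mem[OF that])
  then show ?thesis by (simp add: subspace_def zero_mem add_mem)
qed

lemma left_ideal_UNIV: "left_module (*) (UNIV :: 'l set)"
  by unfold_locales (simp_all add: algebra_simps)

lemma left_ideal_zero: "left_module (*) ({0} :: 'l set)"
  by unfold_locales simp_all

lemma left_ideal_principal: "left_module (*) (range (\<lambda>a. a * b) :: 'l set)"
proof
  show "0 \<in> range (\<lambda>a. a * b)" by (rule range_eqI[of _ _ 0]) simp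
  show "u + v \<in> range (\<lambda>a. a * b)" if "u \<in> range (\<lambda>a. a * b)" "v \<in> range (\<lambda>a. a * b)" for u v
    using that by (auto simp flip: distrib_right)
  show "a * u \<in> range (\<lambda>a. a * b)" if "u \<in> range (\<lambda>a. a * b)" for a u
    using that by (auto simp flip: mult.assoc)
qed (simp_all add: algebra_simps)

lemma dim_left_ideal_psubset:
  assumes "left_module (*) I" "left_module (*) M" "I \<subset> M"
  shows "dim I < dim M"
proof -
  obtain S where S: "finite S" "span S = UNIV" using finite_dim by blast
  obtain B where B: "B \<subseteq> UNIV" "independent B" "UNIV \<subseteq> span B" using maximal_independent_subset[of UNIV] .
  interpret finite_dimensional_vector_space scale B
    by unfold_locales (use B S independent_span_bound[OF S(1) B(2)] in auto)
  have "span I = I" "span M = M" using assms left_ideal_subspace span_eq_iff by blast+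
  then have "span I \<subset> span M" using assms(3) by (simp only:)
  then show ?thesis by (rule dim_psubset)
qed

lemma dim_bounded: "\<exists>d. \<forall>I. dim I < d"
proof -
  obtain S where S: "finite S" "span S = UNIV" using finite_dim by blast
  then show ?thesis using dim_le_card[of _ S] by (intro exI[of _ "Suc (card S)"]) (simp add: less_Suc_eq_le)
qed

text \<open>Dimensions are bounded, so a proper left ideal of greatest dimension takes the place of
  Zorn's lemma.\<close>

lemma maximal_between:
  assumes "left_module (*) I" "I \<subseteq> M" "I \<noteq> (M :: 'l set)"
  shows "\<exists>N. left_module (*) N \<and> I \<subseteq> N \<and> N \<subset> M \<and>
    (\<forall>N'. left_module (*) N' \<longrightarrow> N \<subset> N' \<longrightarrow> N' \<subseteq> M \<longrightarrow> N' = M)"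
proof -
  obtain d where d: "\<And>N. dim N < d" using dim_bounded by blast
  let ?P = "\<lambda>N. left_module (*) N \<and> I \<subseteq> N \<and> N \<subset> M"
  have "?P I" using assms by blast
  then have "\<exists>N. ?P N \<and> (\<forall>N'. ?P N' \<longrightarrow> dim N' \<le> dim N)"
    using d by (intro ex_has_greatest_nat[of ?P I dim d]) simp_all
  then obtain N where N: "?P N" "\<And>N'. ?P N' \<Longrightarrow> dim N' \<le> dim N" by blast
  have "N' = M" if N': "left_module (*) N'" "N \<subset> N'" "N' \<subseteq> M" for N'
  proof (rule ccontr)
    assume "N' \<noteq> M"
    then have "?P N'" using N' N(1) by blast
    then show False using N(2)[of N'] dim_left_ideal_psubset[of N N'] N' N(1) by auto
  qed
  then show ?thesis using N(1) by blast
qed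

text \<open>Otherwise the left ideal generated by \<open>1 - j\<close> lies in a maximal one, which
  also contains \<open>j\<close> and hence 1.\<close>

lemma radical_left_inverse:
  assumes "j \<in> J" shows "\<exists>c. c * (1 - j) = 1"
proof (rule ccontr)
  assume *: "\<nexists>c. c * (1 - j) = 1"
  let ?I = "range (\<lambda>a. a * (1 - j))"
  have "1 \<notin> ?I"
  proof
    assume "1 \<in> ?I"
    then obtain c where "1 = c * (1 - j)" by (rule imageE)
    then have "c * (1 - j) = 1" by (rule sym)
    then show False using * by blast
  qed
  then have "?I \<noteq> UNIV" by auto
  then obtain N where N: "left_module (*) N" "?I \<subseteq> N" "N \<subset> UNIV"
      "\<And>N'. left_module (*) N' \<Longrightarrow> N \<subset> N' \<Longrightarrow> N' \<subseteq> UNIV \<Longrightarrow> N' = UNIV"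
    using maximal_between[OF left_ideal_principal[of "1 - j"] subset_UNIV] by blast
  have "I = N \<or> I = UNIV" if "left_module (*) I" "N \<subseteq> I" for I
    using N(4)[OF that(1)] that(2) by auto
  then have "maximal_left_ideal N" unfolding maximal_left_ideal_def using N(1,3) by auto
  then have "j \<in> N" using assms by (auto simp: jacobson_radical_def)
  moreover have "1 - j \<in> N" by (rule subsetD[OF N(2)], rule range_eqI[of _ _ 1]) simp
  ultimately have "1 \<in> N" using left_module.add_mem[OF N(1), of "1 - j" j] by simp
  then have "a \<in> N" for a using left_module.act_mem[OF N(1), of 1 a] by simp
  then show False using N(3) by blast
qed

text \<open>A left inverse \<open>c\<close> of \<open>1 - j\<close> satisfies
  \<open>c = 1 + c * j\<close>, so it has a left inverse of its own by the same lemma; that inverse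
  must be \<open>1 - j\<close>.\<close>

lemma radical_right_inverse:
  assumes "j \<in> J" shows "\<exists>c. (1 - j) * c = 1"
proof -
  obtain c where c: "c * (1 - j) = 1" using radical_left_inverse[OF assms] by blast
  have "- (c * j) \<in> J" using assms by (simp add: radical_iff aug_minus aug_mult)
  then obtain e where e: "e * (1 - - (c * j)) = 1" using radical_left_inverse by blast
  have ec: "1 - - (c * j) = c" using c by (simp add: algebra_simps)
  have "e = e * (c * (1 - j))" using c by simp
  also have "\<dots> = 1 - j" using e unfolding ec by (simp flip: mult.assoc)
  finally show ?thesis using e ec by metis
qed

text \<open>Nakayama's lemma for left ideals. \<open>N\<close> is maximal among the proper
  submodules of \<open>M\<close>, so the quotient is simple and J annihilates it.\<close>

lemma radical_times_proper:
  assumes M: "left_module (*) M" "M \<noteq> {0}"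
  shows "\<exists>N. left_module (*) N \<and> N \<subset> M \<and> (\<forall>j\<in>J. \<forall>m\<in>M. j * m \<in> N)"
proof -
  interpret M: left_module "(*)" M by fact
  have "{0} \<subseteq> M" "{0} \<noteq> M" using M.zero_mem M(2) by auto
  from maximal_between[OF left_ideal_zero this]
  obtain N where N: "left_module (*) N" "N \<subset> M"
      and max: "\<And>N'. left_module (*) N' \<Longrightarrow> N \<subset> N' \<Longrightarrow> N' \<subseteq> M \<Longrightarrow> N' = M"
    by blast
  interpret N: left_module "(*)" N by fact
  have "j * m \<in> N" if j: "j \<in> J" and m: "m \<in> M" for j m
  proof (rule ccontr)
    assume jm: "j * m \<notin> N"
    \<comment> \<open>\<open>N'\<close> is the sum of \<open>N\<close> and the left ideal generated
      by \<open>j * m\<close>. By maximality it is \<open>M\<close> and contains \<open>m\<close>,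
      so \<open>(1 - a * j) * m\<close> lies in \<open>N\<close> for some \<open>a\<close>; then
      \<open>m\<close> does too, as \<open>1 - a * j\<close> is left invertible.\<close>
    define N' where "N' = {u. \<exists>a. u - a * (j * m) \<in> N}"
    have N'_I: "u \<in> N'" if "u - a * (j * m) \<in> N" for u a using that by (auto simp: N'_def)
    have "left_module (*) N'"
    proof
      show "0 \<in> N'" using N'_I[of 0 0] N.zero_mem by simp
      show "u + v \<in> N'" if uv: "u \<in> N'" "v \<in> N'" for u v
      proof -
        obtain a b where "u - a * (j * m) \<in> N" "v - b * (j * m) \<in> N"
          using uv by (auto simp: N'_def)
        from N.add_mem[OF this] have "u + v - (a + b) * (j * m) \<in> N" by (simp add: algebra_simps)
        then show ?thesis by (rule N'_I)
      qed
      show "r * u \<in> N'" if u: "u \<in> N'" for r u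
      proof -
        obtain a where "u - a * (j * m) \<in> N" using u by (auto simp: N'_def)
        from N.act_mem[OF this, of r] have "r * u - (r * a) * (j * m) \<in> N"
          by (simp add: right_diff_distrib mult.assoc)
        then show ?thesis by (rule N'_I)
      qed
    qed (simp_all add: algebra_simps)
    moreover have "N \<subset> N'"
    proof
      show "N \<subseteq> N'" using N'_I[of _ 0] by auto
      show "N \<noteq> N'" using jm N'_I[of "j * m" 1] N.zero_mem by auto
    qed
    moreover have "N' \<subseteq> M"
    proof
      fix u assume "u \<in> N'"
      then obtain a where "u - a * (j * m) \<in> N" by (auto simp: N'_def)
      then have "u - a * (j * m) \<in> M" using N(2) by blast
      from M.add_mem[OF this M.act_mem[OF M.act_mem[OF m]], of a j] show "u \<in> M" by simp
    qed
    ultimately have "m \<in> N'" using max m by blast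
    then obtain a where a: "m - a * (j * m) \<in> N" by (auto simp: N'_def)
    have "a * j \<in> J" using j by (simp add: radical_iff aug_mult)
    then obtain c where c: "c * (1 - a * j) = 1" using radical_left_inverse by blast
    have "c * (m - a * (j * m)) = c * (1 - a * j) * m" by (simp add: algebra_simps)
    then have "m \<in> N" using N.act_mem[OF a, of c] c by simp
    then show False using jm N.act_mem by blast
  qed
  then show ?thesis using N by blast
qed

text \<open>Each radical factor moves \<open>M\<close> into a proper submodule, and the dimension
  drops. The last factor of the list acts on \<open>m\<close> first, hence the case split at the end
  of the list.\<close>

lemma radical_nilpotent_aux:
  assumes "left_module (*) M"
  shows "\<exists>d. \<forall>js m. length js = d \<longrightarrow> set js \<subseteq> J \<longrightarrow> m \<in> M \<longrightarrow> prod_list js * m = 0"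
  using assms
proof (induction "dim M" arbitrary: M rule: less_induct)
  case less
  show ?case
  proof (cases "M = {0}")
    case False
    obtain N where N: "left_module (*) N" "N \<subset> M" "\<And>j m. j \<in> J \<Longrightarrow> m \<in> M \<Longrightarrow> j * m \<in> N"
      using radical_times_proper[OF less.prems False] by blast
    obtain d where d: "\<And>js m. length js = d \<Longrightarrow> set js \<subseteq> J \<Longrightarrow> m \<in> N \<Longrightarrow> prod_list js * m = 0"
      using less.hyps[OF dim_left_ideal_psubset[OF N(1) less.prems N(2)] N(1)] by blast
    have "prod_list js * m = 0" if len: "length js = Suc d" and "set js \<subseteq> J" "m \<in> M" for js m
    proof -
      obtain ks j where js: "js = ks @ [j]" using len by (cases js rule: rev_cases) auto
      then show ?thesis using d[of ks "j * m"] N(3)[of j m] that by (simp add: mult.assoc)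
    qed
    then show ?thesis by blast
  qed auto
qed

lemma radical_nilpotent:
  "\<exists>d. \<forall>js. length js = Suc d \<longrightarrow> set js \<subseteq> J \<longrightarrow> prod_list js = 0"
proof -
  obtain d where d: "\<And>js m. length js = d \<Longrightarrow> set js \<subseteq> J \<Longrightarrow> prod_list js * m = 0"
    using radical_nilpotent_aux[OF left_ideal_UNIV] by auto
  have "prod_list js = 0" if len: "length js = Suc d" and "set js \<subseteq> J" for js
  proof -
    obtain ks j where "js = ks @ [j]" using len by (cases js rule: rev_cases) auto
    then show ?thesis using d[of ks j] that by simp
  qed
  then show ?thesis by blast
qed

text \<open>Take a longest product of radical elements that does not kill \<open>b\<close>; by
  nilpotency it exists, and one more factor from the left kills the result.\<close>

lemma multiple_in_socle:
  assumes "b \<noteq> 0"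
  obtains a where "a * b \<noteq> 0" "\<And>j. j \<in> J \<Longrightarrow> j * (a * b) = 0"
proof -
  obtain d where d: "\<And>js. length js = Suc d \<Longrightarrow> set js \<subseteq> J \<Longrightarrow> prod_list js = 0"
    using radical_nilpotent by blast
  let ?P = "\<lambda>k. \<exists>js. length js = k \<and> set js \<subseteq> J \<and> prod_list js * b \<noteq> 0"
  have "?P 0" using assms by simp
  moreover have "k < Suc d" if k: "?P k" for k
  proof (rule ccontr)
    assume "\<not> k < Suc d"
    obtain js where js: "length js = k" "set js \<subseteq> J" "prod_list js * b \<noteq> 0" using k by blast
    have "prod_list (take (Suc d) js) = 0"
      by (rule d) (use js \<open>\<not> k < Suc d\<close> set_take_subset[of "Suc d" js] in auto)
    then have "prod_list (take (Suc d) js @ drop (Suc d) js) = 0" unfolding prod_list.append by simp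
    then show False using js(3) by simp
  qed
  ultimately obtain k where k: "?P k" "\<And>k'. ?P k' \<Longrightarrow> k' \<le> k"
    using ex_has_greatest_nat[of ?P 0 id "Suc d"] by auto
  then obtain js where js: "length js = k" "set js \<subseteq> J" "prod_list js * b \<noteq> 0" by blast
  have "j * (prod_list js * b) = 0" if "j \<in> J" for j
  proof (rule ccontr)
    assume "j * (prod_list js * b) \<noteq> 0"
    then have "?P (Suc k)" using js that by (intro exI[of _ "j # js"]) (simp add: mult.assoc)
    then show False using k(2)[of "Suc k"] by simp
  qed
  then show ?thesis using js that by blast
qed

lemma socle_annihilated:
  assumes "w \<in> socle" "j \<in> J" shows "j * w = 0"
proof -
  obtain n a where w: "w = (\<Sum>i<n::nat. a i)" and a: "\<forall>i<n. \<exists>M. minimal_left_ideal M \<and> a i \<in> M"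
    using assms(1) unfolding socle_def mem_Collect_eq by (elim exE conjE)
  have "j * a i = 0" if i: "i < n" for i
  proof -
    obtain M where M: "minimal_left_ideal M" "a i \<in> M" using a[rule_format, OF i] by (elim exE conjE)
    then have "left_module (*) M" "M \<noteq> {0}" by (auto simp: minimal_left_ideal_def)
    from radical_times_proper[OF this] obtain N where N: "left_module (*) N" "N \<subset> M" "\<And>j m. j \<in> J \<Longrightarrow> m \<in> M \<Longrightarrow> j * m \<in> N"
      by blast
    \<comment> \<open>A simple left ideal has no proper submodule but 0, so J times it
      vanishes.\<close>
    then have "N = {0}" using M(1) unfolding minimal_left_ideal_def by blast
    then show ?thesis using N(3)[OF assms(2) M(2)] by simp
  qed
  then show ?thesis by (simp add: w sum_distrib_left)
qed

text \<open>Since \<open>p\<close> and \<open>q\<close> span J modulo its square,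
  \<open>b * J^k\<close> is contained in \<open>b * J^(k+1)\<close> for \<open>k\<close> at least 1.
  Hence all these sets vanish with the highest one.\<close>

lemma radical_generated_right:
  assumes gen: "\<And>j. j \<in> J \<Longrightarrow> \<exists>\<alpha> \<beta>. j - (scale \<alpha> p + scale \<beta> q) \<in> ideal_times (*) J J"
    and b: "b * p = 0" "b * q = 0" and j: "j \<in> J"
  shows "b * j = 0"
proof -
  obtain d where d: "\<And>js. length js = Suc d \<Longrightarrow> set js \<subseteq> J \<Longrightarrow> prod_list js = 0"
    using radical_nilpotent by blast
  let ?Q = "\<lambda>k. \<forall>js. length js = k \<longrightarrow> set js \<subseteq> J \<longrightarrow> b * prod_list js = 0"
  have step: "?Q (Suc k)" if Q: "?Q (Suc (Suc k))" for k
  proof (intro allI impI)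
    fix js :: "'l list" assume js: "length js = Suc k" "set js \<subseteq> J"
    then obtain i ks where ks: "js = i # ks" "length ks = k" by (auto simp: length_Suc_conv)
    then obtain \<alpha> \<beta> where "i - (scale \<alpha> p + scale \<beta> q) \<in> ideal_times (*) J J" using gen[of i] js(2) by auto
    then obtain n a u where s: "i - (scale \<alpha> p + scale \<beta> q) = (\<Sum>t<n::nat. a t * u t)"
        and au: "\<forall>t<n. a t \<in> J \<and> u t \<in> J"
      unfolding ideal_times_def mem_Collect_eq by (elim exE conjE)
    have "b * (a t * u t) * prod_list ks = 0" if "t < n" for t
      using Q[rule_format, of "a t # u t # ks"] au that ks js(2) by (simp add: mult.assoc)
    then have "b * (\<Sum>t<n. a t * u t) * prod_list ks = 0"
      by (simp add: sum_distrib_left sum_distrib_right)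
    moreover have "i = scale \<alpha> p + scale \<beta> q + (\<Sum>t<n. a t * u t)" using s by (simp add: algebra_simps)
    then have "b * i = b * (\<Sum>t<n. a t * u t)" using b by (simp add: distrib_left flip: scale_mult_right)
    ultimately have "b * i * prod_list ks = 0" by (simp only:)
    then show "b * prod_list js = 0" by (simp add: ks mult.assoc)
  qed
  \<comment> \<open>Descent on the number of factors, from \<open>Suc d\<close>, where nilpotency
    applies, down to one.\<close>
  have "?Q (Suc (d - i))" if "i \<le> d" for i
    using that
  proof (induction i)
    case 0
    show ?case using d by (metis diff_zero mult_zero_right)
  next
    case (Suc i)
    then have "d - i = Suc (d - Suc i)" by simp
    then show ?case using step[of "d - Suc i"] Suc by simp
  qed
  from this[of d] have "?Q (Suc 0)" by simp
  from this[rule_format, of "[j]"] show ?thesis using j by simp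
qed

text \<open>The test modules of \<open>selfinjective\<close> consist of sequences, so the regular
  module and the ideal are first copied into coordinate 0. The element \<open>e\<close> is the value
  of the extension at 1.\<close>

lemma selfinjective_extend:
  assumes inj: "selfinjective TYPE('l)" and I: "left_module (*) I"
    and h: "\<And>u v. u \<in> I \<Longrightarrow> v \<in> I \<Longrightarrow> h (u + v) = h u + h v" "\<And>a u. u \<in> I \<Longrightarrow> h (a * u) = a * h u"
  shows "\<exists>e :: 'l. \<forall>u\<in>I. h u = u * e"
proof -
  interpret I: left_module "(*)" I by fact
  let ?M = "std_free 1 :: (nat \<Rightarrow> 'l) set"
  let ?N = "{v \<in> ?M. v 0 \<in> I}"
  have N: "left_module std_act ?N"
    by unfold_locales (auto simp: std_act_def std_free_def fun_eq_iff algebra_simps I.zero_mem I.add_mem I.act_mem)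
  have "left_hom std_act ?N (*) (UNIV :: 'l set) (\<lambda>v. h (v 0))"
    by (simp add: left_hom_def h std_act_def)
  from inj[unfolded selfinjective_def, rule_format, OF left_module_std N _ this, of 1]
  obtain g where g: "left_hom std_act ?M (*) UNIV g" "\<And>v. v \<in> ?N \<Longrightarrow> g v = h (v 0)"
    by auto
  have "h u = u * g (unit_vec 0)" if "u \<in> I" for u
  proof -
    let ?v = "std_act u (unit_vec 0) :: nat \<Rightarrow> 'l"
    have e: "unit_vec 0 \<in> ?M" by (simp add: unit_vec_def std_free_def)
    then have "?v \<in> ?M" by (rule left_module.act_mem[OF left_module_std])
    moreover have "?v 0 = u" by (simp add: std_act_def unit_vec_def)
    ultimately have "g ?v = h u" using g(2)[of ?v] that by simp
    then show ?thesis using left_hom_act[OF g(1) e, of u] by simp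
  qed
  then show ?thesis by blast
qed

lemma socle_scale:
  assumes "\<And>j. j \<in> J \<Longrightarrow> j * w = 0"
  shows "a * w = scale (aug a) w"
  using assms[OF aug_decomp, of a] scale_eq_mult[of "aug a" w] by (simp add: left_diff_distrib)

end

section \<open>The socle and the Frobenius form\<close>

locale local_selfinjective = local_fd_algebra scale
  for scale :: "'k::field \<Rightarrow> 'l::ring_1 \<Rightarrow> 'l" +
  fixes \<omega> :: 'l
  assumes selfinj: "selfinjective TYPE('l)" and omega_nz: "\<omega> \<noteq> 0" and omega_socle: "\<omega> \<in> socle"
begin

text \<open>On the line spanned by \<open>w\<close>, and on that spanned by \<open>b\<close>, the
  algebra acts through the augmentation. So sending \<open>w\<close> to \<open>b\<close> is left
  linear, and by injectivity it is right multiplication by some \<open>e\<close>.\<close>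

lemma socle_multiple:
  assumes w: "w \<noteq> 0" "\<And>j. j \<in> J \<Longrightarrow> j * w = 0" and b: "\<And>j. j \<in> J \<Longrightarrow> j * b = 0"
  obtains e where "b = w * e"
proof -
  let ?I = "range (\<lambda>\<gamma>. scale \<gamma> w)"
  have I: "left_module (*) ?I"
  proof
    show "0 \<in> ?I" by (rule range_eqI[of _ _ 0]) simp
    show "u + v \<in> ?I" if "u \<in> ?I" "v \<in> ?I" for u v
      using that by (auto simp flip: scale_left_distrib)
    show "a * u \<in> ?I" if uI: "u \<in> ?I" for a u
    proof -
      obtain \<gamma> where u: "u = scale \<gamma> w" using uI by blast
      have "a * u = scale (\<gamma> * aug a) w" by (simp add: u socle_scale[OF w(2)] flip: scale_mult_right)
      then show ?thesis by (rule range_eqI)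
    qed
  qed (simp_all add: algebra_simps)
  define h where "h = (\<lambda>u. scale (THE \<gamma>. u = scale \<gamma> w) b)"
  have h: "h (scale \<gamma> w) = scale \<gamma> b" for \<gamma>
    using w(1) by (simp add: h_def)
  have "\<exists>e. \<forall>u\<in>?I. h u = u * e"
  proof (rule selfinjective_extend[OF selfinj I])
    show "h (u + v) = h u + h v" if uvI: "u \<in> ?I" "v \<in> ?I" for u v
    proof -
      obtain \<gamma> \<delta> where uv: "u = scale \<gamma> w" "v = scale \<delta> w" using uvI by blast
      have "h (scale \<gamma> w + scale \<delta> w) = h (scale (\<gamma> + \<delta>) w)" by (simp only: scale_left_distrib)
      also have "\<dots> = h (scale \<gamma> w) + h (scale \<delta> w)" unfolding h by (rule scale_left_distrib)
      finally show ?thesis unfolding uv .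
    qed
    show "h (a * u) = a * h u" if uI: "u \<in> ?I" for a u
    proof -
      obtain \<gamma> where u: "u = scale \<gamma> w" using uI by blast
      have "a * u = scale (\<gamma> * aug a) w" by (simp add: u socle_scale[OF w(2)] flip: scale_mult_right)
      then have "h (a * u) = scale (\<gamma> * aug a) b" by (simp only: h)
      also have "\<dots> = a * scale \<gamma> b" by (simp add: socle_scale[OF b] flip: scale_mult_right)
      finally show ?thesis by (simp only: u h)
    qed
  qed
  then obtain e where e: "\<forall>u\<in>?I. h u = u * e" by (rule exE)
  have "b = w * e" using bspec[OF e rangeI, of 1] h[of 1] by simp
  then show ?thesis by (rule that)
qed

lemma omega_left: "j \<in> J \<Longrightarrow> j * \<omega> = 0"
  by (rule socle_annihilated[OF omega_socle])

text \<open>If \<open>\<omega> * j\<close> is nonzero, it is again annihilated by J from the left,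
  so \<open>\<omega> = \<omega> * j * e\<close> for some \<open>e\<close>. As
  \<open>1 - j * e\<close> has a right inverse, this forces \<omega> to vanish.\<close>

lemma omega_right:
  assumes "j \<in> J" shows "\<omega> * j = 0"
proof (rule ccontr)
  assume nz: "\<omega> * j \<noteq> 0"
  have "i * (\<omega> * j) = 0" if "i \<in> J" for i
    using omega_left[OF that] by (simp flip: mult.assoc)
  then obtain e where e: "\<omega> = \<omega> * j * e" using socle_multiple[OF nz _ omega_left] by blast
  have "\<omega> * (1 - j * e) = \<omega> - \<omega> * j * e" by (simp add: right_diff_distrib mult.assoc)
  also have "\<dots> = 0" unfolding e[symmetric] by simp
  finally have z: "\<omega> * (1 - j * e) = 0" .
  have "j * e \<in> J" using assms by (simp add: radical_iff aug_mult)
  then obtain c where c: "(1 - j * e) * c = 1" using radical_right_inverse by blast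
  have "\<omega> * ((1 - j * e) * c) = 0" unfolding mult.assoc[symmetric] z by simp
  then have "\<omega> = 0" unfolding c by simp
  then show False using omega_nz by blast
qed

lemma socle_one_dim:
  assumes b: "\<And>j. j \<in> J \<Longrightarrow> j * b = 0"
  obtains \<beta> where "b = scale \<beta> \<omega>"
proof -
  obtain e where "b = \<omega> * e" using socle_multiple[OF omega_nz omega_left b] by blast
  also have "\<dots> = scale (aug e) \<omega>"
    using omega_right[OF aug_decomp, of e] scale_eq_mult_right[of "aug e" \<omega>] by (simp add: algebra_simps)
  finally show ?thesis using that by blast
qed

text \<open>A Frobenius functional. Any linear functional with value 1 at \<omega> will do, for
  instance a coordinate in a basis containing \<omega>; the choice has no influence on the
  argument.\<close>

definition frob :: "'l \<Rightarrow> 'k" where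
  "frob = (SOME f. (\<forall>a b. f (a + b) = f a + f b) \<and> (\<forall>c a. f (scale c a) = c * f a) \<and> f \<omega> = 1)"

lemma frob: "frob (a + b) = frob a + frob b" "frob (scale c a) = c * frob a" "frob \<omega> = 1"
proof -
  obtain B where B: "\<omega> \<in> B" "independent B" "span B = UNIV"
    using independent_singleton_extend[OF vector_space_axioms omega_nz] .
  have "\<exists>f. (\<forall>a b. f (a + b) = f a + f b) \<and> (\<forall>c a. f (scale c a) = c * f a) \<and> f \<omega> = 1"
    using B by (intro exI[of _ "\<lambda>v. representation B v \<omega>"])
      (simp add: representation_add representation_scale representation_basis)
  from someI_ex[OF this] show "frob (a + b) = frob a + frob b" "frob (scale c a) = c * frob a" "frob \<omega> = 1"
    unfolding frob_def[symmetric] by blast+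
qed

lemma frob_zero [simp]: "frob 0 = 0"
  using frob(2)[of 0 0] by simp

lemma frob_diff: "frob (a - b) = frob a - frob b"
  using frob(1)[of "a - b" b] by simp

text \<open>A nonzero \<open>b\<close> has a nonzero multiple in the line of \<omega>, on which
  \<open>frob\<close> is injective.\<close>

lemma frob_nondegenerate_left:
  assumes "\<And>a. frob (a * b) = 0" shows "b = 0"
proof (rule ccontr)
  assume "b \<noteq> 0"
  then obtain a where a: "a * b \<noteq> 0" "\<And>j. j \<in> J \<Longrightarrow> j * (a * b) = 0" using multiple_in_socle by blast
  then obtain \<beta> where "a * b = scale \<beta> \<omega>" using socle_one_dim by blast
  then show False using assms[of a] a(1) by (auto simp: frob)
qed

text \<open>The left nondegenerate form \<open>(a, b) \<mapsto> frob (a b)\<close> is right nondegenerate, as the injective linear map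
  \<open>\<Lambda> \<rightarrow> \<Lambda>\<^sup>*\<close>, written in coordinates, is surjective.\<close>

lemma frob_nondegenerate_right:
  assumes "\<And>a. frob (b * a) = 0" shows "b = 0"
proof (rule ccontr)
  assume "b \<noteq> 0"
  then obtain B where B: "b \<in> B" "independent B" "span B = UNIV"
    using independent_singleton_extend[OF vector_space_axioms] by blast
  obtain S where S: "finite S" "span S = UNIV" using finite_dim by blast
  have fin: "finite B" using independent_span_bound[OF S(1) B(2)] S by simp
  interpret V: finite_dimensional_vector_space scale B by unfold_locales (use B fin in auto)
  interpret VV: finite_dimensional_vector_space_pair scale B scale B ..
  define L where "L = (\<lambda>a. \<Sum>t\<in>B. scale (frob (t * a)) t)"
  have lin: "Vector_Spaces.linear scale scale L"
    by unfold_locales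
      (simp_all add: L_def frob distrib_left scale_left_distrib sum.distrib scale_sum_right flip: scale_mult_right)
  have "a = 0" if "L a = 0" for a
  proof (rule frob_nondegenerate_left)
    have t: "frob (t * a) = 0" if "t \<in> B" for t
      using independentD[OF B(2) fin subset_refl _ that, of "\<lambda>t. frob (t * a)"] \<open>L a = 0\<close> by (simp add: L_def)
    fix r
    have "r \<in> span B" using B(3) by simp
    then show "frob (r * a) = 0"
      by (induction r rule: span_induct_alt) (simp_all add: distrib_right frob t flip: scale_mult_left)
  qed
  moreover have "L (a - a') = L a - L a'" for a a'
    by (simp add: L_def right_diff_distrib frob_diff scale_left_diff_distrib sum_subtractf)
  ultimately have "inj L" by (metis injI right_minus_eq)
  then have "surj L" by (rule VV.linear_injective_imp_surjective[OF lin _ refl])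
  then obtain a where "L a = b" by (metis surjD)
  \<comment> \<open>The vector \<open>b\<close> was put into the basis for this comparison: the
    coordinate of \<open>L a = b\<close> at \<open>b\<close> is \<open>frob (b * a)\<close>, so it
    equals 1.\<close>
  then have "(\<Sum>t\<in>B. scale (frob (t * a) - (if t = b then 1 else 0)) t) = 0"
    using B(1) fin by (simp add: L_def scale_left_diff_distrib sum_subtractf if_distrib[of "\<lambda>c. scale c _"] cong: if_cong)
  from independentD[OF B(2) fin subset_refl this B(1)] have "frob (b * a) = 1" by simp
  then show False using assms by simp
qed

text \<open>Subtracting \<open>scale (frob b) \<omega>\<close> gives an element that J still
  annihilates by right multiplication and on which \<open>frob\<close> vanishes. Its right multiples
  are scalar multiples of it, so it is orthogonal to everything.\<close>

lemma right_annihilator_radical: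
  assumes "\<And>j. j \<in> J \<Longrightarrow> b * j = 0"
  shows "b = scale (frob b) \<omega>"
proof -
  let ?b = "b - scale (frob b) \<omega>"
  have "frob (?b * a) = 0" for a
  proof -
    have "?b * (a - scale (aug a) 1) = 0"
      using assms[OF aug_decomp] omega_right[OF aug_decomp] by (simp add: left_diff_distrib flip: scale_mult_left)
    then have "?b * a = scale (aug a) ?b"
      using scale_eq_mult_right[of "aug a" ?b] by (simp add: right_diff_distrib)
    then show ?thesis by (simp add: frob frob_diff)
  qed
  then have "?b = 0" by (rule frob_nondegenerate_right)
  then show ?thesis by simp
qed

end

section \<open>The second syzygy\<close>

lemma (in local_fd_algebra) radical_square_add_product:
  assumes "u \<in> ideal_times (*) J J" "a \<in> J" "b \<in> J"
  shows "u + a * b \<in> ideal_times (*) J J"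
proof -
  obtain n f g where "u = (\<Sum>i<n::nat. f i * g i)" "\<forall>i<n. f i \<in> J \<and> g i \<in> J"
    using assms(1) unfolding ideal_times_def mem_Collect_eq by (elim exE conjE)
  then have "u + a * b = (\<Sum>i<Suc n. (f(n := a)) i * (g(n := b)) i)"
      "\<forall>i<Suc n. (f(n := a)) i \<in> J \<and> (g(n := b)) i \<in> J"
    using assms(2,3) by (auto simp: less_Suc_eq)
  then show ?thesis unfolding ideal_times_def mem_Collect_eq by blast
qed

lemma (in local_fd_algebra) radical_square_subspace: "subspace (ideal_times (*) J J)"
  unfolding subspace_def
proof (intro conjI ballI allI)
  show zero: "0 \<in> ideal_times (*) J J"
    unfolding ideal_times_def mem_Collect_eq by (rule exI[of _ 0]) simp
  fix u assume u: "u \<in> ideal_times (*) J J"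
  show "u + v \<in> ideal_times (*) J J" if "v \<in> ideal_times (*) J J" for v
  proof -
    obtain n f g where v: "v = (\<Sum>i<n::nat. f i * g i)" "\<forall>i<n. f i \<in> J \<and> g i \<in> J"
      using \<open>v \<in> _\<close> unfolding ideal_times_def mem_Collect_eq by (elim exE conjE)
    have "u + (\<Sum>i<m. f i * g i) \<in> ideal_times (*) J J" if "m \<le> n" for m
      using that
    proof (induction m)
      case (Suc m)
      then show ?case
        using radical_square_add_product[of "u + (\<Sum>i<m. f i * g i)" "f m" "g m"] v(2)
        by (simp add: add.assoc)
    qed (simp add: u)
    then show ?thesis using v(1) by blast
  qed
  fix c
  obtain n f g where "u = (\<Sum>i<n::nat. f i * g i)" "\<forall>i<n. f i \<in> J \<and> g i \<in> J"
    using u unfolding ideal_times_def mem_Collect_eq by (elim exE conjE)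
  then have "scale c u = (\<Sum>i<n. scale c (f i) * g i)" "\<forall>i<n. scale c (f i) \<in> J \<and> g i \<in> J"
    by (simp_all add: scale_sum_right scale_mult_left radical_iff aug_scale)
  then show "scale c u \<in> ideal_times (*) J J"
    unfolding ideal_times_def mem_Collect_eq by (intro exI[of _ n] exI[of _ "\<lambda>i. scale c (f i)"] exI[of _ g]) simp
qed

lemma (in local_fd_algebra) radical_square_product:
  "a \<in> J \<Longrightarrow> b \<in> J \<Longrightarrow> a * b \<in> ideal_times (*) J J"
  using radical_square_add_product[of 0 a b] subspace_0[OF radical_square_subspace] by simp

section \<open>The relations among x and y under the hypotheses of the theorem\<close>

locale koszul_data = local_selfinjective scale \<omega>
  for scale :: "'k::field \<Rightarrow> 'l::ring_1 \<Rightarrow> 'l" and \<omega> +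
  fixes x y \<psi>\<^sub>1 \<psi>\<^sub>2 \<sigma>\<^sub>1 \<sigma>\<^sub>2 \<theta>\<^sub>1 \<theta>\<^sub>2 \<rho>\<^sub>1 \<rho>\<^sub>2 \<rho>\<^sub>3 \<rho>\<^sub>4 :: 'l and c :: 'k
  assumes radical_eq: "jacobson_radical = {a * x + b * y | a b. True}"
    and indep_xy: "lin_indep_mod scale (ideal_times (*) jacobson_radical jacobson_radical) x y"
    and minimal_\<psi>: "minimal_relation x y (\<psi>\<^sub>1, \<psi>\<^sub>2)"
    and \<psi>_radical: "\<psi>\<^sub>1 \<in> jacobson_radical" "\<psi>\<^sub>2 \<in> jacobson_radical"
    and indep_\<psi>: "lin_indep_mod scale (ideal_times (*) jacobson_radical jacobson_radical) \<psi>\<^sub>1 \<psi>\<^sub>2"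
    and relation_\<sigma>: "\<sigma>\<^sub>1 * x + \<sigma>\<^sub>2 * y = 0" and relation_\<theta>: "\<theta>\<^sub>1 * x + \<theta>\<^sub>2 * y = 0"
    and indep_\<sigma>\<theta>: "lin_indep_mod (act2 scale) (range (\<lambda>a. act2 (*) a (\<psi>\<^sub>1, \<psi>\<^sub>2))) (\<sigma>\<^sub>1, \<sigma>\<^sub>2) (\<theta>\<^sub>1, \<theta>\<^sub>2)"
    and x\<sigma>: "x * \<sigma>\<^sub>1 + \<rho>\<^sub>1 * \<psi>\<^sub>1 = 0" "x * \<sigma>\<^sub>2 + \<rho>\<^sub>1 * \<psi>\<^sub>2 = 0"
    and y\<sigma>: "y * \<sigma>\<^sub>1 + \<rho>\<^sub>2 * \<psi>\<^sub>1 = 0" "y * \<sigma>\<^sub>2 + \<rho>\<^sub>2 * \<psi>\<^sub>2 = 0"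
    and x\<theta>: "x * \<theta>\<^sub>1 + \<rho>\<^sub>3 * \<psi>\<^sub>1 = 0" "x * \<theta>\<^sub>2 + \<rho>\<^sub>3 * \<psi>\<^sub>2 = 0"
    and y\<theta>: "y * \<theta>\<^sub>1 + \<rho>\<^sub>4 * \<psi>\<^sub>1 = 0" "y * \<theta>\<^sub>2 + \<rho>\<^sub>4 * \<psi>\<^sub>2 = 0"
    and \<sigma>\<rho>: "\<sigma>\<^sub>1 * \<rho>\<^sub>1 + \<sigma>\<^sub>2 * \<rho>\<^sub>2 = 0"
    and \<psi>\<rho>: "\<psi>\<^sub>1 * \<rho>\<^sub>1 + \<psi>\<^sub>2 * \<rho>\<^sub>2 = 0" "\<psi>\<^sub>1 * \<rho>\<^sub>3 + \<psi>\<^sub>2 * \<rho>\<^sub>4 = 0"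
    and \<theta>\<rho>': "\<theta>\<^sub>1 * \<rho>\<^sub>3 + \<theta>\<^sub>2 * \<rho>\<^sub>4 = 0"
    and \<theta>\<rho>: "\<theta>\<^sub>1 * \<rho>\<^sub>1 + \<theta>\<^sub>2 * \<rho>\<^sub>2 = \<omega>"
    and c_nz: "c \<noteq> 0"
    and \<sigma>\<rho>': "\<omega> + scale c (\<sigma>\<^sub>1 * \<rho>\<^sub>3 + \<sigma>\<^sub>2 * \<rho>\<^sub>4) = 0"
begin

abbreviation "J2 \<equiv> ideal_times (*) J J"

lemma relation_\<psi>: "\<psi>\<^sub>1 * x + \<psi>\<^sub>2 * y = 0"
  using minimal_\<psi> by (simp add: minimal_relation_def Omega2_def)

lemma xy_radical: "x \<in> J" "y \<in> J"
proof -
  have "1 * x + 0 * y \<in> J" "0 * x + 1 * y \<in> J" unfolding radical_eq by blast+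
  then show "x \<in> J" "y \<in> J" by simp_all
qed

lemma radical_mod_square: "a * x + b * y - (scale (aug a) x + scale (aug b) y) \<in> J2"
proof -
  have "a * x + b * y - (scale (aug a) x + scale (aug b) y)
      = (a - scale (aug a) 1) * x + (b - scale (aug b) 1) * y"
    using scale_eq_mult[of "aug a" x] scale_eq_mult[of "aug b" y] by (simp add: left_diff_distrib)
  also have "\<dots> \<in> J2"
    by (intro subspace_add[OF radical_square_subspace] radical_square_product aug_decomp xy_radical)
  finally show ?thesis .
qed

text \<open>Modulo the square of J only the residues of the coefficients survive, and there
  \<open>x\<close> and \<open>y\<close> are independent.\<close>

lemma relation_radical:
  assumes "p * x + q * y = 0" shows "p \<in> J" "q \<in> J"
proof -
  have "- (scale (aug p) x + scale (aug q) y) \<in> J2"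
    using radical_mod_square[of p q] assms by simp
  from subspace_neg[OF radical_square_subspace this]
  have "scale (aug p) x + scale (aug q) y \<in> J2" by (simp only: minus_minus)
  then have "aug p = 0 \<and> aug q = 0" using indep_xy unfolding lin_indep_mod_def by blast
  then show "p \<in> J" "q \<in> J" by (simp_all add: radical_iff)
qed

lemmas \<sigma>_radical = relation_radical[OF relation_\<sigma>] and \<theta>_radical = relation_radical[OF relation_\<theta>]

lemma radical_eq_span_\<psi>:
  assumes "j \<in> J" shows "\<exists>\<alpha> \<beta>. j - (scale \<alpha> \<psi>\<^sub>1 + scale \<beta> \<psi>\<^sub>2) \<in> J2"
proof -
  have ex: "\<exists>\<alpha> \<beta>. i - (scale \<alpha> x + scale \<beta> y) \<in> J2" if i: "i \<in> J" for i
  proof -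
    obtain a b where "i = a * x + b * y" using i radical_eq by blast
    then show ?thesis using radical_mod_square by blast
  qed
  obtain \<alpha>1 \<beta>1 where 1: "\<psi>\<^sub>1 - (scale \<alpha>1 x + scale \<beta>1 y) \<in> J2" using ex \<psi>_radical by blast
  obtain \<alpha>2 \<beta>2 where 2: "\<psi>\<^sub>2 - (scale \<alpha>2 x + scale \<beta>2 y) \<in> J2" using ex \<psi>_radical by blast
  obtain \<alpha> \<beta> where 3: "j - (scale \<alpha> x + scale \<beta> y) \<in> J2" using ex assms by blast
  define \<delta> where "\<delta> = \<alpha>1 * \<beta>2 - \<alpha>2 * \<beta>1"
  have comb: "scale r \<psi>\<^sub>1 + scale s \<psi>\<^sub>2 - (scale (r * \<alpha>1 + s * \<alpha>2) x + scale (r * \<beta>1 + s * \<beta>2) y) \<in> J2" for r s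
  proof -
    have "scale r (\<psi>\<^sub>1 - (scale \<alpha>1 x + scale \<beta>1 y)) + scale s (\<psi>\<^sub>2 - (scale \<alpha>2 x + scale \<beta>2 y)) \<in> J2"
      by (intro subspace_add[OF radical_square_subspace] subspace_scale[OF radical_square_subspace] 1 2)
    then show ?thesis
      by (simp add: scale_right_diff_distrib scale_right_distrib scale_left_distrib algebra_simps)
  qed
  have indep: "r = 0 \<and> s = 0" if "r * \<alpha>1 + s * \<alpha>2 = 0" "r * \<beta>1 + s * \<beta>2 = 0" for r s
    using comb[of r s] that indep_\<psi> by (simp add: lin_indep_mod_def)
  \<comment> \<open>If the determinant vanished, both rows of the adjugate matrix would give
    vanishing combinations of the coordinate vectors. Independence would then kill all coordinates,
    a contradiction.\<close>
  have "\<delta> \<noteq> 0"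
  proof
    assume "\<delta> = 0"
    then have "\<beta>2 = 0 \<and> - \<beta>1 = 0" "\<alpha>2 = 0 \<and> - \<alpha>1 = 0"
      by (intro indep; simp add: \<delta>_def algebra_simps)+
    then show False using indep[of 1 0] by simp
  qed
  \<comment> \<open>Cramer's rule for expressing \<open>j\<close> through
    \<open>\<psi>\<^sub>1\<close> and \<open>\<psi>\<^sub>2\<close> modulo the square of J.\<close>
  define r s where "r = (\<alpha> * \<beta>2 - \<beta> * \<alpha>2) / \<delta>" and "s = (\<beta> * \<alpha>1 - \<alpha> * \<beta>1) / \<delta>"
  have "r * \<alpha>1 + s * \<alpha>2 = \<alpha> * \<delta> / \<delta>" "r * \<beta>1 + s * \<beta>2 = \<beta> * \<delta> / \<delta>"
    unfolding r_def s_def times_divide_eq_left add_divide_distrib[symmetric]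
    by (simp_all only: \<delta>_def) (simp_all add: algebra_simps)
  then have "r * \<alpha>1 + s * \<alpha>2 = \<alpha>" "r * \<beta>1 + s * \<beta>2 = \<beta>" using \<open>\<delta> \<noteq> 0\<close> by simp_all
  from subspace_diff[OF radical_square_subspace 3 comb[of r s, unfolded this]]
  have "j - (scale r \<psi>\<^sub>1 + scale s \<psi>\<^sub>2) \<in> J2" by simp
  then show ?thesis by blast
qed

lemma annihilator_\<psi>:
  assumes "b * \<psi>\<^sub>1 = 0" "b * \<psi>\<^sub>2 = 0" shows "b = scale (frob b) \<omega>"
  by (rule right_annihilator_radical, rule radical_generated_right[OF radical_eq_span_\<psi> assms])

text \<open>J\<sigma> and J\<theta> lie in \<Lambda>\<psi>, because J is generated by
  \<open>x\<close> and \<open>y\<close> as a left ideal and (3) handles these two. Hence \<sigma>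
  and \<theta> contribute only scalars modulo \<Lambda>\<psi>.\<close>

lemma radical_combination_\<psi>:
  assumes "j \<in> J" "i \<in> J"
  shows "\<exists>r. j * \<sigma>\<^sub>1 + i * \<theta>\<^sub>1 = r * \<psi>\<^sub>1 \<and> j * \<sigma>\<^sub>2 + i * \<theta>\<^sub>2 = r * \<psi>\<^sub>2"
proof -
  obtain p q p' q' where j: "j = p * x + q * y" and i: "i = p' * x + q' * y"
    using assms radical_eq by blast
  have eqs: "x * \<sigma>\<^sub>1 = - (\<rho>\<^sub>1 * \<psi>\<^sub>1)" "y * \<sigma>\<^sub>1 = - (\<rho>\<^sub>2 * \<psi>\<^sub>1)" "x * \<theta>\<^sub>1 = - (\<rho>\<^sub>3 * \<psi>\<^sub>1)" "y * \<theta>\<^sub>1 = - (\<rho>\<^sub>4 * \<psi>\<^sub>1)"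
    "x * \<sigma>\<^sub>2 = - (\<rho>\<^sub>1 * \<psi>\<^sub>2)" "y * \<sigma>\<^sub>2 = - (\<rho>\<^sub>2 * \<psi>\<^sub>2)" "x * \<theta>\<^sub>2 = - (\<rho>\<^sub>3 * \<psi>\<^sub>2)" "y * \<theta>\<^sub>2 = - (\<rho>\<^sub>4 * \<psi>\<^sub>2)"
    using x\<sigma> y\<sigma> x\<theta> y\<theta> by (simp_all add: eq_neg_iff_add_eq_0)
  show ?thesis
    by (intro exI[of _ "- (p * \<rho>\<^sub>1 + q * \<rho>\<^sub>2 + p' * \<rho>\<^sub>3 + q' * \<rho>\<^sub>4)"])
      (simp add: i j distrib_right left_diff_distrib mult.assoc eqs)
qed

text \<open>Replacing \<open>a\<close> and \<open>b\<close> by their residues changes the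
  combination by an element of \<Lambda>\<psi>, so independence of \<sigma> and \<theta> modulo
  \<Lambda>\<psi> applies to the residues.\<close>

lemma combination_radical:
  assumes "a * \<sigma>\<^sub>1 + b * \<theta>\<^sub>1 + l * \<psi>\<^sub>1 = 0" "a * \<sigma>\<^sub>2 + b * \<theta>\<^sub>2 + l * \<psi>\<^sub>2 = 0"
  shows "a \<in> J" "b \<in> J"
proof -
  let ?j = "a - scale (aug a) 1" and ?i = "b - scale (aug b) 1"
  obtain r where r: "?j * \<sigma>\<^sub>1 + ?i * \<theta>\<^sub>1 = r * \<psi>\<^sub>1" "?j * \<sigma>\<^sub>2 + ?i * \<theta>\<^sub>2 = r * \<psi>\<^sub>2"
    using radical_combination_\<psi>[OF aug_decomp aug_decomp] by blast
  have "scale (aug a) \<sigma> + scale (aug b) \<theta> = (- l - r) * \<psi>"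
    if e: "?j * \<sigma> + ?i * \<theta> = r * \<psi>" and "a * \<sigma> + b * \<theta> + l * \<psi> = 0" for \<sigma> \<theta> \<psi>
  proof -
    have "scale (aug a) \<sigma> + scale (aug b) \<theta> = a * \<sigma> + b * \<theta> - (?j * \<sigma> + ?i * \<theta>)"
      using scale_eq_mult[of "aug a" \<sigma>] scale_eq_mult[of "aug b" \<theta>] by (simp add: left_diff_distrib)
    also have "a * \<sigma> + b * \<theta> = - (l * \<psi>)" using that(2) by (simp add: eq_neg_iff_add_eq_0)
    finally show ?thesis unfolding e by (simp add: left_diff_distrib)
  qed
  from this[OF r(1) assms(1)] this[OF r(2) assms(2)]
  have "act2 scale (aug a) (\<sigma>\<^sub>1, \<sigma>\<^sub>2) + act2 scale (aug b) (\<theta>\<^sub>1, \<theta>\<^sub>2) = act2 (*) (- l - r) (\<psi>\<^sub>1, \<psi>\<^sub>2)"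
    by (simp add: act2_def)
  then have "aug a = 0 \<and> aug b = 0" using indep_\<sigma>\<theta> unfolding lin_indep_mod_def by blast
  then show "a \<in> J" "b \<in> J" by (simp_all add: radical_iff)
qed

text \<open>Were \<open>r\<close> outside J, its residue could be divided out, and the equation
  would express \<psi> through radical multiples of the relations \<open>(p, q)\<close> and \<psi>,
  against minimality of \<psi>.\<close>

lemma \<rho>_radical_aux:
  assumes "z * p + r * \<psi>\<^sub>1 = 0" "z * q + r * \<psi>\<^sub>2 = 0" and pq: "p * x + q * y = 0" and z: "z \<in> J"
  shows "r \<in> J"
proof (rule ccontr)
  assume "r \<notin> J"
  then have nz: "aug r \<noteq> 0" by (simp add: radical_iff)
  let ?s = "- inverse (aug r)"
  let ?j = "r - scale (aug r) 1"
  have *: "\<psi> = scale ?s z * p' + scale ?s ?j * \<psi>" if "z * p' + r * \<psi> = 0" for p' \<psi>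
  proof -
    have "scale ?s z * p' + scale ?s ?j * \<psi> = scale ?s (z * p' + ?j * \<psi>)"
      by (simp add: scale_right_distrib flip: scale_mult_left del: scale_minus_left)
    also have "z * p' + ?j * \<psi> = - scale (aug r) \<psi>"
      using that scale_eq_mult[of "aug r" \<psi>] by (simp add: left_diff_distrib)
    also have "scale ?s \<dots> = \<psi>" using nz by simp
    finally show ?thesis ..
  qed
  define a where "a = (\<lambda>i :: nat. if i = 0 then scale ?s z else scale ?s ?j)"
  define u where "u = (\<lambda>i :: nat. if i = 0 then (p, q) else (\<psi>\<^sub>1, \<psi>\<^sub>2))"
  have "(\<psi>\<^sub>1, \<psi>\<^sub>2) = (\<Sum>i<2. act2 (*) (a i) (u i))"
    using *[OF assms(1)] *[OF assms(2)] by (simp add: numeral_2_eq_2 a_def u_def act2_def)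
  moreover have "\<forall>i<2. a i \<in> J \<and> u i \<in> Omega2 x y"
    using z aug_decomp[of r] pq relation_\<psi> by (simp add: a_def u_def Omega2_def radical_iff aug_scale aug_minus)
  ultimately have "(\<psi>\<^sub>1, \<psi>\<^sub>2) \<in> ideal_times (act2 (*)) J (Omega2 x y)"
    unfolding ideal_times_def mem_Collect_eq by blast
  then show False using minimal_\<psi> by (simp add: minimal_relation_def)
qed

lemma \<rho>_radical: "\<rho>\<^sub>1 \<in> J" "\<rho>\<^sub>2 \<in> J" "\<rho>\<^sub>3 \<in> J" "\<rho>\<^sub>4 \<in> J"
  using \<rho>_radical_aux[OF x\<sigma> relation_\<sigma>] \<rho>_radical_aux[OF y\<sigma> relation_\<sigma>]
    \<rho>_radical_aux[OF x\<theta> relation_\<theta>] \<rho>_radical_aux[OF y\<theta> relation_\<theta>] xy_radical by blast+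

text \<open>
  \<open>\<Lambda>\<psi> + k\<sigma> + k\<theta>\<close> is all of \<open>\<Omega>\<^sup>2(k)\<close>: with a linear section \<open>g\<close> of \<open>(a, b) \<mapsto> a x + b y\<close> over \<open>J\<close>, the map
  \<open>(l, m) \<mapsto> l \<psi> + frob l \<sigma> + aug m \<theta> + g (m - aug m)\<close> on \<open>\<Lambda>\<^sup>2\<close> is injective, hence surjective.
\<close>

lemma relation_expand:
  assumes "p * x + q * y = 0"
  shows "\<exists>\<alpha> \<beta> l. p = scale \<alpha> \<sigma>\<^sub>1 + scale \<beta> \<theta>\<^sub>1 + l * \<psi>\<^sub>1 \<and> q = scale \<alpha> \<sigma>\<^sub>2 + scale \<beta> \<theta>\<^sub>2 + l * \<psi>\<^sub>2"
proof -
  let ?s2 = "act2 scale :: 'k \<Rightarrow> 'l \<times> 'l \<Rightarrow> 'l \<times> 'l"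
  interpret P: vector_space ?s2
    by unfold_locales (auto simp: act2_def scale_right_distrib scale_left_distrib)
  obtain S where S: "finite S" "span S = UNIV" using finite_dim by blast
  define T where "T = (\<lambda>t. (t, 0)) ` S \<union> (\<lambda>t. (0, t)) ` S"
  have "(a, b) \<in> P.span T" for a b
  proof -
    have "a \<in> span S" "b \<in> span S" using S by auto
    have "(a, 0) \<in> P.span T"
      using \<open>a \<in> span S\<close>
    proof (induction a rule: span_induct_alt)
      case base
      show ?case using P.span_zero[of T] by (simp add: zero_prod_def)
    next
      case (step c' u v)
      then have "?s2 c' (u, 0) \<in> P.span T" by (intro P.span_scale P.span_base) (auto simp: T_def)
      moreover have "?s2 c' (u, 0) + (v, 0) = (scale c' u + v, 0)" by (simp add: act2_def)
      ultimately show ?case using P.span_add[OF _ step.IH] by metis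
    qed
    moreover have "(0, b) \<in> P.span T"
      using \<open>b \<in> span S\<close>
    proof (induction b rule: span_induct_alt)
      case base
      show ?case using P.span_zero[of T] by (simp add: zero_prod_def)
    next
      case (step c' u v)
      then have "?s2 c' (0, u) \<in> P.span T" by (intro P.span_scale P.span_base) (auto simp: T_def)
      moreover have "?s2 c' (0, u) + (0, v) = (0, scale c' u + v)" by (simp add: act2_def)
      ultimately show ?case using P.span_add[OF _ step.IH] by metis
    qed
    ultimately have "(a, 0) + (0, b) \<in> P.span T" by (rule P.span_add)
    then show ?thesis by simp
  qed
  then have T: "P.span T = UNIV" "finite T" using S(1) by (auto simp: T_def)
  obtain B where B: "B \<subseteq> UNIV" "P.independent B" "UNIV \<subseteq> P.span B" using P.maximal_independent_subset[of UNIV] .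
  interpret P: finite_dimensional_vector_space ?s2 B
    by unfold_locales (use B P.independent_span_bound[OF T(2) B(2)] T(1) in auto)
  interpret PP: finite_dimensional_vector_space_pair ?s2 B ?s2 B ..
  interpret PL: vector_space_pair ?s2 scale ..
  define f where "f = (\<lambda>(a, b). a * x + b * y)"
  have f_add: "f (u + v) = f u + f v" for u v
    by (cases u, cases v) (simp add: f_def distrib_right)
  have f_scale: "f (?s2 r u) = scale r (f u)" for r u
    by (cases u) (simp add: f_def act2_def scale_right_distrib scale_mult_left)
  have "Vector_Spaces.linear ?s2 scale f"
    by unfold_locales (simp_all only: f_add f_scale)
  then obtain g where g: "Vector_Spaces.linear scale ?s2 g" "\<And>v. v \<in> f ` UNIV \<Longrightarrow> f (g v) = v"
    using PL.linear_exists_right_inverse_on[OF _ P.subspace_UNIV] by blast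
  interpret g: Vector_Spaces.linear scale ?s2 g by fact
  have fJ: "f (g j) = j" if j: "j \<in> J" for j
  proof -
    obtain a b where "j = a * x + b * y" using j radical_eq by blast
    then have "j = f (a, b)" by (simp add: f_def)
    then show ?thesis by (intro g(2)) (rule image_eqI[OF _ UNIV_I])
  qed
  let ?m = "\<lambda>m. m - scale (aug m) 1"
  \<comment> \<open>The two scalar terms make up for two kernels of dimension one: \<open>l\<close>
    times \<psi> vanishes on the line of \<omega>, which \<open>frob\<close> detects, and
    \<open>m - aug m\<close> vanishes on k, which \<open>aug\<close> detects.\<close>
  define H where "H = (\<lambda>(l, m). act2 (*) l (\<psi>\<^sub>1, \<psi>\<^sub>2) + ?s2 (frob l) (\<sigma>\<^sub>1, \<sigma>\<^sub>2) + ?s2 (aug m) (\<theta>\<^sub>1, \<theta>\<^sub>2) + g (?m m))"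
  have fH: "f (H (l, m)) = ?m m" for l m
  proof -
    have rel: "f (\<psi>\<^sub>1, \<psi>\<^sub>2) = 0" "f (\<sigma>\<^sub>1, \<sigma>\<^sub>2) = 0" "f (\<theta>\<^sub>1, \<theta>\<^sub>2) = 0"
      by (simp_all add: f_def relation_\<psi> relation_\<sigma> relation_\<theta>)
    have "f (act2 (*) l (\<psi>\<^sub>1, \<psi>\<^sub>2)) = l * f (\<psi>\<^sub>1, \<psi>\<^sub>2)"
      by (simp add: f_def act2_def distrib_left mult.assoc)
    then have "f (H (l, m)) = f (g (?m m))"
      by (simp only: H_def prod.case f_add f_scale rel) simp
    also have "\<dots> = ?m m" by (rule fJ[OF aug_decomp])
    finally show ?thesis .
  qed
  have linH: "Vector_Spaces.linear ?s2 ?s2 H"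
  proof unfold_locales
    have m_add: "?m (u + v) = ?m u + ?m v" for u v by (simp add: aug_add scale_left_distrib)
    have m_scale: "?m (scale r u) = scale r (?m u)" for r u
      by (simp add: aug_scale scale_right_diff_distrib)
    show "H (u + v) = H u + H v" for u v
    proof (cases u, cases v)
      fix l m l' m' assume uv: "u = (l, m)" "v = (l', m')"
      have "H (u + v) = act2 (*) (l + l') (\<psi>\<^sub>1, \<psi>\<^sub>2) + ?s2 (frob (l + l')) (\<sigma>\<^sub>1, \<sigma>\<^sub>2) + ?s2 (aug (m + m')) (\<theta>\<^sub>1, \<theta>\<^sub>2) + g (?m (m + m'))"
        by (simp add: uv H_def)
      also have "\<dots> = H u + H v"
        unfolding m_add g.add by (simp add: uv H_def frob aug_add P.scale_left_distrib) (simp add: act2_def distrib_right)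
      finally show ?thesis .
    qed
    show "H (?s2 r u) = ?s2 r (H u)" for r u
    proof (cases u)
      fix l m assume u: "u = (l, m)"
      have "H (?s2 r u) = act2 (*) (scale r l) (\<psi>\<^sub>1, \<psi>\<^sub>2) + ?s2 (frob (scale r l)) (\<sigma>\<^sub>1, \<sigma>\<^sub>2) + ?s2 (aug (scale r m)) (\<theta>\<^sub>1, \<theta>\<^sub>2) + g (?m (scale r m))"
        by (simp add: u H_def act2_def)
      also have "\<dots> = ?s2 r (H u)"
        unfolding m_scale g.scale by (simp add: u H_def frob aug_scale P.scale_right_distrib) (simp add: act2_def scale_mult_left)
      finally show ?thesis .
    qed
  qed
  interpret H: Vector_Spaces.linear ?s2 ?s2 H by fact
  have "inj H"
  proof (subst H.inj_iff_eq_0, intro allI impI)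
    fix u assume H0: "H u = 0"
    obtain l m where u: "u = (l, m)" by (cases u)
    have m: "m = scale (aug m) 1" using fH[of l m] H0 by (simp add: u f_def zero_prod_def)
    then have "g (?m m) = 0" using g.zero by simp
    then have eq: "scale (frob l) \<sigma>\<^sub>1 + scale (aug m) \<theta>\<^sub>1 + l * \<psi>\<^sub>1 = 0" "scale (frob l) \<sigma>\<^sub>2 + scale (aug m) \<theta>\<^sub>2 + l * \<psi>\<^sub>2 = 0"
      using H0 by (simp_all add: u H_def act2_def zero_prod_def add.commute add.left_commute)
    have "scale (frob l) 1 * \<sigma>\<^sub>1 + scale (aug m) 1 * \<theta>\<^sub>1 + l * \<psi>\<^sub>1 = 0" "scale (frob l) 1 * \<sigma>\<^sub>2 + scale (aug m) 1 * \<theta>\<^sub>2 + l * \<psi>\<^sub>2 = 0"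
      using eq by (simp_all flip: scale_eq_mult)
    from combination_radical[OF this] have z: "frob l = 0" "aug m = 0"
      by (simp_all add: radical_iff aug_scale_one)
    then have "l = scale (frob l) \<omega>" using eq by (intro annihilator_\<psi>) simp_all
    then show "u = 0" using z m by (simp add: u zero_prod_def)
  qed
  then have "surj H" by (rule PP.linear_injective_imp_surjective[OF linH _ refl])
  then obtain u where u: "(p, q) = H u" by (rule surjE)
  obtain l m where lm: "u = (l, m)" by (cases u)
  \<comment> \<open>Applying \<open>f\<close> to \<open>H (l, m)\<close> leaves only the summand
    from the section; for a relation it is 0, so the remaining three terms give the
    expansion.\<close>
  have "?m m = 0" using fH[of l m] assms by (simp add: u[symmetric] lm[symmetric] f_def)
  then have "g (?m m) = 0" using g.zero by simp
  then show ?thesis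
    using u by (intro exI[of _ "frob l"] exI[of _ "aug m"] exI[of _ l])
      (simp add: lm H_def act2_def add.commute add.left_commute)
qed

end

section \<open>The minimal resolution\<close>

lemma even_odd_cases:
  obtains j where "(i :: nat) = 2 * j" | j where "i = Suc (2 * j)"
  by (metis oddE evenE Suc_eq_plus1)

lemma std_free_zero: "v \<in> std_free r \<Longrightarrow> r \<le> i \<Longrightarrow> v i = 0"
  by (simp add: std_free_def)

context koszul_data
begin

text \<open>
  The minimal resolution \<open>F\<close> of \<open>k\<close> has \<open>F\<^sub>n = \<Lambda>\<^sup>n\<^sup>+\<^sup>1\<close>. In even degree, the basis vector \<open>2 j\<close> covers the
  generator of \<open>\<Omega>\<^sup>n(k) \<subseteq> (\<Omega>\<^sup>2(k))\<^sup>n\<^sup>/\<^sup>2\<close> with components \<open>\<theta>\<close> at \<open>j - 1\<close> and \<open>c\<^sup>j \<sigma>\<close> at \<open>j\<close> (where defined), and \<open>2 j + 1\<close> covers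
  \<open>\<psi>\<close> at \<open>j\<close>. In odd degree, \<open>2 j\<close> and \<open>2 j + 1\<close> cover the relations obtained by multiplying the generator \<open>2 j\<close> by \<open>x\<close> and by \<open>y\<close>.
\<close>

definition dif :: "nat \<Rightarrow> (nat \<Rightarrow> 'l) \<Rightarrow> nat \<Rightarrow> 'l" where
  "dif n v i =
    (if n < i then 0
     else if even n then
       (if even i then v i * x + v (Suc i) * y
        else v (Suc i) * \<rho>\<^sub>3 + v (Suc (Suc i)) * \<rho>\<^sub>4 + scale (c ^ (i div 2)) (v (i - 1) * \<rho>\<^sub>1 + v i * \<rho>\<^sub>2))
     else
       (if even i then v (Suc (Suc i)) * \<theta>\<^sub>1 + scale (c ^ (i div 2)) (v i * \<sigma>\<^sub>1) + v (Suc i) * \<psi>\<^sub>1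
        else v (Suc i) * \<theta>\<^sub>2 + scale (c ^ (i div 2)) (v (i - 1) * \<sigma>\<^sub>2) + v i * \<psi>\<^sub>2))"

lemma dif_gt: "n < i \<Longrightarrow> dif n v i = 0"
  by (simp add: dif_def)

lemma dif_even:
  "j \<le> m \<Longrightarrow> dif (2 * m) v (2 * j) = v (2 * j) * x + v (Suc (2 * j)) * y"
  "j < m \<Longrightarrow> dif (2 * m) v (Suc (2 * j)) = v (Suc (Suc (2 * j))) * \<rho>\<^sub>3 + v (Suc (Suc (Suc (2 * j)))) * \<rho>\<^sub>4
     + scale (c ^ j) (v (2 * j) * \<rho>\<^sub>1 + v (Suc (2 * j)) * \<rho>\<^sub>2)"
  by (simp_all add: dif_def)

lemma dif_odd:
  "j \<le> m \<Longrightarrow> dif (Suc (2 * m)) v (2 * j) = v (Suc (Suc (2 * j))) * \<theta>\<^sub>1 + scale (c ^ j) (v (2 * j) * \<sigma>\<^sub>1) + v (Suc (2 * j)) * \<psi>\<^sub>1"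
  "j \<le> m \<Longrightarrow> dif (Suc (2 * m)) v (Suc (2 * j)) = v (Suc (Suc (2 * j))) * \<theta>\<^sub>2 + scale (c ^ j) (v (2 * j) * \<sigma>\<^sub>2) + v (Suc (2 * j)) * \<psi>\<^sub>2"
  by (simp_all add: dif_def)

lemma dif_add: "dif n (u + v) = dif n u + dif n v"
  by (simp add: fun_eq_iff dif_def distrib_right scale_right_distrib)

lemma dif_hom: "left_hom std_act (std_free r) std_act (std_free (Suc n)) (dif n)"
  unfolding left_hom_def
proof (intro conjI ballI allI)
  show "dif n v \<in> std_free (Suc n)" for v by (simp add: std_free_def dif_gt)
  show "dif n (u + v) = dif n u + dif n v" for u v by (rule dif_add)
  show "dif n (std_act a v) = std_act a (dif n v)" for a v
    by (simp add: fun_eq_iff dif_def std_act_def distrib_left mult.assoc scale_mult_right scale_right_distrib)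
qed

text \<open>The differential is described on pairs of indices \<open>2 * j\<close>,
  \<open>Suc (2 * j)\<close>. The coordinates of \<open>F\<close> in degree \<open>2 * m\<close> run
  up to \<open>2 * m\<close>, so the last pair lacks its odd member; in odd degree all pairs are
  complete.\<close>

lemma ext_even:
  assumes "\<And>j. j \<le> m \<Longrightarrow> f (2 * j) = g (2 * j)" "\<And>j. j < m \<Longrightarrow> f (Suc (2 * j)) = g (Suc (2 * j))"
    "\<And>i. 2 * m < i \<Longrightarrow> f i = g i"
  shows "f = g"
proof
  fix i show "f i = g i"
  proof (cases "2 * m < i")
    case False
    then show ?thesis using assms(1,2) by (cases i rule: even_odd_cases) auto
  qed (use assms(3) in auto)
qed

lemma ext_odd:
  assumes "\<And>j. j \<le> m \<Longrightarrow> f (2 * j) = g (2 * j)" "\<And>j. j \<le> m \<Longrightarrow> f (Suc (2 * j)) = g (Suc (2 * j))"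
    "\<And>i. Suc (2 * m) < i \<Longrightarrow> f i = g i"
  shows "f = g"
proof
  fix i show "f i = g i"
  proof (cases "Suc (2 * m) < i")
    case False
    then show ?thesis using assms(1,2) by (cases i rule: even_odd_cases) auto
  qed (use assms(3) in auto)
qed

lemma \<sigma>\<rho>'_eq: "scale c (\<sigma>\<^sub>1 * \<rho>\<^sub>3 + \<sigma>\<^sub>2 * \<rho>\<^sub>4) = - \<omega>"
  using \<sigma>\<rho>' by (metis minus_unique)

text \<open>Pairing a combination of \<theta>, \<sigma> and \<psi> with the columns
  \<open>\<rho>\<^sub>1, \<rho>\<^sub>2\<close> and \<open>\<rho>\<^sub>3, \<rho>\<^sub>4\<close>
  leaves only the \<theta>-part and the \<sigma>-part, respectively. The factor \<open>c\<close> in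
  the second equation avoids a division.\<close>

lemma pair_\<rho>:
  fixes s :: 'k
  assumes "p = a * \<theta>\<^sub>1 + scale s (b * \<sigma>\<^sub>1) + l * \<psi>\<^sub>1" "q = a * \<theta>\<^sub>2 + scale s (b * \<sigma>\<^sub>2) + l * \<psi>\<^sub>2"
  shows "p * \<rho>\<^sub>1 + q * \<rho>\<^sub>2 = a * \<omega>" "scale c (p * \<rho>\<^sub>3 + q * \<rho>\<^sub>4) = - scale s (b * \<omega>)"
    "p * x + q * y = 0"
proof -
  have "p * r + q * r' = a * (\<theta>\<^sub>1 * r + \<theta>\<^sub>2 * r') + scale s (b * (\<sigma>\<^sub>1 * r + \<sigma>\<^sub>2 * r')) + l * (\<psi>\<^sub>1 * r + \<psi>\<^sub>2 * r')" for r r'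
    unfolding assms
    by (simp add: distrib_left distrib_right mult.assoc scale_right_distrib flip: scale_mult_left)
  note * = this
  show "p * \<rho>\<^sub>1 + q * \<rho>\<^sub>2 = a * \<omega>" unfolding * by (simp add: \<theta>\<rho> \<sigma>\<rho> \<psi>\<rho>)
  show "p * x + q * y = 0" unfolding * by (simp add: relation_\<theta> relation_\<sigma> relation_\<psi>)
  have "scale c (p * \<rho>\<^sub>3 + q * \<rho>\<^sub>4) = scale s (b * scale c (\<sigma>\<^sub>1 * \<rho>\<^sub>3 + \<sigma>\<^sub>2 * \<rho>\<^sub>4))"
    unfolding * by (simp add: \<theta>\<rho>' \<psi>\<rho> mult.commute flip: scale_mult_right)
  then show "scale c (p * \<rho>\<^sub>3 + q * \<rho>\<^sub>4) = - scale s (b * \<omega>)" by (simp add: \<sigma>\<rho>'_eq)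
qed

lemma dif_dif: "dif n (dif (Suc n) v) = 0"
proof (cases n rule: even_odd_cases)
  case (1 m)
  let ?w = "dif (Suc (2 * m)) v"
  have "dif (2 * m) ?w = 0"
  proof (rule ext_even[of m])
    fix j assume j: "j \<le> m"
    show "dif (2 * m) ?w (2 * j) = 0 (2 * j)"
      unfolding dif_even(1)[OF j] using pair_\<rho>(3)[OF dif_odd[OF j, of v]] by simp
  next
    fix j assume j: "j < m"
    then have j0: "j \<le> m" and j1: "Suc j \<le> m" by auto
    let ?t = "?w (Suc (Suc (2 * j))) * \<rho>\<^sub>3 + ?w (Suc (Suc (Suc (2 * j)))) * \<rho>\<^sub>4"
    have "scale c ?t = - scale (c ^ Suc j) (v (Suc (Suc (2 * j))) * \<omega>)"
      \<comment> \<open>Origin of the powers of \<open>c\<close>: \<sigma> in block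
        \<open>Suc j\<close> carries \<open>c ^ Suc j\<close>, and its pairing gives \<omega>
        divided by \<open>- c\<close>. This cancels the \<omega> from \<theta> in block
        \<open>j\<close>, which the differential scales by \<open>c ^ j\<close>.\<close>
      using pair_\<rho>(2)[OF dif_odd[OF j1, of v]] by simp
    also have "\<dots> = scale c (- scale (c ^ j) (v (Suc (Suc (2 * j))) * \<omega>))" by simp
    finally have "?t = - scale (c ^ j) (v (Suc (Suc (2 * j))) * \<omega>)" by (rule scale_left_imp_eq[OF c_nz])
    then show "dif (2 * m) ?w (Suc (2 * j)) = 0 (Suc (2 * j))"
      unfolding dif_even(2)[OF j] using pair_\<rho>(1)[OF dif_odd[OF j0, of v]] by simp
  qed (simp add: dif_gt)
  then show ?thesis by (simp add: 1)
next
  case (2 m)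
  let ?w = "dif (2 * Suc m) v"
  have *: "(a * x + b * y) * \<theta> + scale s ((a' * x + b' * y) * \<sigma>)
      + (a * \<rho>\<^sub>3 + b * \<rho>\<^sub>4 + scale s (a' * \<rho>\<^sub>1 + b' * \<rho>\<^sub>2)) * \<psi> = 0"
    if "x * \<sigma> + \<rho>\<^sub>1 * \<psi> = 0" "y * \<sigma> + \<rho>\<^sub>2 * \<psi> = 0" "x * \<theta> + \<rho>\<^sub>3 * \<psi> = 0" "y * \<theta> + \<rho>\<^sub>4 * \<psi> = 0"
    for a b a' b' \<theta> \<sigma> \<psi> s
  proof -
    have "(a * x + b * y) * \<theta> + scale s ((a' * x + b' * y) * \<sigma>)
      + (a * \<rho>\<^sub>3 + b * \<rho>\<^sub>4 + scale s (a' * \<rho>\<^sub>1 + b' * \<rho>\<^sub>2)) * \<psi>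
      = a * (x * \<theta> + \<rho>\<^sub>3 * \<psi>) + b * (y * \<theta> + \<rho>\<^sub>4 * \<psi>) +
        scale s (a' * (x * \<sigma> + \<rho>\<^sub>1 * \<psi>) + b' * (y * \<sigma> + \<rho>\<^sub>2 * \<psi>))"
      by (simp add: distrib_left distrib_right mult.assoc scale_right_distrib flip: scale_mult_left)
    then show ?thesis using that by simp
  qed
  have "dif (Suc (2 * m)) ?w = 0"
  proof (rule ext_odd[of m])
    fix j assume j: "j \<le> m"
    then have j': "j \<le> Suc m" "Suc j \<le> Suc m" "j < Suc m" by auto
    have e: "?w (Suc (Suc (2 * j))) = v (Suc (Suc (2 * j))) * x + v (Suc (Suc (Suc (2 * j)))) * y"
      using dif_even(1)[OF j'(2), of v] by simp
    show "dif (Suc (2 * m)) ?w (2 * j) = 0 (2 * j)"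
      unfolding dif_odd[OF j] e dif_even(1)[OF j'(1)] dif_even(2)[OF j'(3)]
      using *[OF x\<sigma>(1) y\<sigma>(1) x\<theta>(1) y\<theta>(1)] by simp
    show "dif (Suc (2 * m)) ?w (Suc (2 * j)) = 0 (Suc (2 * j))"
      unfolding dif_odd[OF j] e dif_even(1)[OF j'(1)] dif_even(2)[OF j'(3)]
      using *[OF x\<sigma>(2) y\<sigma>(2) x\<theta>(2) y\<theta>(2)] by simp
  qed (simp add: dif_gt)
  then show ?thesis by (simp add: 2)
qed

text \<open>Minimality: all matrix entries of the differential lie in J. Coordinate functions
  followed by \<open>aug\<close> are therefore cocycles.\<close>

lemma aug_dif: "aug (dif n v i) = 0"
  using xy_radical \<rho>_radical \<sigma>_radical \<theta>_radical \<psi>_radical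
  by (simp add: dif_def radical_iff aug_add aug_mult aug_scale)

text \<open>The even entries of a cycle lie in J, so the \<open>x\<close>, \<open>y\<close> part of
  the differential clears them. The odd entries then annihilate \<psi>, hence are multiples of
  \<omega>, and these are boundaries of multiples of \<theta>.\<close>

lemma dif_exact_odd:
  assumes v: "v \<in> std_free (Suc (2 * Suc m))" and dv: "dif (Suc (2 * m)) v = 0"
  shows "v \<in> dif (2 * Suc m) ` std_free (Suc (Suc (2 * Suc m)))"
proof -
  have eqs: "v (Suc (Suc (2 * j))) * \<theta>\<^sub>1 + scale (c ^ j) (v (2 * j) * \<sigma>\<^sub>1) + v (Suc (2 * j)) * \<psi>\<^sub>1 = 0"
      "v (Suc (Suc (2 * j))) * \<theta>\<^sub>2 + scale (c ^ j) (v (2 * j) * \<sigma>\<^sub>2) + v (Suc (2 * j)) * \<psi>\<^sub>2 = 0"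
    if "dif (Suc (2 * m)) v = 0" "j \<le> m" for v j
    using fun_cong[OF that(1), of "2 * j"] fun_cong[OF that(1), of "Suc (2 * j)"] dif_odd[OF that(2), of v] by simp_all
  have rad: "scale (c ^ j) (v (2 * j)) \<in> J" "v (Suc (Suc (2 * j))) \<in> J" if "j \<le> m" for j
    using combination_radical[of "scale (c ^ j) (v (2 * j))" "v (Suc (Suc (2 * j)))" "v (Suc (2 * j))"]
      eqs[OF dv that] by (simp_all add: scale_mult_left add.commute)
  have "\<exists>p q. v (2 * j) = p * x + q * y" for j
  proof -
    have "v (2 * j) \<in> J"
    \<comment> \<open>Up to \<open>m\<close> the even entry occurs as the coefficient of \<sigma> in
      its own block; the last one, \<open>j = Suc m\<close>, occurs only as the coefficient of
      \<theta> in block \<open>m\<close>.\<close>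
    proof (cases "j \<le> m")
      case True
      then show ?thesis using rad(1)[OF True] c_nz by (simp add: radical_iff aug_scale)
    next
      case False
      then obtain i where i: "j = Suc i" "m \<le> i" by (cases j) auto
      show ?thesis
      proof (cases "i = m")
        case True
        then show ?thesis using rad(2)[of m] i by simp
      next
        case False
        then show ?thesis using std_free_zero[OF v, of "2 * j"] i by (simp add: radical_iff)
      qed
    qed
    then show ?thesis using radical_eq by blast
  qed
  then obtain p q where pq: "\<And>j. v (2 * j) = p j * x + q j * y" by metis
  define w where "w = (\<lambda>i. if 2 * Suc m + 1 < i then 0 else if even i then p (i div 2) else q (i div 2))"
  have w: "w \<in> std_free (Suc (Suc (2 * Suc m)))" by (simp add: w_def std_free_def)
  define v' where "v' = v - dif (2 * Suc m) w"
  have v'_even: "v' (2 * j) = 0" for j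
  proof (cases "j \<le> Suc m")
    case True
    then show ?thesis using pq[of j] dif_even(1)[OF True, of w] by (simp add: v'_def w_def)
  next
    case False
    then show ?thesis using std_free_zero[OF v, of "2 * j"] by (simp add: v'_def dif_gt)
  qed
  have "dif (Suc (2 * m)) (v' + dif (2 * Suc m) w) = 0" using dv by (simp add: v'_def)
  then have dv': "dif (Suc (2 * m)) v' = 0" using dif_dif[of "Suc (2 * m)" w] by (simp add: dif_add)
  have v'_odd: "v' (Suc (2 * j)) = scale (frob (v' (Suc (2 * j)))) \<omega>" if "j \<le> m" for j
    using eqs[OF dv' that] v'_even[of j] v'_even[of "Suc j"] by (intro annihilator_\<psi>) simp_all
  \<comment> \<open>Each pair of \<open>z\<close> is a scalar multiple of \<theta>, which is
    orthogonal to \<open>x, y\<close> and to \<open>\<rho>\<^sub>3, \<rho>\<^sub>4\<close> and gives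
    \<omega> against \<open>\<rho>\<^sub>1, \<rho>\<^sub>2\<close>. Dividing by \<open>c ^ j\<close>
    undoes the scaling in the differential.\<close>
  define z where "z = (\<lambda>i. if 2 * m + 1 < i then 0
    else scale (frob (v' (Suc (2 * (i div 2)))) / c ^ (i div 2)) (if even i then \<theta>\<^sub>1 else \<theta>\<^sub>2))"
  have z: "z \<in> std_free (Suc (Suc (2 * Suc m)))" by (simp add: z_def std_free_def)
  have z_rel: "z (2 * j) * r + z (Suc (2 * j)) * r' =
      (if j \<le> m then scale (frob (v' (Suc (2 * j))) / c ^ j) (\<theta>\<^sub>1 * r + \<theta>\<^sub>2 * r') else 0)" for j r r'
    by (simp add: z_def scale_right_distrib flip: scale_mult_left)
  have "dif (2 * Suc m) z = v'"
  proof (rule ext_even[of "Suc m"])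
    fix j assume j: "j \<le> Suc m"
    show "dif (2 * Suc m) z (2 * j) = v' (2 * j)"
      unfolding dif_even(1)[OF j] z_rel v'_even by (simp add: relation_\<theta>)
  next
    fix j assume j: "j < Suc m"
    have "z (Suc (Suc (2 * j))) * \<rho>\<^sub>3 + z (Suc (Suc (Suc (2 * j)))) * \<rho>\<^sub>4 = 0"
      using z_rel[of "Suc j" \<rho>\<^sub>3 \<rho>\<^sub>4] by (simp add: \<theta>\<rho>')
    then show "dif (2 * Suc m) z (Suc (2 * j)) = v' (Suc (2 * j))"
      unfolding dif_even(2)[OF j] z_rel using v'_odd[of j] j c_nz by (simp add: \<theta>\<rho>)
  next
    fix i assume "2 * Suc m < i"
    then show "dif (2 * Suc m) z i = v' i"
      using std_free_zero[OF v, of i] by (simp add: v'_def dif_gt)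
  qed
  then have "v = dif (2 * Suc m) (w + z)" by (simp add: dif_add v'_def)
  moreover have "w + z \<in> std_free (Suc (Suc (2 * Suc m)))"
    using left_module.add_mem[OF left_module_std w z] .
  ultimately show ?thesis by blast
qed

lemma dif_exact_even:
  assumes v: "v \<in> std_free (Suc (Suc (2 * m)))" and dv: "dif (2 * m) v = 0"
  shows "v \<in> dif (Suc (2 * m)) ` std_free (Suc (Suc (Suc (2 * m))))"
proof -
  have "\<exists>\<alpha> \<beta> l. v (2 * j) = scale \<alpha> \<sigma>\<^sub>1 + scale \<beta> \<theta>\<^sub>1 + l * \<psi>\<^sub>1 \<and> v (Suc (2 * j)) = scale \<alpha> \<sigma>\<^sub>2 + scale \<beta> \<theta>\<^sub>2 + l * \<psi>\<^sub>2"
    if j: "j \<le> m" for j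
    using fun_cong[OF dv, of "2 * j"] dif_even(1)[OF j, of v] by (intro relation_expand) simp
  then obtain \<alpha> \<beta> l where e: "\<And>j. j \<le> m \<Longrightarrow> v (2 * j) = scale (\<alpha> j) \<sigma>\<^sub>1 + scale (\<beta> j) \<theta>\<^sub>1 + l j * \<psi>\<^sub>1"
      "\<And>j. j \<le> m \<Longrightarrow> v (Suc (2 * j)) = scale (\<alpha> j) \<sigma>\<^sub>2 + scale (\<beta> j) \<theta>\<^sub>2 + l j * \<psi>\<^sub>2"
    by metis
  have e': "v (2 * j) = scale (\<beta> j) 1 * \<theta>\<^sub>1 + scale (\<alpha> j) (1 * \<sigma>\<^sub>1) + l j * \<psi>\<^sub>1"
    "v (Suc (2 * j)) = scale (\<beta> j) 1 * \<theta>\<^sub>2 + scale (\<alpha> j) (1 * \<sigma>\<^sub>2) + l j * \<psi>\<^sub>2" if "j \<le> m" for j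
    using e[OF that] by (simp_all add: add.commute flip: scale_eq_mult)
  \<comment> \<open>The odd entries of the cycle condition compare the coefficients of \<omega> from
    neighbouring blocks. They force exactly the ratio between \<theta> in one block and \<sigma> in
    the next that is built into the generators.\<close>
  have \<alpha>: "\<alpha> (Suc j) = c ^ Suc j * \<beta> j" if j: "j < m" for j
  proof -
    have j0: "j \<le> m" and j1: "Suc j \<le> m" using j by auto
    have "v (Suc (Suc (2 * j))) * \<rho>\<^sub>3 + v (Suc (Suc (Suc (2 * j)))) * \<rho>\<^sub>4
      + scale (c ^ j) (v (2 * j) * \<rho>\<^sub>1 + v (Suc (2 * j)) * \<rho>\<^sub>2) = 0"
      using fun_cong[OF dv, of "Suc (2 * j)"] dif_even(2)[OF j, of v] by simp
    then have "scale c (v (Suc (Suc (2 * j))) * \<rho>\<^sub>3 + v (Suc (Suc (Suc (2 * j)))) * \<rho>\<^sub>4)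
      + scale c (scale (c ^ j) (v (2 * j) * \<rho>\<^sub>1 + v (Suc (2 * j)) * \<rho>\<^sub>2)) = 0"
      by (metis scale_right_distrib scale_zero_right)
    moreover have "scale c (v (Suc (Suc (2 * j))) * \<rho>\<^sub>3 + v (Suc (Suc (Suc (2 * j)))) * \<rho>\<^sub>4) = - scale (\<alpha> (Suc j)) \<omega>"
      using pair_\<rho>(2)[OF e'[OF j1]] by simp
    moreover have "v (2 * j) * \<rho>\<^sub>1 + v (Suc (2 * j)) * \<rho>\<^sub>2 = scale (\<beta> j) \<omega>"
      using pair_\<rho>(1)[OF e'[OF j0]] by (simp flip: scale_eq_mult)
    ultimately have "scale (c ^ Suc j * \<beta> j) \<omega> = scale (\<alpha> (Suc j)) \<omega>"
      by (simp add: mult.assoc)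
    then show ?thesis using omega_nz by simp
  qed
  \<comment> \<open>Generator \<open>2 * Suc j\<close> covers \<theta> in block \<open>j\<close>, so
    its coefficient is read off there; its \<sigma> in block \<open>Suc j\<close> then has the right
    coefficient too. Generator 0 has no \<theta> and takes \<open>\<alpha> 0\<close>.\<close>
  define w where "w = (\<lambda>i. if 2 * m + 2 < i then 0 else if even i then
    scale (case i div 2 of 0 \<Rightarrow> \<alpha> 0 | Suc j \<Rightarrow> \<beta> j) 1 else l (i div 2))"
  have w: "w \<in> std_free (Suc (Suc (Suc (2 * m))))" by (simp add: w_def std_free_def)
  have w1: "w (Suc (Suc (2 * j))) = scale (\<beta> j) 1" "scale (c ^ j) (w (2 * j) * p) = scale (\<alpha> j) p"
    "w (Suc (2 * j)) = l j" if j: "j \<le> m" for j p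
  proof -
    show "w (Suc (Suc (2 * j))) = scale (\<beta> j) 1" "w (Suc (2 * j)) = l j" using j by (simp_all add: w_def)
    show "scale (c ^ j) (w (2 * j) * p) = scale (\<alpha> j) p"
      using j \<alpha>[of "j - 1"] by (cases j) (simp_all add: w_def flip: scale_eq_mult)
  qed
  have "dif (Suc (2 * m)) w = v"
  proof (rule ext_odd[of m])
    fix j assume j: "j \<le> m"
    show "dif (Suc (2 * m)) w (2 * j) = v (2 * j)" "dif (Suc (2 * m)) w (Suc (2 * j)) = v (Suc (2 * j))"
      unfolding dif_odd[OF j] w1[OF j] e[OF j] by (simp_all add: add.commute flip: scale_eq_mult)
  next
    fix i assume "Suc (2 * m) < i"
    then show "dif (Suc (2 * m)) w i = v i" using std_free_zero[OF v, of i] by (simp add: dif_gt)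
  qed
  then show ?thesis using w by blast
qed

definition F :: "('l, nat \<Rightarrow> 'l, 'k) resolution" where
  "F = \<lparr>res_mod = \<lambda>n. std_free (Suc n), res_act = \<lambda>n. std_act, res_d = dif, res_aug = \<lambda>v. aug (v 0)\<rparr>"

lemma F_simps [simp]:
  "res_mod F n = std_free (Suc n)" "res_act F n = std_act" "res_d F = dif" "res_aug F = (\<lambda>v. aug (v 0))"
  by (simp_all add: F_def)

lemma F_resolution: "free_resolution (trivial_act scale) UNIV F"
  unfolding free_resolution_def F_simps
proof (intro conjI allI left_module_std has_basis_std dif_hom)
  show "left_hom std_act (std_free (Suc 0)) (trivial_act scale) UNIV (\<lambda>v. aug (v 0))"
    by (simp add: left_hom_def std_act_def trivial_act_def aug_add aug_mult)
  show "(\<lambda>v. aug (v 0)) ` std_free (Suc 0) = UNIV"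
  proof -
    have "t \<in> (\<lambda>v. aug (v 0)) ` std_free (Suc 0)" for t
      by (rule image_eqI[of _ _ "std_act (scale t 1) (unit_vec 0)"])
        (auto simp: std_act_def unit_vec_def std_free_def aug_scale_one)
    then show ?thesis by blast
  qed
  show "{v \<in> std_free (Suc 0). aug (v 0) = 0} = dif 0 ` std_free (Suc (Suc 0))"
  proof (intro equalityI subsetI)
    fix v assume "v \<in> {v \<in> std_free (Suc 0). aug (v 0) = 0}"
    then have v: "v \<in> std_free (Suc 0)" "v 0 \<in> J" by (simp_all add: radical_iff)
    then obtain a b where ab: "v 0 = a * x + b * y" using radical_eq by blast
    define u where "u = (\<lambda>i :: nat. if i = 0 then a else if i = 1 then b else 0)"
    have "v = dif 0 u" using ab std_free_zero[OF v(1)] by (auto simp: fun_eq_iff dif_def u_def)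
    moreover have "u \<in> std_free (Suc (Suc 0))" by (simp add: u_def std_free_def)
    ultimately show "v \<in> dif 0 ` std_free (Suc (Suc 0))" by blast
  qed (auto simp: aug_dif std_free_def dif_gt)
  show "{v \<in> std_free (Suc (Suc n)). dif n v = 0} = dif (Suc n) ` std_free (Suc (Suc (Suc n)))" for n
  proof (intro equalityI subsetI)
    fix v assume "v \<in> {v \<in> std_free (Suc (Suc n)). dif n v = 0}"
    then show "v \<in> dif (Suc n) ` std_free (Suc (Suc (Suc n)))"
      using dif_exact_odd[of v] dif_exact_even[of v] by (cases n rule: even_odd_cases) auto
  qed (auto simp: dif_dif std_free_def dif_gt)
qed

section \<open>Chain maps of degree two on the minimal resolution\<close>

definition shift_\<sigma> :: "nat \<Rightarrow> (nat \<Rightarrow> 'l) \<Rightarrow> nat \<Rightarrow> 'l" where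
  "shift_\<sigma> n v i = (if i \<le> n then v i else 0)"

text \<open>Dropping the first two coordinates renumbers block \<open>Suc j\<close> as block
  \<open>j\<close>, whose \<sigma> carries one factor \<open>c\<close> less. The exponent counts
  blocks from the end, so it grows by one towards the front and absorbs this factor.\<close>

definition shift_\<theta> :: "nat \<Rightarrow> (nat \<Rightarrow> 'l) \<Rightarrow> nat \<Rightarrow> 'l" where
  "shift_\<theta> n v i = (if i \<le> n then scale (c ^ ((n - i) div 2)) (v (Suc (Suc i))) else 0)"

text \<open>The formula for the differential depends on the degree only through its parity and the
  cut-off, and entries up to \<open>n\<close> use only coordinates up to \<open>Suc n\<close>. In
  degree two, coordinate 0 belongs to the generator that covers \<sigma>.\<close>

lemma shift_\<sigma>_lifts: "shift_\<sigma> \<in> lifts F F 2 (\<lambda>v. aug (v 0))"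
  unfolding lifts_def mem_Collect_eq F_simps
proof (intro conjI allI ballI)
  show "left_hom std_act (std_free (Suc (2 + n))) std_act (std_free (Suc n)) (shift_\<sigma> n)" for n
    by (simp add: left_hom_def shift_\<sigma>_def std_act_def std_free_def fun_eq_iff)
  show "aug (shift_\<sigma> 0 v 0) = aug (v 0)" for v by (simp add: shift_\<sigma>_def)
  show "shift_\<sigma> n (dif (2 + n) v) = dif n (shift_\<sigma> (Suc n) v)" for n v
  proof (cases n rule: even_odd_cases)
    case (1 m)
    show ?thesis unfolding 1
      by (rule ext_even[of m]) (simp_all add: shift_\<sigma>_def dif_def)
  next
    case (2 m)
    show ?thesis unfolding 2
      by (rule ext_odd[of m]) (simp_all add: shift_\<sigma>_def dif_def)
  qed
qed

lemma shift_\<theta>_lifts: "shift_\<theta> \<in> lifts F F 2 (\<lambda>v. aug (v 2))"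
  unfolding lifts_def mem_Collect_eq F_simps
proof (intro conjI allI ballI)
  show "left_hom std_act (std_free (Suc (2 + n))) std_act (std_free (Suc n)) (shift_\<theta> n)" for n
    by (simp add: left_hom_def shift_\<theta>_def std_act_def std_free_def fun_eq_iff scale_right_distrib scale_mult_right)
  show "aug (shift_\<theta> 0 v 0) = aug (v 2)" for v by (simp add: shift_\<theta>_def numeral_2_eq_2)
  show "shift_\<theta> n (dif (2 + n) v) = dif n (shift_\<theta> (Suc n) v)" for n v
  proof (cases n rule: even_odd_cases)
    case (1 m)
    show ?thesis unfolding 1
    proof (rule ext_even[of m])
      fix j assume "j \<le> m"
      \<comment> \<open>Writing \<open>m\<close> as \<open>j + t\<close> removes the truncated
        subtractions from the exponents of \<open>c\<close>.\<close>
      then obtain t where m: "m = j + t" using le_Suc_ex by blast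
      have "(Suc (2 * t)) div 2 = t" "Suc (2 * (j + t)) - 2 * j = Suc (2 * t)" by simp_all
      then show "shift_\<theta> (2 * m) (dif (2 + 2 * m) v) (2 * j) = dif (2 * m) (shift_\<theta> (Suc (2 * m)) v) (2 * j)"
        by (simp add: m shift_\<theta>_def dif_def scale_right_distrib scale_mult_left)
    next
      fix j assume "j < m"
      then obtain t where m: "m = Suc (j + t)" using less_imp_Suc_add by blast
      have "(Suc (2 * t)) div 2 = t" "(Suc (Suc (Suc (2 * t)))) div 2 = Suc t"
        "Suc (2 * (j + t)) - 2 * j = Suc (2 * t)" "Suc (Suc (Suc (2 * (j + t)))) - 2 * j = Suc (Suc (Suc (2 * t)))"
        "Suc (Suc (2 * (j + t))) - 2 * j = Suc (Suc (2 * t))" by simp_all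
      then show "shift_\<theta> (2 * m) (dif (2 + 2 * m) v) (Suc (2 * j)) = dif (2 * m) (shift_\<theta> (Suc (2 * m)) v) (Suc (2 * j))"
        by (simp add: m shift_\<theta>_def dif_def scale_right_distrib scale_mult_left mult.assoc mult.left_commute add.commute[of t j] flip: power_add)
    qed (simp add: shift_\<theta>_def dif_gt)
  next
    case (2 m)
    show ?thesis unfolding 2
    proof (rule ext_odd[of m])
      fix j assume "j \<le> m"
      then obtain t where m: "m = j + t" using le_Suc_ex by blast
      have "(Suc (2 * t)) div 2 = t" "Suc (2 * (j + t)) - 2 * j = Suc (2 * t)" "Suc (Suc (2 * (j + t))) - 2 * j = Suc (Suc (2 * t))" by simp_all
      then show "shift_\<theta> (Suc (2 * m)) (dif (2 + Suc (2 * m)) v) (2 * j) = dif (Suc (2 * m)) (shift_\<theta> (Suc (Suc (2 * m))) v) (2 * j)"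
          "shift_\<theta> (Suc (2 * m)) (dif (2 + Suc (2 * m)) v) (Suc (2 * j)) = dif (Suc (2 * m)) (shift_\<theta> (Suc (Suc (2 * m))) v) (Suc (2 * j))"
        by (simp_all add: m shift_\<theta>_def dif_def scale_right_distrib scale_mult_left mult.assoc mult.left_commute add.commute[of t j] flip: power_add)
    qed (simp add: shift_\<theta>_def dif_gt)
  qed
qed

end

section \<open>Generation in degrees one and two\<close>

lemma lifts_cong:
  assumes "G \<in> lifts R Q n g" "\<And>u. u \<in> res_mod R n \<Longrightarrow> g u = g' u"
  shows "G \<in> lifts R Q n g'"
  using assms by (simp add: lifts_def)

lemma (in trivial_resolution) homogeneous_sum_generated:
  assumes "\<And>i. i \<in> A \<Longrightarrow> h i \<in> cocycles scale R n \<and> homogeneous n (h i) \<in> subalgebra_gen E S"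
  shows "homogeneous n (\<lambda>u. \<Sum>i\<in>A. t i * h i u) \<in> subalgebra_gen E S"
proof -
  \<comment> \<open>The empty sum needs the zero element, which is obtained as 0 times the unit: a
    zero class placed in degree 0 is also one placed in degree \<open>n\<close>.\<close>
  have zero: "homogeneous n 0 \<in> subalgebra_gen E S"
  proof -
    have "0 \<odot>\<^bsub>E\<^esub> \<one>\<^bsub>E\<^esub> \<in> subalgebra_gen E S" by (intro subalgebra_gen.smult subalgebra_gen.one)
    moreover have "0 \<odot>\<^bsub>E\<^esub> \<one>\<^bsub>E\<^esub> = homogeneous 0 0"
      unfolding ext_one homogeneous_smult[OF aug_cocycle] by (simp add: zero_fun_def)
    moreover have "homogeneous 0 0 = homogeneous n 0"
      by (simp add: homogeneous_def fun_eq_iff ext_class_zero)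
    ultimately show ?thesis by metis
  qed
  have "(\<lambda>u. \<Sum>i\<in>A. t i * h i u) \<in> cocycles scale R n \<and>
      homogeneous n (\<lambda>u. \<Sum>i\<in>A. t i * h i u) \<in> subalgebra_gen E S"
    using assms
  proof (induction A rule: infinite_finite_induct)
    case (insert a A)
    let ?f = "\<lambda>u. t a * h a u" and ?g = "\<lambda>u. \<Sum>i\<in>A. t i * h i u"
    have f: "?f \<in> cocycles scale R n" "homogeneous n ?f \<in> subalgebra_gen E S"
      using insert.prems[of a] cocycles_smult[of "h a" n "t a"] homogeneous_smult[of "h a" n "t a"]
        subalgebra_gen.smult[of "homogeneous n (h a)" E S "t a"] by auto
    have g: "?g \<in> cocycles scale R n" "homogeneous n ?g \<in> subalgebra_gen E S"
      using insert by auto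
    have "(\<lambda>u. \<Sum>i\<in>insert a A. t i * h i u) = ?f + ?g" using insert.hyps by (simp add: fun_eq_iff)
    then show ?case
      using cocycles_add[OF f(1) g(1)] homogeneous_add[OF f(1) g(1)] subalgebra_gen.add[OF f(2) g(2)] by simp
  qed (use zero cocycles_zero in \<open>simp_all add: zero_fun_def\<close>)
  then show ?thesis ..
qed

section \<open>Transport of the generators to an arbitrary resolution\<close>

locale koszul_resolution =
  koszul_data scale \<omega> x y \<psi>\<^sub>1 \<psi>\<^sub>2 \<sigma>\<^sub>1 \<sigma>\<^sub>2 \<theta>\<^sub>1 \<theta>\<^sub>2 \<rho>\<^sub>1 \<rho>\<^sub>2 \<rho>\<^sub>3 \<rho>\<^sub>4 c + R: trivial_resolution scale R
  for scale :: "'k::field \<Rightarrow> 'l::ring_1 \<Rightarrow> 'l"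
    and \<omega> x y \<psi>\<^sub>1 \<psi>\<^sub>2 \<sigma>\<^sub>1 \<sigma>\<^sub>2 \<theta>\<^sub>1 \<theta>\<^sub>2 \<rho>\<^sub>1 \<rho>\<^sub>2 \<rho>\<^sub>3 \<rho>\<^sub>4 c
    and R :: "('l, 'p::ab_group_add, 'k) resolution"

sublocale koszul_resolution \<subseteq> F: trivial_resolution scale F
  by unfold_locales (fact residue F_resolution)+

context koszul_resolution
begin

definition \<Psi> where "\<Psi> = (SOME G. G \<in> lifts R F 0 (res_aug R))"

lemma \<Psi>: "\<Psi> \<in> lifts R F 0 (res_aug R)"
proof -
  interpret two_trivial_resolutions scale R F ..
  have "\<exists>G. G \<in> lifts R F 0 (res_aug R)"
    by (rule lifts_exist[OF R.res_aug_hom R.res_aug_d])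
  then show ?thesis unfolding \<Psi>_def by (rule someI_ex)
qed

definition \<epsilon> :: "nat \<Rightarrow> nat \<Rightarrow> (nat \<Rightarrow> 'l) \<Rightarrow> 'k" where
  "\<epsilon> n i v = (if v \<in> std_free (Suc n) then aug (v i) else 0)"

lemma \<epsilon>: "\<epsilon> n i \<in> cocycles scale F n"
proof -
  have "left_hom std_act (std_free (Suc n)) (trivial_act scale) UNIV (\<lambda>v. aug (v i))"
    by (simp add: left_hom_def std_act_def trivial_act_def aug_add aug_mult)
  from F.cochains_restrict[of n "\<lambda>v. aug (v i)"] this
  have "\<epsilon> n i \<in> cochains scale F n" by (simp add: \<epsilon>_def[abs_def])
  moreover have "\<epsilon> n i (dif n v) = 0" for v by (simp add: \<epsilon>_def aug_dif)
  ultimately show ?thesis by (simp add: F.cocycles_iff)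
qed

text \<open>The class dual to generator \<open>i\<close> of \<open>F\<close> in degree
  \<open>n\<close>, pulled back to \<open>R\<close>.\<close>

definition e :: "nat \<Rightarrow> nat \<Rightarrow> 'p \<Rightarrow> 'k" where
  "e n i u = (if u \<in> res_mod R n then \<epsilon> n i (\<Psi> n u) else 0)"

lemma e: "e n i \<in> cocycles scale R n"
proof -
  interpret two_trivial_resolutions scale R F ..
  show ?thesis using cocycle_lift[OF \<Psi> \<epsilon>, of n i] by (simp add: e_def[abs_def])
qed

lemma e_eq: "u \<in> res_mod R n \<Longrightarrow> e n i u = aug (\<Psi> n u i)"
  using left_hom_mem[OF liftsD(1)[OF \<Psi>, of n]] by (simp add: e_def \<epsilon>_def)

text \<open>Going from \<open>R\<close> to \<open>F\<close> and back is homotopic to the identity,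
  so \<open>f\<close> may be replaced by its composite with this chain map. That composite factors
  through a map from a finite free module to k, which is a combination of coordinates.\<close>

lemma cocycle_expand:
  assumes f: "f \<in> cocycles scale R n"
  shows "\<exists>a. R.homogeneous n f = R.homogeneous n (\<lambda>u. \<Sum>i\<le>n. a i * e n i u)"
proof -
  interpret FR: two_trivial_resolutions scale F R ..
  interpret RR: two_trivial_resolutions scale R R ..
  obtain \<Phi> where \<Phi>: "\<Phi> \<in> lifts F R 0 (res_aug F)"
    using FR.lifts_exist[OF F.res_aug_hom F.res_aug_d] by blast
  have comp: "(\<lambda>i u. \<Phi> i (\<Psi> i u)) \<in> lifts R R 0 (res_aug R)"
    by (rule lifts_cong[OF lifts_comp[OF \<Psi> \<Phi>, simplified]]) (use liftsD(2)[OF \<Psi>] in simp)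
  have f_cut: "(\<lambda>u. if u \<in> res_mod R n then f u else 0) = f"
    using R.cocycles_outside[OF f] by (auto simp: fun_eq_iff)
  have "f - (\<lambda>u. if u \<in> res_mod R n then f (\<Phi> n (\<Psi> n u)) else 0) \<in> coboundaries scale R n"
    using RR.lift_unique[OF lifts_ident comp f, unfolded add_0_left f_cut] .
  from R.homogeneous_cong[OF this]
  have "R.homogeneous n f = R.homogeneous n (\<lambda>u. if u \<in> res_mod R n then f (\<Phi> n (\<Psi> n u)) else 0)" .
  also have "(\<lambda>u. if u \<in> res_mod R n then f (\<Phi> n (\<Psi> n u)) else 0)
      = (\<lambda>u. \<Sum>i\<le>n. f (\<Phi> n (unit_vec i)) * e n i u)"
  proof
    fix u
    show "(if u \<in> res_mod R n then f (\<Phi> n (\<Psi> n u)) else 0) = (\<Sum>i\<le>n. f (\<Phi> n (unit_vec i)) * e n i u)"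
    proof (cases "u \<in> res_mod R n")
      case True
      let ?v = "\<Psi> n u"
      have hom: "left_hom std_act (std_free (Suc n)) (trivial_act scale) UNIV (\<lambda>v. f (\<Phi> n v))"
        using left_hom_comp[OF liftsD(1)[OF \<Phi>, of n] R.cocycles_hom[of f n]] f by simp
      have unit: "unit_vec i \<in> (std_free (Suc n) :: (nat \<Rightarrow> 'l) set)" if "i < Suc n" for i
        using that by (auto simp: unit_vec_def std_free_def)
      have "?v \<in> std_free (Suc n)" using left_hom_mem[OF liftsD(1)[OF \<Psi>, of n]] True by simp
      from std_expand[OF this]
      have "f (\<Phi> n ?v) = f (\<Phi> n (\<Sum>i<Suc n. std_act (?v i) (unit_vec i)))" by (rule arg_cong)
      also have "\<dots> = (\<Sum>i<Suc n. f (\<Phi> n (std_act (?v i) (unit_vec i))))"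
        by (rule left_hom_sum[OF hom left_module_std])
          (use unit left_module.act_mem[OF left_module_std] in blast)
      also have "\<dots> = (\<Sum>i<Suc n. aug (?v i) * f (\<Phi> n (unit_vec i)))"
        by (rule sum.cong) (use left_hom_act[OF hom unit] in \<open>simp_all add: trivial_act_def\<close>)
      also have "\<dots> = (\<Sum>i\<le>n. f (\<Phi> n (unit_vec i)) * e n i u)"
        unfolding lessThan_Suc_atMost by (rule sum.cong) (use e_eq[OF True] in \<open>simp_all add: mult.commute\<close>)
      finally show ?thesis using True by simp
    qed (simp add: e_def)
  qed
  finally show ?thesis by (intro exI[of _ "\<lambda>i. f (\<Phi> n (unit_vec i))"])
qed

text \<open>The cocycle \<open>e 2 k\<close> has two lifts to chain maps from \<open>R\<close> to
  \<open>F\<close>: one lifts it inside \<open>R\<close> and then applies \<open>\<Psi>\<close>, the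
  other applies \<open>\<Psi>\<close> and then \<open>S\<close>. The first computes the Yoneda
  product, the second the coordinate; by uniqueness of lifts they agree up to a coboundary.\<close>

lemma e_product:
  assumes S: "S \<in> lifts F F 2 (\<lambda>v. aug (v k))"
    and Si: "\<And>v. aug (S n v i') = t * aug (v i)"
  shows "R.homogeneous n (e n i') \<otimes>\<^bsub>R.E\<^esub> R.homogeneous 2 (e 2 k) = t \<odot>\<^bsub>R.E\<^esub> R.homogeneous (n + 2) (e (n + 2) i)"
proof -
  interpret RF: two_trivial_resolutions scale R F ..
  obtain G where G: "G \<in> chain_lifts R 2 (e 2 k)" using R.chain_lifts_exist[OF e] .
  then have G': "G \<in> lifts R R 2 (e 2 k)" by (simp add: chain_lifts_eq)
  have 1: "(\<lambda>i u. \<Psi> i (G i u)) \<in> lifts R F 2 (e 2 k)"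
  proof (rule lifts_cong[OF lifts_comp[OF G' \<Psi>, unfolded add_0_left add_0_right]])
    show "res_aug R (G 0 u) = e 2 k u" if "u \<in> res_mod R 2" for u
      using liftsD(2)[OF G' that] .
  qed
  have 2: "(\<lambda>i u. S i (\<Psi> (2 + i) u)) \<in> lifts R F 2 (e 2 k)"
    by (rule lifts_cong[OF lifts_comp[OF \<Psi> S, unfolded add_0_left]]) (simp add: e_eq)
  have "(\<lambda>u. if u \<in> res_mod R (n + 2) then e n i' (G n u) else 0) - (\<lambda>u. t * e (n + 2) i u) \<in> coboundaries scale R (n + 2)"
  proof -
    have eq1: "(\<lambda>u. if u \<in> res_mod R (2 + n) then \<epsilon> n i' (\<Psi> n (G n u)) else 0)
        = (\<lambda>u. if u \<in> res_mod R (n + 2) then e n i' (G n u) else 0)"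
      unfolding add.commute[of 2 n] using left_hom_mem[OF liftsD(1)[OF G', of n]]
      by (auto simp: e_def fun_eq_iff)
    have eq2: "(\<lambda>u. if u \<in> res_mod R (2 + n) then \<epsilon> n i' (S n (\<Psi> (2 + n) u)) else 0) = (\<lambda>u. t * e (n + 2) i u)"
    proof
      fix u
      show "(if u \<in> res_mod R (2 + n) then \<epsilon> n i' (S n (\<Psi> (2 + n) u)) else 0) = t * e (n + 2) i u"
      proof (cases "u \<in> res_mod R (2 + n)")
        case True
        have "S n (\<Psi> (2 + n) u) \<in> std_free (Suc n)" using left_hom_mem[OF liftsD(1)[OF 2, of n] True] by simp
        then have "\<epsilon> n i' (S n (\<Psi> (2 + n) u)) = t * e (2 + n) i u"
          unfolding e_eq[OF True] by (simp only: \<epsilon>_def if_True Si)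
        then show ?thesis using True by (simp only: if_True add.commute[of n 2])
      next
        case False
        then have "e (2 + n) i u = 0" by (simp only: e_def if_False)
        then show ?thesis using False by (simp only: if_False add.commute[of n 2] mult_zero_right)
      qed
    qed
    show ?thesis
      using RF.lift_unique[OF 1 2 \<epsilon>, of n i'] unfolding eq1 eq2 unfolding add.commute[of 2 n] .
  qed
  then have "R.homogeneous (n + 2) (\<lambda>u. if u \<in> res_mod R (n + 2) then e n i' (G n u) else 0)
      = R.homogeneous (n + 2) (\<lambda>u. t * e (n + 2) i u)" by (rule R.homogeneous_cong)
  then show ?thesis
    unfolding R.homogeneous_mult[OF e e G] R.homogeneous_smult[OF e] .
qed

definition gens where
  "gens = (\<lambda>i. R.homogeneous 1 (e 1 i)) ` {..1} \<union> (\<lambda>i. R.homogeneous 2 (e 2 i)) ` {..2}"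

lemma e_generated: "i \<le> n \<Longrightarrow> R.homogeneous n (e n i) \<in> subalgebra_gen R.E gens"
proof (induction n arbitrary: i rule: less_induct)
  case (less n)
  consider "n = 0" | "n = 1 \<or> n = 2" | "3 \<le> n" by linarith
  then show ?case
  proof cases
    case 1
    have "e 0 0 = R.aug_cocycle"
      using e_eq[of _ 0 0] liftsD(2)[OF \<Psi>] by (auto simp: fun_eq_iff R.aug_cocycle_def e_def)
    then show ?thesis using less.prems 1 subalgebra_gen.one[of R.E gens] by (simp add: R.ext_one)
  next
    case 2
    then have "R.homogeneous n (e n i) \<in> gens" using less.prems by (auto simp: gens_def)
    then show ?thesis by (rule subalgebra_gen.incl)
  next
    case 3
    \<comment> \<open>For \<open>m \<ge> 1\<close> the first \<open>m + 1\<close> and the last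
      two... coordinates in degree \<open>n\<close> cover everything. In degree two the middle
      coordinate, dual to \<psi>, would be missed, so that degree belongs to the base cases.\<close>
    define m where "m = n - 2"
    have n: "n = m + 2" and m: "1 \<le> m" using 3 by (simp_all add: m_def)
    have step: "R.homogeneous n (e n i) \<in> subalgebra_gen R.E gens"
      if S: "S \<in> lifts F F 2 (\<lambda>v. aug (v k))" "\<And>v. aug (S m v i') = t * aug (v i)"
        and t: "t \<noteq> 0" and k: "k \<le> 2" and i': "i' \<le> m" for S k i' t
    proof -
      have "R.homogeneous m (e m i') \<otimes>\<^bsub>R.E\<^esub> R.homogeneous 2 (e 2 k) \<in> subalgebra_gen R.E gens"
      proof (rule subalgebra_gen.mult)
        show "R.homogeneous m (e m i') \<in> subalgebra_gen R.E gens" using less.IH i' n by simp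
        show "R.homogeneous 2 (e 2 k) \<in> subalgebra_gen R.E gens"
          using k by (intro subalgebra_gen.incl) (simp add: gens_def)
      qed
      then have "t \<odot>\<^bsub>R.E\<^esub> R.homogeneous n (e n i) \<in> subalgebra_gen R.E gens"
        unfolding e_product[OF S] n .
      from subalgebra_gen.smult[OF this, of "inverse t"]
      have "R.homogeneous n (\<lambda>u. inverse t * (t * e n i u)) \<in> subalgebra_gen R.E gens"
        unfolding R.homogeneous_smult[OF e] R.homogeneous_smult[OF R.cocycles_smult[OF e]] .
      moreover have "(\<lambda>u. inverse t * (t * e n i u)) = e n i" using t by (simp add: fun_eq_iff)
      ultimately show ?thesis by (simp only:)
    qed
    show ?thesis
    proof (cases "i \<le> m")
      case True
      show ?thesis
      proof (rule step[OF shift_\<sigma>_lifts, of i 1])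
        show "aug (shift_\<sigma> m v i) = 1 * aug (v i)" for v using True by (simp add: shift_\<sigma>_def)
      qed (use True in auto)
    next
      case False
      define i' where "i' = i - 2"
      \<comment> \<open>Here \<open>i > m\<close> and \<open>m \<ge> 1\<close>, so
        \<open>i \<ge> 2\<close> and the subtraction of 2 is exact.\<close>
      have i: "i = Suc (Suc i')" "i' \<le> m" using False m less.prems n by (simp_all add: i'_def)
      show ?thesis
      proof (rule step[OF shift_\<theta>_lifts, of i' "c ^ ((m - i') div 2)"])
        show "aug (shift_\<theta> m v i') = c ^ ((m - i') div 2) * aug (v i)" for v
          using i by (simp add: shift_\<theta>_def aug_scale)
      qed (use i c_nz in auto)
    qed
  qed
qed

lemma homogeneous_generated:
  assumes "f \<in> cocycles scale R n" shows "R.homogeneous n f \<in> subalgebra_gen R.E gens"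
proof -
  obtain a where "R.homogeneous n f = R.homogeneous n (\<lambda>u. \<Sum>i\<le>n. a i * e n i u)"
    using cocycle_expand[OF assms] by blast
  also have "\<dots> \<in> subalgebra_gen R.E gens"
    by (rule R.homogeneous_sum_generated) (simp add: e e_generated)
  finally show ?thesis .
qed

lemma gens_homogeneous: "gens \<subseteq> Ext_homogeneous scale R 1 \<union> Ext_homogeneous scale R 2"
  using R.homogeneous_mem[OF e, of 1] R.homogeneous_mem[OF e, of 2] unfolding gens_def by blast

lemma Ext_generated:
  shows "finitely_generated_algebra R.E \<and>
   generates_algebra R.E (Ext_homogeneous scale R 1 \<union> Ext_homogeneous scale R 2)"
proof -
  \<comment> \<open>Stated for every intermediate set, as it is used for the finite set
    \<open>gens\<close> and for all elements of degrees one and two.\<close>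
  have gen: "generates_algebra R.E S"
    if "gens \<subseteq> S" "S \<subseteq> Ext_homogeneous scale R 1 \<union> Ext_homogeneous scale R 2" for S
  proof -
    have S: "S \<subseteq> carrier R.E" using that(2) by (auto simp: Ext_homogeneous_def)
    have "carrier R.E \<subseteq> subalgebra_gen R.E S"
      by (rule R.carrier_subset_subalgebra_gen) (rule subalgebra_gen_mono[OF homogeneous_generated that(1)])
    then show ?thesis using S R.subalgebra_gen_subset_carrier[OF S] by (auto simp: generates_algebra_def)
  qed
  have "finite gens" by (simp add: gens_def)
  then have "finitely_generated_algebra R.E"
    unfolding finitely_generated_algebra_def using gen[OF subset_refl gens_homogeneous] by (intro exI[of _ gens] conjI)
  then show ?thesis using gen[OF gens_homogeneous subset_refl] by (rule conjI)
qed

end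

theorem theorem5p3:
  fixes scale :: "'k::field \<Rightarrow> 'l::ring_1 \<Rightarrow> 'l"
    and x y \<psi>\<^sub>1 \<psi>\<^sub>2 \<sigma>\<^sub>1 \<sigma>\<^sub>2 \<theta>\<^sub>1 \<theta>\<^sub>2 \<rho>\<^sub>1 \<rho>\<^sub>2 \<rho>\<^sub>3 \<rho>\<^sub>4 \<omega> :: 'l
    and c :: 'k
    and R :: "('l, 'p::ab_group_add, 'k) resolution"
  assumes "fd_algebra scale"
    and "generates_algebra (type_algebra scale) {x, y}"
    and "local_ring TYPE('l)"
    and "selfinjective TYPE('l)"
    and "residue_field_is_base scale"
    and "jacobson_radical = {a * x + b * y | a b. True}"
    and "lin_indep_mod scale (ideal_times (*) jacobson_radical jacobson_radical) x y"
    \<comment> \<open>(1)\<close>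
    and "minimal_relation x y (\<psi>\<^sub>1, \<psi>\<^sub>2)"
    and "\<psi>\<^sub>1 \<in> jacobson_radical" and "\<psi>\<^sub>2 \<in> jacobson_radical" and "lin_indep_mod scale (ideal_times (*) jacobson_radical jacobson_radical) \<psi>\<^sub>1 \<psi>\<^sub>2"
    \<comment> \<open>(2)\<close>
    and "minimal_relation x y (\<sigma>\<^sub>1, \<sigma>\<^sub>2)"
    and "minimal_relation x y (\<theta>\<^sub>1, \<theta>\<^sub>2)"
    and "lin_indep_mod (act2 scale) (range (\<lambda>a. act2 (*) a (\<psi>\<^sub>1, \<psi>\<^sub>2))) (\<sigma>\<^sub>1, \<sigma>\<^sub>2) (\<theta>\<^sub>1, \<theta>\<^sub>2)"
    \<comment> \<open>(3)\<close>
    and "act2 (*) x (\<sigma>\<^sub>1, \<sigma>\<^sub>2) + act2 (*) \<rho>\<^sub>1 (\<psi>\<^sub>1, \<psi>\<^sub>2) = 0"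
    and "act2 (*) y (\<sigma>\<^sub>1, \<sigma>\<^sub>2) + act2 (*) \<rho>\<^sub>2 (\<psi>\<^sub>1, \<psi>\<^sub>2) = 0"
    and "act2 (*) x (\<theta>\<^sub>1, \<theta>\<^sub>2) + act2 (*) \<rho>\<^sub>3 (\<psi>\<^sub>1, \<psi>\<^sub>2) = 0"
    and "act2 (*) y (\<theta>\<^sub>1, \<theta>\<^sub>2) + act2 (*) \<rho>\<^sub>4 (\<psi>\<^sub>1, \<psi>\<^sub>2) = 0"
    and "\<sigma>\<^sub>1 * \<rho>\<^sub>1 + \<sigma>\<^sub>2 * \<rho>\<^sub>2 = 0"
    and "\<psi>\<^sub>1 * \<rho>\<^sub>1 + \<psi>\<^sub>2 * \<rho>\<^sub>2 = 0"
    and "\<psi>\<^sub>1 * \<rho>\<^sub>3 + \<psi>\<^sub>2 * \<rho>\<^sub>4 = 0"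
    and "\<theta>\<^sub>1 * \<rho>\<^sub>3 + \<theta>\<^sub>2 * \<rho>\<^sub>4 = 0"
    and "\<omega> \<noteq> 0" and "\<omega> \<in> socle" and "\<theta>\<^sub>1 * \<rho>\<^sub>1 + \<theta>\<^sub>2 * \<rho>\<^sub>2 = \<omega>"
    and "c \<noteq> 0"
    and "\<theta>\<^sub>1 * \<rho>\<^sub>1 + \<theta>\<^sub>2 * \<rho>\<^sub>2 + scale c (\<sigma>\<^sub>1 * \<rho>\<^sub>3 + \<sigma>\<^sub>2 * \<rho>\<^sub>4) = 0"
    and "free_resolution (trivial_act scale) (UNIV :: 'k set) R"
  shows "finitely_generated_algebra (Ext_algebra scale R) \<and>
         generates_algebra (Ext_algebra scale R)
           (Ext_homogeneous scale R 1 \<union> Ext_homogeneous scale R 2)"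
proof -
  interpret fd_algebra scale by fact
  interpret koszul_resolution scale \<omega> x y \<psi>\<^sub>1 \<psi>\<^sub>2 \<sigma>\<^sub>1 \<sigma>\<^sub>2 \<theta>\<^sub>1 \<theta>\<^sub>2 \<rho>\<^sub>1 \<rho>\<^sub>2 \<rho>\<^sub>3 \<rho>\<^sub>4 c R
  proof unfold_locales
    show "\<sigma>\<^sub>1 * x + \<sigma>\<^sub>2 * y = 0" "\<theta>\<^sub>1 * x + \<theta>\<^sub>2 * y = 0"
      using assms(12,13) by (simp_all add: minimal_relation_def Omega2_def)
    show "x * \<sigma>\<^sub>1 + \<rho>\<^sub>1 * \<psi>\<^sub>1 = 0" "x * \<sigma>\<^sub>2 + \<rho>\<^sub>1 * \<psi>\<^sub>2 = 0"
      "y * \<sigma>\<^sub>1 + \<rho>\<^sub>2 * \<psi>\<^sub>1 = 0" "y * \<sigma>\<^sub>2 + \<rho>\<^sub>2 * \<psi>\<^sub>2 = 0"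
      "x * \<theta>\<^sub>1 + \<rho>\<^sub>3 * \<psi>\<^sub>1 = 0" "x * \<theta>\<^sub>2 + \<rho>\<^sub>3 * \<psi>\<^sub>2 = 0"
      "y * \<theta>\<^sub>1 + \<rho>\<^sub>4 * \<psi>\<^sub>1 = 0" "y * \<theta>\<^sub>2 + \<rho>\<^sub>4 * \<psi>\<^sub>2 = 0"
      using assms(15-18) by (simp_all add: act2_def zero_prod_def)
    show "\<omega> + scale c (\<sigma>\<^sub>1 * \<rho>\<^sub>3 + \<sigma>\<^sub>2 * \<rho>\<^sub>4) = 0" using assms(25,27) by simp
  qed (fact assms)+
  show ?thesis by (rule Ext_generated)
qed

end
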